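(* Let $K$ be a quadratic number field and let $E$ be an elliptic curve over $K$ such that the group $E(K)$ contains a subgroup isomorphic to $C_{16}=\mathbb{Z}/16\mathbb{Z}$. Then $E$ is a base change of an elliptic curve over $\mathbb{Q}$, i.e. there exists an elliptic curve $E_0$ over $\mathbb{Q}$ such that $E_0\times_{\mathbb{Q}}K\cong E$ over $K$. *)

theory Defs
  imports Complex_Main "HOL-Algebra.Elementary_Groups"
begin

definition quadratic_field :: "complex set \<Rightarrow> bool" where
  "quadratic_field K \<longleftrightarrow>
     (\<exists>d::int. (\<nexists>m::int. d = m^2) \<and>
        K = {of_rat p + of_rat q * csqrt (of_int d) | p q. True})"

datatype weier = Weier complex complex complex complex complex

fun wcoeffs :: "weier \<Rightarrow> complex set" where
  "wcoeffs (Weier a1 a2 a3 a4 a6) = {a1, a2, a3, a4, a6}"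

fun wpoly :: "weier \<Rightarrow> complex \<Rightarrow> complex \<Rightarrow> complex" where
  "wpoly (Weier a1 a2 a3 a4 a6) x y =
     y^2 + a1*x*y + a3*y - (x^3 + a2*x^2 + a4*x + a6)"

fun wdisc :: "weier \<Rightarrow> complex" where
  "wdisc (Weier a1 a2 a3 a4 a6) =
    (let b2 = a1^2 + 4*a2; b4 = 2*a4 + a1*a3; b6 = a3^2 + 4*a6;
         b8 = a1^2*a6 + 4*a2*a6 - a1*a3*a4 + a2*a3^2 - a4^2
     in - (b2^2*b8) - 8*b4^3 - 27*b6^2 + 9*b2*b4*b6)"

definition elliptic_over :: "complex set \<Rightarrow> weier \<Rightarrow> bool" where
  "elliptic_over F E \<longleftrightarrow> wcoeffs E \<subseteq> F \<and> wdisc E \<noteq> 0"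

text \<open>Points: None is the point at infinity O.\<close>
type_synonym pt = "(complex \<times> complex) option"

fun on_curve :: "weier \<Rightarrow> pt \<Rightarrow> bool" where
  "on_curve E None = True"
| "on_curve E (Some (x, y)) = (wpoly E x y = 0)"

fun wadd :: "weier \<Rightarrow> pt \<Rightarrow> pt \<Rightarrow> pt" where
  "wadd E None Q = Q"
| "wadd E P None = P"
| "wadd (Weier a1 a2 a3 a4 a6) (Some (x1, y1)) (Some (x2, y2)) =
    (if x1 = x2 \<and> y1 + y2 + a1*x2 + a3 = 0 then None
     else
       (let l = (if x1 = x2 then (3*x1^2 + 2*a2*x1 + a4 - a1*y1) / (2*y1 + a1*x1 + a3)
                 else (y2 - y1) / (x2 - x1));
            v = y1 - l*x1;
            x3 = l^2 + a1*l - a2 - x1 - x2;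
            y3 = - (l + a1)*x3 - v - a3
        in Some (x3, y3)))"

definition rat_points :: "complex set \<Rightarrow> weier \<Rightarrow> pt monoid" where
  "rat_points F E =
     \<lparr> carrier = {P. on_curve E P \<and> (\<forall>x y. P = Some (x, y) \<longrightarrow> x \<in> F \<and> y \<in> F)},
       mult = wadd E, one = None \<rparr>"

definition iso_over :: "complex set \<Rightarrow> weier \<Rightarrow> weier \<Rightarrow> bool" where
  "iso_over F E' E \<longleftrightarrow>
     (\<exists>u r s t. u \<in> F \<and> r \<in> F \<and> s \<in> F \<and> t \<in> F \<and> u \<noteq> 0 \<and>
        (\<forall>x y. wpoly E (u^2*x + r) (u^3*y + s*u^2*x + t) = u^6 * wpoly E' x y))"

end

theory Submission
  imports Defs "HOL-Computational_Algebra.Computational_Algebra"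
begin

text \<open>
  Let \<open>P\<close> generate the subgroup. Move \<open>8P\<close> to the origin and scale \<open>4P\<close> to abscissa 1: the curve becomes
  \<open>y\<^sup>2 = x\<^sup>3 + A x\<^sup>2 + x\<close>, and if \<open>h\<^sup>2\<close> is the abscissa of \<open>2P\<close> then \<open>A\<close> is a rational function of \<open>h\<close>. So it
  suffices that \<open>h\<close> is rational. The existence of \<open>P\<close> gives, after a choice of sign for \<open>h\<close>, a \<open>K\<close>-point with
  abscissa \<open>(1 - h) / (1 + h)\<close> on the curve \<open>C\<close> of genus two \<open>y\<^sup>2 = f(x) = x\<^sup>5 + 2x\<^sup>4 + 2x\<^sup>2 - x\<close> (a model of \<open>X\<^sub>1(16)\<close>).

  If \<open>h\<close> were irrational, this point and its conjugate would give a rational point of the Jacobian \<open>J\<close> of \<open>C\<close>, with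
  Mumford form \<open>(u, v)\<close> and \<open>u\<close> irreducible. The claim is that \<open>u\<close> can only be \<open>x\<^sup>2 + 1\<close> or \<open>x\<^sup>2 + 2x - 1\<close>; both belong to
  singular curves. For its proof, a descent shows that every rational point of \<open>J\<close> is twice another one up to
  translation by rational points of order two (the rational points of \<open>C\<close> that are needed on the way come from
  Fermat's theorems on \<open>x\<^sup>4 + y\<^sup>4 = z\<^sup>2\<close> and \<open>x\<^sup>4 - y\<^sup>4 = z\<^sup>2\<close>). There are Kummer coordinates with values
  in the eighth cyclotomic field for which these translations are multiplication by \<open>i\<close> and \<open>\<surd>2\<close>, and doubling
  is, up to a fixed linear map, the square of the complex conjugate. So the coordinates of a rational point lie
  in the image of every iterate of an explicit quadratic map, which contracts \<open>2\<close>-adically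
  towards finitely many points.
\<close>

section \<open>Divisor classes in Mumford form\<close>

text \<open>A descent alone would leave open the finite generation of \<open>J(Q)\<close> and the
  torsion of odd order, on which doubling is bijective. The contraction settles both at once. Up to
  sign and the rational translations, \<open>J(Q)\<close> consists of the origin and two classes of
  order five that doubling interchanges; their vectors \<open>(1,0,0,0)\<close>,
  \<open>(1,1,0,0)\<close>, \<open>(0,1,1,0)\<close> form an attracting fixed point and an
  attracting 2-cycle. A vector with arbitrarily long chains of halves lies on this attractor,
  because an integer divisible by all powers of 2 is zero.

  Two features of \<open>C\<close> make the formulas manageable. The factorization
  \<open>f = x (x^2 + 1) (x^2 + 2x - 1)\<close> gives the two translations and three norms whose
  product is a square. The automorphism \<open>(x, y) -> (-1/x, y/x^3)\<close> has order four and
  acts on \<open>J\<close> as a square root of -1; halving works with a cubic and its reversal under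
  it. Translations use \<open>mumfordI\<close> in the usual way: interpolate by a cubic
  \<open>c\<close>, remove the known factors of \<open>c^2 - f\<close>, and keep the new
  quadratic.\<close>

text \<open>Mumford forms: \<open>x\<^sup>2 + a x + b\<close> divides \<open>x\<^sup>5 + 2x\<^sup>4 + 2x\<^sup>2 - x - (v1 x + v0)\<^sup>2\<close>. The two equations say that the
  remainder vanishes; the quotient is \<open>x\<^sup>3 + (2-a) x\<^sup>2 + (a\<^sup>2-2a-b) x + w\<close>, where \<open>w\<close> is the expression that occurs twice.\<close>

definition mumford :: "rat \<Rightarrow> rat \<Rightarrow> rat \<Rightarrow> rat \<Rightarrow> bool" where
  "mumford a b v1 v0 \<longleftrightarrow>
     b*(a^2-2*a-b) + a*(2 - v1^2 - a*(a^2-2*a-b) - b*(2-a)) + 1 + 2*v1*v0 = 0 \<and>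
     v0^2 + b*(2 - v1^2 - a*(a^2-2*a-b) - b*(2-a)) = 0"

text \<open>The coordinate on the Kummer surface that is not determined by \<open>a\<close> and \<open>b\<close>.\<close>

definition kum :: "rat \<Rightarrow> rat \<Rightarrow> rat \<Rightarrow> rat" where
  "kum a b v = v^2 + a^3 - 2*a^2 - a*b + b - 1"

text \<open>Here the cubic \<open>c\<close> with coefficients \<open>c3, \<dots>, c0\<close> is congruent to \<open>-(v1 x + v0)\<close> modulo \<open>x\<^sup>2 + a x + b\<close>, and
  \<open>c\<^sup>2 - f\<close> is \<open>x\<^sup>2 + a x + b\<close> times the quartic with coefficients \<open>q4, \<dots>, q0\<close>.\<close>

lemma mumfordI:
  fixes a b c3 c2 c1 c0 q4 q3 q2 q1 q0 :: rat
  assumes f6: "c3^2 = q4" and f5: "2*c3*c2 - 1 = q3 + a*q4" and f4: "c2^2 + 2*c3*c1 - 2 = q2 + a*q3 + b*q4"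
    and f3: "2*c3*c0 + 2*c2*c1 = q1 + a*q2 + b*q3" and f2: "c1^2 + 2*c2*c0 - 2 = q0 + a*q1 + b*q2"
    and f1: "2*c1*c0 + 1 = a*q0 + b*q1" and f0: "c0^2 = b*q0"
    and v1: "v1 = a*l + b*c3 - c1" and v0: "v0 = b*l - c0" and l: "l = c2 - a*c3"
  shows "mumford a b v1 v0"
proof -
  \<comment> \<open>\<open>c3 x + l\<close> is the quotient of the cubic by
    \<open>x^2 + a x + b\<close>.\<close>
  have c2: "c2 = l + a*c3" by (simp add: l)
  have l1: "2*c3*l = 1 + q3 - a*q4" using f5 unfolding c2 f6[symmetric] by (simp add: algebra_simps power2_eq_square)
  have l2: "l^2 = 2 - a + q2 + b*q4 - 2*c1*c3" using f4 f6 l1 unfolding c2 by Groebner_Basis.algebra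
  have l3: "2*l*c1 = q1 + a*q2 + b*q3 - 2*c3*c0 - 2*a*c3*c1" using f3 unfolding c2 by Groebner_Basis.algebra
  have c1: "c1^2 = 2 + q0 + a*q1 + b*q2 - 2*l*c0 - 2*a*c3*c0" using f2 unfolding c2 by Groebner_Basis.algebra
  have "v1^2 = a^2*l^2 + b^2*c3^2 + c1^2 + a*b*(2*c3*l) - a*(2*l*c1) - 2*b*c3*c1"
    unfolding v1 by Groebner_Basis.algebra
  also have "\<dots> = 2 - 2*b + 2*a*b + q0 - 2*c0*l + b*l^2 - a^3 + 2*a^2"
    unfolding l1 l3 c1 l2 f6 by Groebner_Basis.algebra
  finally have w: "2 - v1^2 - a*(a^2-2*a-b) - b*(2-a) = - q0 + 2*c0*l - b*l^2"
    by (simp add: algebra_simps power2_eq_square power3_eq_cube)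
  have "v0^2 + b*(- q0 + 2*c0*l - b*l^2) = 0" using f0 unfolding v0 by Groebner_Basis.algebra
  moreover have "b*(a^2-2*a-b) + a*(- q0 + 2*c0*l - b*l^2) + 1 + 2*v1*v0 = 0"
  proof -
    have "2*v1*v0 = 2*a*b*l^2 - 2*a*l*c0 + b^2*(2*c3*l) - 2*b*c3*c0 - b*(2*l*c1) + 2*c1*c0"
      unfolding v1 v0 by Groebner_Basis.algebra
    also have "\<dots> = 2*a*b*l^2 - 2*a*l*c0 + b^2*(1 + q3 - a*q4) - 2*b*c3*c0 - b*(q1 + a*q2 + b*q3 - 2*c3*c0 - 2*a*c3*c1) + (a*q0+b*q1-1)"
      unfolding l1 l3 using f1 by simp
    finally show ?thesis using l2 by Groebner_Basis.algebra
  qed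
  ultimately show ?thesis unfolding mumford_def w by simp
qed

section \<open>Integral models and the descent conditions\<close>

lemma rat_cases_coprime:
  obtains p q :: int where "(x::rat) = of_int p / of_int q" "q > 0" "coprime p q"
proof (cases x)
  case (Fract p q)
  have "x = of_int p / of_int q" unfolding Fract(1) by (rule Fract_of_int_quotient)
  thus ?thesis using Fract(2,3) by (rule that)
qed

text \<open>Gauss's lemma: contents multiply, so for primitive \<open>U\<close> all of
  \<open>D\<close> divides the content of \<open>W\<close>.\<close>

lemma gauss_quotient:
  fixes U F W :: "int poly"
  assumes "smult D F = U * W" "content U = 1" "D \<noteq> 0"
  obtains V where "F = U * V"
proof -
  have "content (smult D F) = content W" using assms by (simp add: content_mult)
  hence "content W = \<bar>D\<bar> * content F" by (simp add: normalize_int_def)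
  hence "D dvd content W" by simp
  then obtain V where "W = smult D V"
    using const_poly_dvd_iff_dvd_content[of D W] by (auto simp: dvd_def)
  hence "smult D F = smult D (U * V)" using assms by simp
  hence "smult D (F - U * V) = 0" by (simp add: smult_diff_right)
  hence "F = U * V" using assms(3) by simp
  thus ?thesis by (rule that)
qed

lemma common_denominator_pair:
  fixes x y :: rat
  obtains E e g :: int where "E \<noteq> 0" "gcd (gcd E e) g = 1" "of_int E*x = of_int e" "of_int E*y = of_int g"
proof -
  obtain p q where x: "x = of_int p / of_int q" and q: "q > 0" by (rule rat_cases_coprime)
  obtain r s where y: "y = of_int r / of_int s" and s: "s > 0" by (rule rat_cases_coprime)
  define M where "M = q*s"
  define P where "P = p*s"
  define R where "R = r*q"
  have M0: "M \<noteq> 0" using q s by (simp add: M_def)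
  have Mx: "of_int M*x = of_int P" unfolding M_def P_def x using q by simp
  have My: "of_int M*y = of_int R" unfolding M_def R_def y using s by simp
  define d where "d = gcd (gcd M P) R"
  have d0: "d \<noteq> 0" using M0 by (simp add: d_def)
  have "d dvd gcd M P" and dR: "d dvd R" unfolding d_def by (rule gcd_dvd1, rule gcd_dvd2)
  hence dM: "d dvd M" and dP: "d dvd P" by simp_all
  obtain E where E: "M = d*E" using dM by (rule dvdE)
  obtain e where e: "P = d*e" using dP by (rule dvdE)
  obtain g where g: "R = d*g" using dR by (rule dvdE)
  define h where "h = gcd (gcd E e) g"
  have "h dvd gcd E e" and hg: "h dvd g" unfolding h_def by (rule gcd_dvd1, rule gcd_dvd2)
  hence hE: "h dvd E" and he: "h dvd e" by simp_all
  have "d*h dvd M" unfolding E by (rule mult_dvd_mono[OF dvd_refl hE])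
  moreover have "d*h dvd P" unfolding e by (rule mult_dvd_mono[OF dvd_refl he])
  moreover have "d*h dvd R" unfolding g by (rule mult_dvd_mono[OF dvd_refl hg])
  ultimately have "d*h dvd gcd (gcd M P) R" by (intro gcd_greatest)
  hence "d*h dvd d" by (fold d_def)
  hence "d*h dvd d*1" by simp
  hence "h dvd 1" using d0 dvd_mult_cancel_left by blast
  hence 1: "gcd (gcd E e) g = 1" unfolding h_def by simp
  have "of_int d * (of_int E * x) = of_int d * (of_int e :: rat)"
    using Mx unfolding E e by (simp only: of_int_mult mult.assoc)
  hence 2: "of_int E * x = of_int e" using d0 mult_left_cancel[of "of_int d :: rat"] by simp
  have "of_int d * (of_int E * y) = of_int d * (of_int g :: rat)"
    using My unfolding E g by (simp only: of_int_mult mult.assoc)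
  hence 3: "of_int E * y = of_int g" using d0 mult_left_cancel[of "of_int d :: rat"] by simp
  have "E \<noteq> 0" using E M0 by auto
  thus ?thesis by (rule that[OF _ 1 2 3])
qed

lemma integral_model:
  fixes m n B :: int
  assumes D: "mumford a b v1 v0" and n: "n \<noteq> 0" and a: "of_int n*a = of_int m" and b: "of_int n*b = of_int B"
    and prim: "gcd (gcd n m) B = 1"
  obtains E e g W3 W2 W1 W0 :: int where "E \<noteq> 0" "gcd (gcd E e) g = 1"
    "of_int E*v1 = of_int e" "of_int E*v0 = of_int g"
    "n*W3 = E^2" "n*W2 + m*W3 = 2*E^2" "n*W1 + m*W2 + B*W3 = 0" "n*W0 + m*W1 + B*W2 = 2*E^2 - e^2"
    "m*W0 + B*W1 = -(E^2) - 2*e*g" "B*W0 = -(g^2)"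
proof -
  obtain E e g :: int where E0: "E \<noteq> 0" and gE: "gcd (gcd E e) g = 1" and e: "of_int E*v1 = of_int e" and g: "of_int E*v0 = of_int g"
    by (rule common_denominator_pair)
  define w where "w = 2 - v1^2 - a*(a^2-2*a-b) - b*(2-a)"
  have D1: "b*(a^2-2*a-b) + a*w + 1 + 2*v1*v0 = 0" and D2: "v0^2 + b*w = 0"
    using D unfolding mumford_def w_def by auto
  obtain p q where w: "w = of_int p / of_int q" and q: "q > 0" by (rule rat_cases_coprime)
  hence w': "of_int q*w = of_int p" by simp
  \<comment> \<open>\<open>F\<close> is \<open>E^2 (f - v^2)\<close>, and \<open>W\<close> is
    \<open>E^2*n^2*q\<close> times the cofactor
    \<open>x^3 + (2-a) x^2 + (a^2-2a-b) x + w\<close>.\<close>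
  define W where "W = [:E^2*n^2*p, E^2*(m^2-2*m*n-B*n)*q, E^2*(2*n-m)*n*q, E^2*n^2*q:]"
  define F where "F = [:-(g^2), -(E^2)-2*e*g, 2*E^2-e^2, 0, 2*E^2, E^2:]"
  have eq: "x = y" if "(of_int x :: rat) = of_int y" for x y using that by simp
  have "smult (n^3*q) F = [:B, m, n:] * W"
  proof -
    note of_int = of_int_mult of_int_power of_int_diff of_int_minus of_int_add of_int_numeral
      a[symmetric] b[symmetric] w'[symmetric] e[symmetric] g[symmetric]
    let ?n = "of_int n :: rat" and ?q = "of_int q :: rat" and ?E = "of_int E :: rat"
    have 0: "n^3*q*(-(g^2)) = B*(E^2*n^2*p)"
    proof (rule eq)
      have "?n^3*?q*(-((?E*v0)^2)) - (?n*b)*(?E^2*?n^2*(?q*w)) = -(?n^3*?q*?E^2)*(v0^2+b*w)"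
        by Groebner_Basis.algebra
      thus "of_int (n^3*q*(-(g^2))) = (of_int (B*(E^2*n^2*p)) :: rat)" unfolding of_int D2 by simp
    qed
    have 1: "n^3*q*(-(E^2)-2*e*g) = B*(E^2*(m^2-2*m*n-B*n)*q) + m*(E^2*n^2*p)"
    proof (rule eq)
      have "?n^3*?q*(-(?E^2)-2*(?E*v1)*(?E*v0)) - ((?n*b)*(?E^2*((?n*a)^2-2*(?n*a)*?n-(?n*b)*?n)*?q) + (?n*a)*(?E^2*?n^2*(?q*w)))
        = -(?n^3*?q*?E^2)*(b*(a^2-2*a-b) + a*w + 1 + 2*v1*v0)"
        by Groebner_Basis.algebra
      thus "of_int (n^3*q*(-(E^2)-2*e*g)) = (of_int (B*(E^2*(m^2-2*m*n-B*n)*q) + m*(E^2*n^2*p)) :: rat)"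
        unfolding of_int D1 by simp
    qed
    have 2: "n^3*q*(2*E^2-e^2) = B*(E^2*(2*n-m)*n*q) + m*(E^2*(m^2-2*m*n-B*n)*q) + n*(E^2*n^2*p)"
    proof (rule eq)
      have "?n^3*?q*(2*?E^2-(?E*v1)^2) - ((?n*b)*(?E^2*(2*?n-?n*a)*?n*?q) + (?n*a)*(?E^2*((?n*a)^2-2*(?n*a)*?n-(?n*b)*?n)*?q) + ?n*(?E^2*?n^2*(?q*w)))
        = (?n^3*?q*?E^2)*(2 - v1^2 - a*(a^2-2*a-b) - b*(2-a) - w)"
        by Groebner_Basis.algebra
      thus "of_int (n^3*q*(2*E^2-e^2)) = (of_int (B*(E^2*(2*n-m)*n*q) + m*(E^2*(m^2-2*m*n-B*n)*q) + n*(E^2*n^2*p)) :: rat)"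
        unfolding of_int by (simp add: w_def)
    qed
    have 3: "0 = B*(E^2*n^2*q) + m*(E^2*(2*n-m)*n*q) + n*(E^2*(m^2-2*m*n-B*n)*q)"
      by Groebner_Basis.algebra
    have 4: "n^3*q*(2*E^2) = m*(E^2*n^2*q) + n*(E^2*(2*n-m)*n*q)" by Groebner_Basis.algebra
    have 5: "n^3*q*E^2 = n*(E^2*n^2*q)" by Groebner_Basis.algebra
    show ?thesis unfolding F_def W_def using 0 1 2 3 4 5 by (simp add: ac_simps)
  qed
  moreover have "content [:B, m, n:] = 1"
    using prim n by (simp add: content_def cCons_def gcd.commute gcd.assoc gcd.left_commute)
  moreover have "n^3*q \<noteq> 0" using n q by simp
  ultimately obtain V where FV: "F = [:B, m, n:] * V" by (rule gauss_quotient)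
  have "F = smult B V + pCons 0 (smult m V) + pCons 0 (pCons 0 (smult n V))" unfolding FV by simp
  hence c: "coeff F k = B * coeff V k + (if k \<ge> 1 then m * coeff V (k-1) else 0) + (if k \<ge> 2 then n * coeff V (k-2) else 0)" for k
    by (auto simp: coeff_pCons numeral_2_eq_2 split: nat.split)
  have dV: "coeff V k = 0" if "k \<ge> 4" for k
  proof (cases "V = 0")
    case False
    have "degree F = 2 + degree V" unfolding FV using n False by (subst degree_mult_eq) auto
    moreover have "degree F \<le> 5" unfolding F_def by (simp add: degree_pCons_eq_if)
    ultimately show ?thesis using that by (intro coeff_eq_0) auto
  qed auto
  show ?thesis
  proof (rule that[OF E0 gE e g, of "coeff V 3" "coeff V 2" "coeff V 1" "coeff V 0"])
    show "n * coeff V 3 = E^2" using c[of 5] dV[of 5] dV[of 4] by (simp add: F_def coeff_pCons eval_nat_numeral)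
    show "n * coeff V 2 + m*coeff V 3 = 2*E^2" using c[of 4] dV[of 4] by (simp add: F_def coeff_pCons eval_nat_numeral)
    show "n * coeff V 1 + m*coeff V 2 + B*coeff V 3 = 0" using c[of 3] by (simp add: F_def coeff_pCons eval_nat_numeral)
    show "n * coeff V 0 + m*coeff V 1 + B*coeff V 2 = 2*E^2-e^2" using c[of 2] by (simp add: F_def coeff_pCons eval_nat_numeral)
    show "m * coeff V 0 + B*coeff V 1 = -(E^2)-2*e*g" using c[of 1] by (simp add: F_def coeff_pCons)
    show "B * coeff V 0 = -(g^2)" using c[of 0] by (simp add: F_def)
  qed
qed

text \<open>Take norms from \<open>Q[x]/(x^2 + a x + b)\<close>: on the left stand those of
  \<open>x\<close>, \<open>x^2 + 1\<close> and \<open>x^2 + 2x - 1\<close>, whose product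
  \<open>f\<close> is congruent to the square of \<open>v1 x + v0\<close>.\<close>

lemma mumford_norm:
  assumes "mumford a b v1 v0"
  shows "b*((1-b)^2+a^2)*(2*(b+1)^2-(a+b-1)^2) = (v1^2*b - v1*v0*a + v0^2)^2"
proof -
  define w where "w = 2 - v1^2 - a*(a^2-2*a-b) - b*(2-a)"
  have D1: "b*(a^2-2*a-b) + a*w + 1 + 2*v1*v0 = 0" and D2: "v0^2 + b*w = 0"
    using assms unfolding mumford_def w_def by auto
  let ?d1 = "b*(a^2-2*a-b) + a*w + 1 + 2*v1*v0" and ?d0 = "v0^2 + b*w"
  have "b*((1-b)^2+a^2)*(2*(b+1)^2-(a+b-1)^2) - (v1^2*b - v1*v0*a + v0^2)^2 =
    - ?d1*(4*v1*v0*b - v1^2*a*b - v0^2*a) - ?d0*(v1^2*(a^2-2*b) - 2*v1*v0*a + 2*v0^2)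
    + ?d1^2*b - ?d1*?d0*a + ?d0^2"
    unfolding w_def by Groebner_Basis.algebra
  thus ?thesis unfolding D1 D2 by simp
qed

section \<open>Valuations of the norms at each prime\<close>

lemma even_multiplicity_square:
  fixes p x y z E :: int
  assumes "x*y*E^4 = z^2" "prime p" "\<not> p dvd y" "x \<noteq> 0" "E \<noteq> 0"
  shows "even (multiplicity p x)"
proof -
  have y0: "y \<noteq> 0" using assms(3) by auto
  have z0: "z \<noteq> 0" using assms y0 by auto
  have pe: "prime_elem p" using assms(2) by (rule prime_imp_prime_elem)
  have "multiplicity p (x*y*E^4) = multiplicity p x + multiplicity p y + 4*multiplicity p E"
    using assms(4,5) y0 pe by (simp add: prime_elem_multiplicity_mult_distrib prime_elem_multiplicity_power_distrib)
  moreover have "multiplicity p (z^2) = 2*multiplicity p z"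
    using z0 pe by (simp add: prime_elem_multiplicity_power_distrib)
  moreover have "multiplicity p y = 0" using assms(3) by (rule not_dvd_imp_multiplicity_0)
  ultimately have "multiplicity p x + 4*multiplicity p E = 2*multiplicity p z" using assms(1) by simp
  thus ?thesis by presburger
qed

lemma not_dvd_add:
  fixes p x k y :: int
  assumes "x = p*k + y" "\<not> p dvd y" shows "\<not> p dvd x"
  using assms by (simp add: dvd_add_right_iff)

text \<open>A Mumford form with its denominators cleared: \<open>n x\<^sup>2 + m x + B\<close> is primitive, and
  \<open>E\<^sup>2 f - (e x + g)\<^sup>2 = (n x\<^sup>2 + m x + B) (W3 x\<^sup>3 + W2 x\<^sup>2 + W1 x + W0)\<close>.\<close>

locale integral_datum =
  fixes a b v1 v0 :: rat and n m B E e g W3 W2 W1 W0 :: int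
  assumes D: "mumford a b v1 v0" and n: "n \<noteq> 0" and a: "of_int n*a = of_int m" and b: "of_int n*b = of_int B"
    and prim: "gcd (gcd n m) B = 1" and B: "B \<noteq> 0"
    and E: "E \<noteq> 0" and primE: "gcd (gcd E e) g = 1" and e: "of_int E*v1 = of_int e" and g: "of_int E*v0 = of_int g"
    and W5: "n*W3 = E^2" and W4: "n*W2 + m*W3 = 2*E^2" and W3: "n*W1 + m*W2 + B*W3 = 0"
    and W2: "n*W0 + m*W1 + B*W2 = 2*E^2 - e^2" and W1: "m*W0 + B*W1 = -(E^2) - 2*e*g" and W0: "B*W0 = -(g^2)"
begin

text \<open>\<open>T\<close> is the resultant of \<open>n x^2 + m x + B\<close> with
  \<open>x^2 + 1\<close>, and \<open>R\<close> the one with \<open>x^2 + 2x - 1\<close>.\<close>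

definition "T = (B-n)^2 + m^2"
definition "R = 2*(B+n)^2 - (m+B-n)^2"

lemma norm_square: "(of_int n)^2*((1 - b)^2 + a^2) = of_int T"
proof -
  have "(of_int n)^2*((1 - b)^2 + a^2) = (of_int n*b - of_int n)^2 + (of_int n*a)^2" by Groebner_Basis.algebra
  also have "\<dots> = of_int T" unfolding T_def a b by simp
  finally show ?thesis .
qed

lemma resultant: "B*n*(T*R)*E^4 = (n^2*(e^2*B - e*g*m + g^2*n))^2"
proof -
  let ?n = "of_int n :: rat" and ?E = "of_int E :: rat"
  have "of_int (B*n*(T*R)*E^4) = (?n*b)*?n*((((?n*b)-?n)^2+(?n*a)^2)*(2*(?n*b+?n)^2-(?n*a+?n*b-?n)^2))*?E^4"
    unfolding T_def R_def a b by (simp only: of_int_mult of_int_add of_int_diff of_int_power of_int_numeral)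
  also have "\<dots> = ?n^6*?E^4*(b*((1-b)^2+a^2)*(2*(b+1)^2-(a+b-1)^2))" by Groebner_Basis.algebra
  also have "\<dots> = ?n^6*?E^4*(v1^2*b - v1*v0*a + v0^2)^2" unfolding mumford_norm[OF D] ..
  also have "\<dots> = (?n^2*((?E*v1)^2*(?n*b) - (?E*v1)*(?E*v0)*(?n*a) + (?E*v0)^2*?n))^2"
    by Groebner_Basis.algebra
  also have "\<dots> = of_int ((n^2*(e^2*B - e*g*m + g^2*n))^2)" unfolding e g a b by (simp only: of_int_mult of_int_add of_int_diff of_int_power of_int_numeral)
  finally show ?thesis by (simp only: of_int_eq_iff)
qed

lemma even_multiplicity_if_not_dvd:
  assumes "prime p" "\<not> p dvd T*R"
  shows "even (multiplicity p (B*n))"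
  by (rule even_multiplicity_square[OF resultant assms]) (use B n E in simp_all)

lemma prime_dvd_prim:
  assumes "prime (p::int)" "p dvd n" "p dvd m" "p dvd B" shows False
proof -
  have "p dvd gcd (gcd n m) B" using assms by simp
  hence "is_unit p" unfolding prim .
  thus False using assms(1) not_prime_unit by blast
qed

lemma prime_dvd_primE:
  assumes "prime (p::int)" "p dvd E" "p dvd e" "p dvd g" shows False
proof -
  have "p dvd gcd (gcd E e) g" using assms by simp
  hence "is_unit p" unfolding primE .
  thus False using assms(1) not_prime_unit by blast
qed

lemma prime_dvd_W:
  assumes p: "prime (p::int)" and n': "\<not> p dvd n" and pE: "p dvd E"
  shows "p dvd W3" "p dvd W2" "p dvd W1"
proof -
  have "p dvd n*W3" using pE unfolding W5 by (simp add: prime_dvd_power_iff[OF p])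
  thus w3: "p dvd W3" using n' by (simp add: prime_dvd_mult_iff[OF p])
  have "n*W2 = 2*E^2 - m*W3" using W4 by simp
  hence "p dvd n*W2" using pE w3 by (simp add: power2_eq_square)
  thus w2: "p dvd W2" using n' by (simp add: prime_dvd_mult_iff[OF p])
  have "n*W1 = - m*W2 - B*W3" using W3 by simp
  hence "p dvd n*W1" using w2 w3 by simp
  thus "p dvd W1" using n' by (simp add: prime_dvd_mult_iff[OF p])
qed

text \<open>If \<open>p\<close> divides neither \<open>n\<close> nor \<open>E\<close>, then
  \<open>B*W0 = -(g^2)\<close> with \<open>W0\<close> prime to \<open>p\<close>. Otherwise
  \<open>T\<close> and \<open>R\<close> are both prime to \<open>p\<close>, and the square in
  \<open>resultant\<close> decides.\<close>

lemma parity_B: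
  assumes p: "prime (p::int)" and pB: "p dvd B"
  shows "even (multiplicity p (B*n))"
proof -
  note pm = prime_dvd_mult_iff[OF p] prime_dvd_power_iff[OF p]
  obtain B' where B': "B = p*B'" using pB by (rule dvdE)
  consider "p dvd n" | "\<not> p dvd n" "p dvd E" | "\<not> p dvd n" "\<not> p dvd E" by blast
  thus ?thesis
  proof cases
    case 1
    then obtain n' where n': "n = p*n'" by (rule dvdE)
    have pm': "\<not> p dvd m" using prime_dvd_prim[OF p 1 _ pB] by blast
    have "T = p*(p*(B'-n')^2) + m^2" unfolding T_def unfolding B' n' by Groebner_Basis.algebra
    hence "\<not> p dvd T" by (rule not_dvd_add) (use pm' in \<open>simp add: pm\<close>)
    moreover have "R = p*(2*p*(B'+n')^2 - p*(B'-n')^2 - 2*m*(B'-n')) + (-(m^2))" unfolding R_def unfolding B' n' by Groebner_Basis.algebra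
    hence "\<not> p dvd R" by (rule not_dvd_add) (use pm' in \<open>simp add: pm\<close>)
    ultimately show ?thesis using p by (intro even_multiplicity_if_not_dvd) (simp_all add: pm)
  next
    case 2
    note w2 = prime_dvd_W(2)[OF p 2] and w1 = prime_dvd_W(3)[OF p 2]
    have "g^2 = B*(-W0)" using W0 by simp
    hence "p dvd g^2" using pB by simp
    hence pg: "p dvd g" by (simp add: pm)
    hence pe: "\<not> p dvd e" using prime_dvd_primE[OF p 2(2)] by blast
    have w0: "\<not> p dvd W0"
    proof
      assume "p dvd W0"
      moreover have "e^2 = 2*E^2 - n*W0 - m*W1 - B*W2" using W2 by simp
      ultimately have "p dvd e^2" using 2 w1 w2 by (simp add: power2_eq_square)
      thus False using pe by (simp add: pm)
    qed
    have "m*W0 = -(E^2) - 2*e*g - B*W1" using W1 by simp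
    hence "p dvd m*W0" using 2 pg w1 by (simp add: power2_eq_square)
    hence "p dvd m" using w0 by (simp add: pm)
    then obtain m' where m': "m = p*m'" by (rule dvdE)
    have "T = p*(p*B'^2 - 2*B'*n + p*m'^2) + n^2" unfolding T_def unfolding B' m' by Groebner_Basis.algebra
    hence "\<not> p dvd T" by (rule not_dvd_add) (use 2 in \<open>simp add: pm\<close>)
    moreover have "R = p*(2*p*B'^2 + 4*B'*n - p*(m'+B')^2 + 2*n*(m'+B')) + n^2" unfolding R_def unfolding B' m' by Groebner_Basis.algebra
    hence "\<not> p dvd R" by (rule not_dvd_add) (use 2 in \<open>simp add: pm\<close>)
    ultimately show ?thesis using p by (intro even_multiplicity_if_not_dvd) (simp_all add: pm)
  next
    case 3
    have "g^2 = B*(-W0)" using W0 by simp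
    hence "p dvd g^2" using pB by simp
    hence pg: "p dvd g" by (simp add: pm)
    have w0: "\<not> p dvd W0"
    proof
      assume "p dvd W0"
      moreover have "E^2 = - 2*e*g - B*W1 - m*W0" using W1 by simp
      ultimately have "p dvd E^2" using pg pB by simp
      thus False using 3 by (simp add: pm)
    qed
    hence "W0 \<noteq> 0" by auto
    hence "g \<noteq> 0" using W0 B by auto
    have pe: "prime_elem p" using p by (rule prime_imp_prime_elem)
    have "multiplicity p (B*W0) = multiplicity p B"
      using B \<open>W0 \<noteq> 0\<close> pe not_dvd_imp_multiplicity_0[OF w0] by (simp add: prime_elem_multiplicity_mult_distrib)
    moreover have "multiplicity p (-(g^2)) = 2 * multiplicity p g"
      using \<open>g \<noteq> 0\<close> pe by (simp add: prime_elem_multiplicity_power_distrib)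
    ultimately have "even (multiplicity p B)" using W0 by simp
    moreover have "multiplicity p (B*n) = multiplicity p B"
      using B n pe not_dvd_imp_multiplicity_0[OF 3(1)] by (simp add: prime_elem_multiplicity_mult_distrib)
    ultimately show ?thesis by simp
  qed
qed

text \<open>By \<open>resultant\<close>, an odd valuation of \<open>T\<close> would force
  \<open>p\<close> to divide \<open>R\<close> as well. After \<open>m\<close>, \<open>n\<close> and
  \<open>E\<close> are shown to be prime to \<open>p\<close>, the contradiction is that
  \<open>x^2 + 1\<close> and its cofactor in \<open>f\<close> have a common root only modulo
  2.\<close>

lemma parity_T:
  assumes p: "prime (p::int)" and p2: "\<not> p dvd 2" and T0: "T \<noteq> 0" and R0: "R \<noteq> 0" and Bn: "even (multiplicity p (B*n))"
  shows "even (multiplicity p T)"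
proof (rule ccontr)
  assume odd: "odd (multiplicity p T)"
  note pm = prime_dvd_mult_iff[OF p] prime_dvd_power_iff[OF p]
  have pe: "prime_elem p" using p by (rule prime_imp_prime_elem)
  have cancel2: "p dvd x" if "p dvd 2*x" for x using that p2 by (simp add: pm)
  have pT: "p dvd T" using odd not_dvd_imp_multiplicity_0 by fastforce
  have pR: "p dvd R"
  proof (rule ccontr)
    assume "\<not> p dvd R"
    have "(T*(B*n))*R*E^4 = (n^2*(e^2*B - e*g*m + g^2*n))^2" using resultant by (simp add: ac_simps)
    hence "even (multiplicity p (T*(B*n)))"
      by (rule even_multiplicity_square) (use p \<open>\<not> p dvd R\<close> T0 B n E in auto)
    moreover have "multiplicity p (T*(B*n)) = multiplicity p T + multiplicity p (B*n)"
      using T0 B n pe by (intro prime_elem_multiplicity_mult_distrib) auto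
    ultimately show False using odd Bn by simp
  qed
  have m: "\<not> p dvd m"
  proof
    assume pm': "p dvd m"
    have "(B-n)^2 = T - m*m" unfolding T_def by Groebner_Basis.algebra
    hence "p dvd (B-n)^2" using pT pm' by simp
    hence "p dvd B-n" by (simp add: pm)
    moreover have "2*(2*(2*(n*n))) = R - (B-n)*(2*(B+n) + 4*n - 2*m - (B-n)) + m*m" unfolding R_def by Groebner_Basis.algebra
    ultimately have "p dvd 2*(2*(2*(n*n)))" using pR pm' by simp
    hence "p dvd n" using cancel2 pm by blast
    moreover have "p dvd B" using \<open>p dvd B-n\<close> \<open>p dvd n\<close> by (metis diff_add_cancel dvd_add)
    ultimately show False using prime_dvd_prim p pm' by blast
  qed
  have n': "\<not> p dvd n"
  proof
    assume pn: "p dvd n"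
    have "2*(m*(m+B)) = (T + n*(2*B-n)) - (R - n*(4*B+2*n+2*m+2*B-n))" unfolding T_def R_def by Groebner_Basis.algebra
    hence "p dvd 2*(m*(m+B))" using pT pR pn by simp
    hence mB: "p dvd m+B" using cancel2 m pm by blast
    have "2*(m*m) = T + n*(2*B-n) - (m+B)*(B-m)" unfolding T_def by Groebner_Basis.algebra
    hence "p dvd 2*(m*m)" using pT pn mB by simp
    thus False using cancel2 m pm by blast
  qed
  \<comment> \<open>If \<open>p\<close> divides \<open>E\<close>, the factorization reduces modulo
    \<open>p\<close> to \<open>(n x^2 + m x + B) W0 = -(e x + g)^2\<close>. So the discriminant
    vanishes, and with \<open>T\<close> and \<open>R\<close> this leaves
    \<open>8 n^2 = 0\<close>.\<close>
  have E': "\<not> p dvd E"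
  proof
    assume pE: "p dvd E"
    note w2 = prime_dvd_W(2)[OF p n' pE] and w1 = prime_dvd_W(3)[OF p n' pE]
    have 0: "n*W0 = E*(2*E) - e^2 - m*W1 - B*W2" using W2 by (simp add: power2_eq_square)
    have w0: "\<not> p dvd W0"
    proof
      assume w0: "p dvd W0"
      have "e^2 = E*(2*E) - n*W0 - m*W1 - B*W2" using 0 by simp
      hence "p dvd e^2" using pE w0 w1 w2 by simp
      moreover have "g^2 = - B*W0" using W0 by simp
      hence "p dvd g^2" using w0 by simp
      ultimately show False using prime_dvd_primE p pE by (simp add: pm)
    qed
    have "W0*W0*(m*m - 4*(n*B)) =
      (m*W0 + E*E + 2*e*g)*(m*W0 - E*E - 2*e*g) + E*E*(E*E + 4*e*g) - 4*(n*W0+e^2)*(B*W0) + 4*e^2*(B*W0 + g^2)"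
      by Groebner_Basis.algebra
    also have "m*W0 + E*E + 2*e*g = - B*W1" using W1 by (simp add: power2_eq_square)
    also have "n*W0 + e^2 = E*(2*E) - m*W1 - B*W2" using 0 by simp
    also have "B*W0 + g^2 = 0" using W0 by simp
    finally have "p dvd W0*W0*(m*m - 4*(n*B))" using pE w1 w2 by simp
    hence d: "p dvd m*m - 4*(n*B)" using w0 by (simp add: pm)
    have "(B+n)^2 = T - (m*m - 4*(n*B))" unfolding T_def by Groebner_Basis.algebra
    hence "p dvd (B+n)^2" using d pT by simp
    hence Bn': "p dvd B+n" by (simp add: pm)
    have "(m+B-n)^2 = (B+n)*(2*(B+n)) - R" unfolding R_def by Groebner_Basis.algebra
    hence "p dvd (m+B-n)^2" using pR Bn' by simp
    hence mBn: "p dvd m+B-n" by (simp add: pm)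
    have "2*(2*(2*(n*n))) = (m*m-4*(n*B)) - (m+B-n)*(m-(B-n)) - (B-n)^2 + 4*n*(B+n) + 4*(n*n)" by Groebner_Basis.algebra
    also have "\<dots> = (m*m-4*(n*B)) - (m+B-n)*(m-(B-n)) - (B+n)*(B+n) + 4*n*(B+n) + 4*(n*(B+n))" by Groebner_Basis.algebra
    finally have eq: "2*(2*(2*(n*n))) = \<dots>" .
    have "p dvd 2*(2*(2*(n*n)))" unfolding eq by (simp only: dvd_add dvd_diff dvd_mult dvd_mult2 d mBn Bn')
    thus False using cancel2 n' pm by blast
  qed
  define k where "k = multiplicity p T"
  have k0: "k > 0" using odd by (auto simp: k_def intro: Nat.gr0I)
  have "coprime p m" using p m by (rule prime_imp_coprime)
  hence "coprime (p^(k+1)) m" by simp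
  hence "gcd m (p^(k+1)) = 1" unfolding coprime_iff_gcd_eq_1 by (simp only: gcd.commute)
  moreover obtain x y where "x*m + y*p^(k+1) = gcd m (p^(k+1))" using bezout_int by blast
  ultimately have xy: "x*m + y*p^(k+1) = 1" by simp
  \<comment> \<open>The quadratic \<open>n x\<^sup>2 + m x + B\<close> agrees with \<open>n (x\<^sup>2 + 1)\<close> modulo \<open>p^(k+1)\<close> at \<open>x = i\<close>, where \<open>x\<^sup>2 + 1\<close> has odd
    valuation \<open>k\<close>. Evaluating the factorization of \<open>E\<^sup>2 f - V\<^sup>2\<close> and its derivative there shows that \<open>p\<close> divides the cofactor
    \<open>x (x\<^sup>2 + 2x - 1)\<close> of \<open>x\<^sup>2 + 1\<close> in \<open>f\<close> as well, hence 2.\<close>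
  define i where "i = -(B-n)*x"
  define c where "c = (B-n)*y"
  have mi: "m*i = p^k*p*c - (B-n)"
  proof -
    have "m*i = -(B-n)*(x*m)" unfolding i_def by simp
    also have "x*m = 1 - y*p^(k+1)" using xy by simp
    finally show ?thesis unfolding c_def by (simp add: algebra_simps)
  qed
  define j where "j = i^2 + 1"
  obtain T' where T': "T = p^k*T'" "\<not> p dvd T'"
  proof -
    have "\<not> is_unit p" using p not_prime_unit by blast
    from multiplicity_decompose'[OF T0 this] obtain T' where "T = p^multiplicity p T * T'" "\<not> p dvd T'" .
    thus ?thesis unfolding k_def[symmetric] by (rule that)
  qed
  have p0: "p \<noteq> 0" using p by auto
  hence pk: "p^k \<noteq> 0" by simp
  have mj: "m^2*j = p^k*(p*(c*(p^k*p*c) - 2*c*(B-n)) + T')"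
  proof -
    have "m^2*j = (m*i)^2 + m^2" unfolding j_def by Groebner_Basis.algebra
    also have "\<dots> = T + p^k*(p*(c*(p^k*p*c) - 2*c*(B-n)))" unfolding mi T_def by Groebner_Basis.algebra
    finally show ?thesis unfolding T'(1) by (simp only: distrib_left add.commute)
  qed
  have "p^k dvd m^2*j" unfolding mj by simp
  moreover have "coprime (p^k) (m^2)" using \<open>coprime p m\<close> by simp
  ultimately have "p^k dvd j" by (simp add: coprime_dvd_mult_right_iff)
  then obtain j' where j': "j = p^k*j'" by (rule dvdE)
  have "p^k*(m^2*j') = p^k*(p*(c*(p^k*p*c) - 2*c*(B-n)) + T')" using mj unfolding j' by (simp add: ac_simps)
  hence mj': "m^2*j' = p*(c*(p^k*p*c) - 2*c*(B-n)) + T'" by (simp only: mult_left_cancel[OF pk])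
  have "\<not> p dvd m^2*j'" by (rule not_dvd_add[OF mj' T'(2)])
  hence pj': "\<not> p dvd j'" by auto
  have pj: "p dvd j" unfolding j' using k0 by (simp add: dvd_power)
  define h where "h = i*(i^2+2*i-1)"
  define V where "V = g + e*i"
  define Wi where "Wi = W0 + W1*i + W2*i^2 + W3*i^3"
  define X where "X = j'*(E^2*h - n*Wi) - p*(c*Wi)"
  have U: "n*i^2 + m*i + B = n*j + p^k*p*c" unfolding mi j_def by Groebner_Basis.algebra
  have "E^2*(j*h) - V^2 = (n*i^2 + m*i + B)*Wi"
  proof -
    have "(n*i^2 + m*i + B)*Wi = (n*W3)*i^5 + (n*W2 + m*W3)*i^4 + (n*W1 + m*W2 + B*W3)*i^3
      + (n*W0 + m*W1 + B*W2)*i^2 + (m*W0 + B*W1)*i + B*W0" unfolding Wi_def by Groebner_Basis.algebra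
    also have "\<dots> = E^2*(j*h) - V^2" unfolding W5 W4 W3 W2 W1 W0 j_def h_def V_def by Groebner_Basis.algebra
    finally show ?thesis ..
  qed
  hence "V^2 = j*(E^2*h - n*Wi) - p^k*(p*(c*Wi))" unfolding U by (simp add: algebra_simps)
  hence V2: "V^2 = p^k*X" unfolding X_def j' by (simp add: algebra_simps)
  have pX: "p dvd X"
  proof (cases "V = 0")
    case True
    thus ?thesis using V2 p0 by simp
  next
    case False
    hence X0: "X \<noteq> 0" using V2 by auto
    have "multiplicity p (V^2) = 2*multiplicity p V" using False pe by (simp add: prime_elem_multiplicity_power_distrib)
    moreover have "multiplicity p (p^k*X) = multiplicity p (p^k) + multiplicity p X"
      using pk X0 pe by (intro prime_elem_multiplicity_mult_distrib)
    moreover have "multiplicity p (p^k) = k" using p0 p not_prime_unit by (intro multiplicity_same_power) auto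
    ultimately have "k + multiplicity p X = 2*multiplicity p V" using V2 by simp
    hence "even (k + multiplicity p X)" by simp
    moreover have "odd k" using odd by (simp add: k_def)
    ultimately have "odd (multiplicity p X)" by simp
    hence "multiplicity p X \<noteq> 0" by (rule odd_pos[THEN gr_implies_not0])
    thus ?thesis using not_dvd_imp_multiplicity_0[of p X] by argo
  qed
  have "j'*(E^2*h - n*Wi) = X + p*(c*Wi)" unfolding X_def by simp
  hence "p dvd j'*(E^2*h - n*Wi)" using pX by simp
  hence 1: "p dvd E^2*h - n*Wi" using pj' by (simp add: pm)
  have "p dvd V^2" unfolding V2 using pX by simp
  hence pV: "p dvd V" by (simp add: pm)
  have pU: "p dvd n*i^2 + m*i + B" unfolding U using pj by simp
  have mWi: "m*Wi = 2*i*(E^2*h - n*Wi) + j*(E^2*(3*i^2+4*i-1)) - V*(2*e) - (n*i^2 + m*i + B)*(W1 + 2*W2*i + 3*W3*i^2)"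
  proof -
    have "(2*n*i+m)*Wi + (n*i^2 + m*i + B)*(W1 + 2*W2*i + 3*W3*i^2) = 5*(n*W3)*i^4 + 4*(n*W2 + m*W3)*i^3 + 3*(n*W1 + m*W2 + B*W3)*i^2
      + 2*(n*W0 + m*W1 + B*W2)*i + (m*W0 + B*W1)" unfolding Wi_def by Groebner_Basis.algebra
    also have "\<dots> = 2*i*(E^2*h) + j*(E^2*(3*i^2+4*i-1)) - V*(2*e)" unfolding W5 W4 W3 W2 W1 j_def h_def V_def by Groebner_Basis.algebra
    finally show ?thesis by (simp add: algebra_simps)
  qed
  have "p dvd m*Wi" unfolding mWi by (intro dvd_add dvd_diff dvd_mult[OF 1] dvd_mult2[OF pj] dvd_mult2[OF pV] dvd_mult2[OF pU])
  hence "p dvd n*Wi" using m by (simp add: pm)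
  hence "p dvd (E^2*h - n*Wi) + n*Wi" using 1 by (rule dvd_add[rotated])
  hence "p dvd E^2*h" by simp
  hence "p dvd h" using E' by (simp add: pm)
  hence "p dvd j*(i+2) - h" using pj by (intro dvd_diff dvd_mult2)
  moreover have "j*(i+2) - h = 2*(1+i)" unfolding j_def h_def by Groebner_Basis.algebra
  ultimately have "p dvd 1+i" using cancel2 by simp
  hence "p dvd j - (1+i)*(i-1)" using pj by (intro dvd_diff dvd_mult2)
  moreover have "j - (1+i)*(i-1) = 2" unfolding j_def by (simp add: algebra_simps power2_eq_square)
  ultimately have "p dvd 2" by simp
  thus False using p2 by contradiction
qed
end

text \<open>Image under \<open>(x, y) -> (-1/x, y/x^3)\<close>, up to the sign of \<open>y\<close>.
  The cubic is the reversal \<open>v0 x^3 - v1 x^2\<close> of \<open>v1 x + v0\<close>.\<close>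

lemma mumford_tau:
  assumes D: "mumford a b v1 v0" and b: "b \<noteq> 0"
  obtains w1 w0 where "mumford (-a/b) (1/b) w1 w0"
proof -
  define w where "w = 2 - v1^2 - a*(a^2-2*a-b) - b*(2-a)"
  have D1: "b*(a^2-2*a-b) + a*w + 1 + 2*v1*v0 = 0" and D2: "v0^2 + b*w = 0"
    using D unfolding mumford_def w_def by auto
  define A where "A = -a/b"
  define B where "B = 1/b"
  have Ab: "A*b = -a" and Bb: "B*b = 1" using b by (simp_all add: A_def B_def)
  have "mumford A B (A*(-v1 - A*v0) + B*v0 - 0) (B*(-v1 - A*v0) - 0)"
  proof (rule mumfordI[of v0 "-b*w" "-v1" "b*(a^2-2*a-b)" A 0 "-b*(2-a)" B 0 b 0 _ "-v1 - A*v0"])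
    show "v0^2 = -b*w" using D2 by simp
    have "A*(-b*w) = -(A*b)*w" by simp
    also have "\<dots> = a*w" unfolding Ab by simp
    finally have e: "A*(-b*w) = a*w" .
    show "2*v0*(-v1) - 1 = b*(a^2-2*a-b) + A*(-b*w)" unfolding e using D1 by (simp add: algebra_simps)
    have "A*(b*(a^2-2*a-b)) + B*(-b*w) = (A*b)*(a^2-2*a-b) - (B*b)*w" by simp
    also have "\<dots> = -a*(a^2-2*a-b) - w" unfolding Ab Bb by simp
    finally show "(-v1)^2 + 2*v0*0 - 2 = -b*(2-a) + A*(b*(a^2-2*a-b)) + B*(-b*w)" unfolding w_def by simp
    have "A*(-b*(2-a)) + B*(b*(a^2-2*a-b)) = -(A*b)*(2-a) + (B*b)*(a^2-2*a-b)" by simp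
    also have "\<dots> = - b" unfolding Ab Bb by (simp add: algebra_simps power2_eq_square)
    finally show "2*v0*0 + 2*(-v1)*0 = b + A*(-b*(2-a)) + B*(b*(a^2-2*a-b))" by simp
    have "A*b + B*(-b*(2-a)) = A*b - (B*b)*(2-a)" by simp
    also have "\<dots> = -2" unfolding Ab Bb by simp
    finally show "0^2 + 2*(-v1)*0 - 2 = 0 + A*b + B*(-b*(2-a))" by simp
    show "2*0*0 + 1 = A*0 + B*b" using Bb by simp
  qed simp_all
  thus ?thesis unfolding A_def B_def by (rule that)
qed

lemma integral_datum_exists:
  fixes n m B :: int
  assumes "mumford a b v1 v0" "n \<noteq> 0" "of_int n*a = of_int m" "of_int n*b = of_int B" "gcd (gcd n m) B = 1" "B \<noteq> 0"
  obtains E e g W3 W2 W1 W0 where "integral_datum a b v1 v0 n m B E e g W3 W2 W1 W0"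
proof -
  obtain E e g W3 W2 W1 W0 :: int where "E \<noteq> 0" "gcd (gcd E e) g = 1"
    "of_int E*v1 = of_int e" "of_int E*v0 = of_int g"
    "n*W3 = E^2" "n*W2 + m*W3 = 2*E^2" "n*W1 + m*W2 + B*W3 = 0" "n*W0 + m*W1 + B*W2 = 2*E^2 - e^2"
    "m*W0 + B*W1 = -(E^2) - 2*e*g" "B*W0 = -(g^2)"
    by (rule integral_model[OF assms(1-5)])
  with assms have "integral_datum a b v1 v0 n m B E e g W3 W2 W1 W0" by unfold_locales
  thus ?thesis by (rule that)
qed

lemma int_is_square:
  fixes x :: int
  assumes "\<And>p. prime p \<Longrightarrow> even (multiplicity p x)"
  obtains k where "\<bar>x\<bar> = k^2"
proof -
  have "is_nth_power 2 (normalize x)"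
    using is_nth_power_conv_multiplicity[of 2 x] assms by simp
  then obtain k where "normalize x = k^2" by (rule is_nth_powerE)
  thus ?thesis using that[of k] by simp
qed

lemma int_is_square_or_double:
  fixes x :: int
  assumes x: "x > 0" and "\<And>p. prime p \<Longrightarrow> \<not> p dvd 2 \<Longrightarrow> even (multiplicity p x)"
  obtains k where "x = k^2 \<or> x = 2*k^2"
proof (cases "even (multiplicity 2 x)")
  case True
  have "even (multiplicity p x)" if p: "prime p" for p
  proof (cases "p dvd 2")
    case False
    thus ?thesis using assms(2) p by blast
  next
    case d: True
    hence "p = 2" using p primes_dvd_imp_eq[of p 2] by simp
    thus ?thesis using True by simp
  qed
  then obtain k where "\<bar>x\<bar> = k^2" by (rule int_is_square)
  thus ?thesis using that[of k] x by simp
next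
  case False
  hence "2 dvd x" using not_dvd_imp_multiplicity_0[of 2 x] by fastforce
  then obtain y where y: "x = 2*y" by (rule dvdE)
  have y0: "y \<noteq> 0" using x y by auto
  have "even (multiplicity p y)" if p: "prime p" for p
  proof -
    have m: "multiplicity p x = multiplicity p 2 + multiplicity p y"
      unfolding y using p y0 by (intro prime_elem_multiplicity_mult_distrib prime_imp_prime_elem) auto
    show ?thesis
    proof (cases "p dvd 2")
      case True
      hence "p = 2" using p primes_dvd_imp_eq[of p 2] by simp
      thus ?thesis using m False by simp
    next
      case d: False
      thus ?thesis using m assms(2)[OF p d] not_dvd_imp_multiplicity_0[OF d] by simp
    qed
  qed
  then obtain k where "\<bar>y\<bar> = k^2" by (rule int_is_square)
  thus ?thesis using that[of k] x y by simp
qed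

lemma two_squares_int:
  fixes x y :: int
  assumes "2*x^2 = y^2" shows "x = 0"
proof (rule ccontr)
  assume x: "x \<noteq> 0"
  hence y: "y \<noteq> 0" using assms by auto
  have p: "prime_elem (2::int)" by (rule prime_imp_prime_elem) simp
  have "multiplicity 2 (2*x^2) = multiplicity 2 (2::int) + multiplicity 2 (x^2)"
    using x p by (intro prime_elem_multiplicity_mult_distrib) auto
  moreover have "multiplicity 2 (x^2) = 2*multiplicity 2 x"
    using x p by (simp add: prime_elem_multiplicity_power_distrib)
  moreover have "multiplicity 2 (y^2) = 2*multiplicity 2 y"
    using y p by (simp add: prime_elem_multiplicity_power_distrib)
  ultimately have "1 + 2*multiplicity 2 x = 2*multiplicity 2 y" using assms by simp
  thus False by presburger
qed

text \<open>The square classes left by the descent. \<open>parity_B\<close> handles the primes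
  dividing \<open>B\<close>; applied to the image under \<open>mumford_tau\<close>, which exchanges
  \<open>B\<close> and \<open>n\<close>, it handles those dividing \<open>n\<close>. For
  \<open>T\<close> the sign is fixed by positivity, and only the prime 2 stays open.\<close>

lemma selmer:
  assumes D: "mumford a b v1 v0" and b: "b \<noteq> 0"
  shows "\<exists>s. s \<noteq> 0 \<and> (b = s^2 \<or> b = -(s^2))"
    and "(1-b)^2 + a^2 \<noteq> 0 \<Longrightarrow> \<exists>t. t \<noteq> 0 \<and> ((1-b)^2 + a^2 = t^2 \<or> (1-b)^2 + a^2 = 2*t^2)"
proof -
  obtain n m B :: int where n: "n \<noteq> 0" and prim: "gcd (gcd n m) B = 1" and nm: "of_int n*a = of_int m" and nB: "of_int n*b = of_int B"
    by (rule common_denominator_pair)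
  have B: "B \<noteq> 0" using nB n b by auto
  obtain E e g W3 W2 W1 W0 where I: "integral_datum a b v1 v0 n m B E e g W3 W2 W1 W0"
    by (rule integral_datum_exists[OF D n nm nB prim B])
  obtain w1 w0 where D': "mumford (-a/b) (1/b) w1 w0" by (rule mumford_tau[OF D b])
  have nm': "of_int B*(-a/b) = of_int (-m)" using b unfolding nB[symmetric] of_int_minus nm[symmetric] by simp
  have nB': "of_int B*(1/b) = of_int n" using b unfolding nB[symmetric] by simp
  have prim': "gcd (gcd B (-m)) n = 1" using prim by (simp add: gcd.commute gcd.left_commute)
  obtain E' e' g' W3' W2' W1' W0' where I': "integral_datum (-a/b) (1/b) w1 w0 B (-m) n E' e' g' W3' W2' W1' W0'"
    by (rule integral_datum_exists[OF D' B nm' nB' prim' n])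
  have par: "even (multiplicity p (B*n))" if p: "prime p" for p
  proof -
    consider "p dvd B" | "p dvd n" | "\<not> p dvd B*n" using p by (auto simp: prime_dvd_mult_iff)
    thus ?thesis
    proof cases
      case 1 thus ?thesis using integral_datum.parity_B[OF I p] by simp
    next
      case 2 thus ?thesis using integral_datum.parity_B[OF I' p] by (simp add: mult.commute)
    next
      case 3 thus ?thesis using not_dvd_imp_multiplicity_0[OF 3] by simp
    qed
  qed
  then obtain k where k: "\<bar>B*n\<bar> = k^2" by (rule int_is_square)
  define s where "s = (of_int k / of_int n :: rat)"
  have bs: "b = of_int (B*n) / (of_int n)^2" using n unfolding of_int_mult nB[symmetric] by (simp add: power2_eq_square)
  have "B*n = k^2 \<or> B*n = -(k^2)" using k by linarith
  hence bs': "b = s^2 \<or> b = -(s^2)" unfolding bs s_def power_divide by (auto simp del: of_int_mult)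
  moreover have "s \<noteq> 0" using bs' b by auto
  ultimately show "\<exists>s. s \<noteq> 0 \<and> (b = s^2 \<or> b = -(s^2))" by blast
  assume N: "(1-b)^2 + a^2 \<noteq> 0"
  define T where "T = integral_datum.T n m B"
  define R where "R = integral_datum.R n m B"
  have NT: "(of_int n)^2*((1 - b)^2 + a^2) = of_int T" unfolding T_def by (rule integral_datum.norm_square[OF I])
  have N': "(1-b)^2 + a^2 = of_int T / (of_int n)^2" unfolding NT[symmetric] using n by simp
  have T0: "T \<noteq> 0" using N N' by auto
  have T: "T = (B-n)^2 + m^2" unfolding T_def by (rule integral_datum.T_def[OF I])
  have "T \<ge> 0" unfolding T by simp
  hence Tpos: "T > 0" using T0 by simp
  have "\<exists>k. T = k^2 \<or> T = 2*k^2"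
  \<comment> \<open>\<open>parity_T\<close> needs \<open>R\<close> nonzero. Since 2 is not a square,
    \<open>R = 0\<close> occurs only for multiples of \<open>x^2 + 2x - 1\<close>.\<close>
  proof (cases "R = 0")
    case True
    have R: "R = 2*(B+n)^2 - (m+B-n)^2" unfolding R_def by (rule integral_datum.R_def[OF I])
    hence e: "2*(B+n)^2 = (m+B-n)^2" using True by simp
    hence 1: "B + n = 0" by (rule two_squares_int)
    hence "m + B - n = 0" using e by simp
    hence "B = -n" "m = 2*n" using 1 by auto
    hence "T = 2*(2*n)^2" unfolding T by (simp add: power2_eq_square)
    thus ?thesis by blast
  next
    case False
    obtain k where "T = k^2 \<or> T = 2*k^2"
    proof (rule int_is_square_or_double[OF Tpos])
      fix p :: int assume p: "prime p" "\<not> p dvd 2"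
      show "even (multiplicity p T)"
        using integral_datum.parity_T[OF I p] par[OF p(1)] T0 False unfolding T_def R_def by simp
    qed
    thus ?thesis by blast
  qed
  then obtain k where k: "T = k^2 \<or> T = 2*k^2" by blast
  define t where "t = (of_int k / of_int n :: rat)"
  have t: "(1-b)^2 + a^2 = t^2 \<or> (1-b)^2 + a^2 = 2*t^2"
    using k unfolding N' t_def power_divide by auto
  moreover have "t \<noteq> 0" using t N by auto
  ultimately show "\<exists>t. t \<noteq> 0 \<and> ((1-b)^2 + a^2 = t^2 \<or> (1-b)^2 + a^2 = 2*t^2)" by blast
qed

section \<open>Rational points\<close>

lemma coprimeI_prime:
  fixes a b :: int
  assumes "a \<noteq> 0 \<or> b \<noteq> 0" "\<And>p. prime p \<Longrightarrow> p dvd a \<Longrightarrow> p dvd b \<Longrightarrow> False"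
  shows "coprime a b"
proof (rule ccontr)
  assume "\<not> coprime a b"
  hence "gcd a b \<noteq> 0" "\<not> is_unit (gcd a b)" using assms(1) by (auto simp: coprime_iff_gcd_eq_1)
  then obtain p where "prime p" "p dvd gcd a b" using prime_divisor_exists by blast
  thus False using assms(2)[of p] by simp
qed

lemma coprime_product_square:
  fixes u v w :: int
  assumes "coprime u v" "u*v = w^2" "u \<ge> 0" "v \<ge> 0"
  obtains r where "u = r^2"
proof (cases "u = 0 \<or> v = 0")
  case True
  have "u = 0 \<or> u = 1"
  proof (cases "u = 0")
    case False
    hence "v = 0" using True by simp
    hence "is_unit u" using assms(1) by simp
    thus ?thesis using assms(3) by simp
  qed simp
  hence "u = u^2" by auto
  thus ?thesis by (rule that)
next
  case False
  have "coprime (nat u) (nat v)" using assms(1,3,4) by (simp add: coprime_int_iff[symmetric])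
  moreover have "nat u * nat v = (nat \<bar>w\<bar>)^2"
    using assms(2,3) by (simp add: nat_mult_distrib[symmetric] nat_power_eq[symmetric])
  hence "is_nth_power 2 (nat u * nat v)" by (rule is_nth_powerI)
  moreover have "nat u > 0" "nat v > 0" using False assms(3,4) by auto
  ultimately have "is_nth_power 2 (nat u)" by (rule is_nth_power_mult_coprime_natD)
  then obtain r where "nat u = r^2" by (rule is_nth_powerE)
  hence "u = (int r)^2" using assms(3) by (metis nat_eq_iff of_nat_power)
  thus ?thesis by (rule that)
qed

lemma coprime_product_square_both:
  fixes u v w :: int
  assumes "coprime u v" "u*v = w^2" "w \<noteq> 0"
  obtains c r s where "c = 1 \<or> c = -1" "u = c*r^2" "v = c*s^2"
proof -
  have uv: "u*v > 0" using assms by simp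
  define c where "c = sgn u"
  have u0: "u \<noteq> 0" using uv by auto
  have c: "c = 1 \<or> c = -1" unfolding c_def using u0 by (auto simp: sgn_if)
  have cu: "c*u \<ge> 0" and cv: "c*v \<ge> 0" using uv unfolding c_def by (auto simp: sgn_if zero_less_mult_iff)
  have cc: "c*c = 1" using c by auto
  have cop: "coprime (c*u) (c*v)" "coprime (c*v) (c*u)" using assms(1) c by (auto simp: coprime_commute)
  have e: "(c*u)*(c*v) = w^2" "(c*v)*(c*u) = w^2" using assms(2) c by (auto simp: mult.commute)
  obtain r where r: "c*u = r^2" by (rule coprime_product_square[OF cop(1) e(1) cu cv])
  obtain s where s: "c*v = s^2" by (rule coprime_product_square[OF cop(2) e(2) cv cu])
  have "u = c*r^2" "v = c*s^2" unfolding r[symmetric] s[symmetric] using c by auto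
  thus ?thesis by (rule that[OF c])
qed

lemma pythagorean_triple:
  fixes x y z :: int
  assumes xyz: "x^2 + y^2 = z^2" and cop: "coprime x y" and y: "even y" and z: "z > 0"
  obtains m n where "coprime m n" "x = m^2 - n^2" "y = 2*m*n" "z = m^2 + n^2"
proof -
  have "odd x"
  proof
    assume "even x"
    hence "is_unit (2::int)" using coprime_common_divisor[OF cop] y by blast
    thus False by simp
  qed
  hence "odd (z^2)" using xyz[symmetric] y by simp
  hence "odd z" by simp
  have "even (z+x)" "even (z-x)" using \<open>odd x\<close> \<open>odd z\<close> by simp_all
  then obtain u v where u: "z + x = 2*u" and v: "z - x = 2*v" unfolding dvd_def by blast
  obtain w where w: "y = 2*w" using y by (rule dvdE)
  have zu: "z = u + v" and xu: "x = u - v" using u v by auto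
  have uv: "u*v = w^2" using xyz unfolding zu xu w by (simp add: algebra_simps power2_eq_square)
  have "x^2 \<le> z^2" using xyz zero_le_power2[of y] by linarith
  hence "\<bar>x\<bar> \<le> z" using z by (simp add: abs_le_square_iff[symmetric])
  hence uv0: "u \<ge> 0" "v \<ge> 0" using u v by auto
  have copuv: "coprime u v"
  proof (rule coprimeI_prime)
    show "u \<noteq> 0 \<or> v \<noteq> 0" using zu z by auto
    fix p assume p: "prime p" "p dvd u" "p dvd v"
    hence "p dvd x" unfolding xu by simp
    moreover have "p dvd w^2" using p(2) unfolding uv[symmetric] by simp
    hence "p dvd w" using p(1) prime_dvd_power by blast
    hence "p dvd y" unfolding w by simp
    ultimately have "is_unit p" using cop coprime_common_divisor by blast
    thus False using p(1) not_prime_unit by blast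
  qed
  obtain r where r: "u = r^2" by (rule coprime_product_square[OF copuv uv uv0])
  have copvu: "coprime v u" and vu: "v*u = w^2" using copuv uv by (simp_all add: coprime_commute mult.commute)
  obtain s where s: "v = s^2" by (rule coprime_product_square[OF copvu vu uv0(2,1)])
  have "(r*s)^2 = w^2" using uv unfolding r s by (simp add: power_mult_distrib)
  hence "w = r*s \<or> w = r*(-s)" by (auto simp: power2_eq_iff)
  then obtain s' where s': "w = r*s'" "s' = s \<or> s' = -s" by blast
  have "coprime r s'" using copuv s'(2) unfolding r s by auto
  moreover have "x = r^2 - s'^2" "z = r^2 + s'^2" using xu zu s'(2) unfolding r s by auto
  moreover have "y = 2*r*s'" unfolding w s'(1) by simp
  ultimately show ?thesis by (intro that)
qed

lemma odd_square_mod4: assumes "odd (x::int)" shows "x^2 mod 4 = 1"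
proof -
  obtain k where "x = 2*k+1" using assms by (rule oddE)
  hence "x^2 = 1 + 4*(k*k+k)" by (simp add: power2_eq_square algebra_simps)
  thus ?thesis by (simp only: mod_mult_self2) simp
qed

lemma even_square_mod4: assumes "even (x::int)" shows "x^2 mod 4 = 0"
proof -
  obtain k where "x = 2*k" using assms by (rule evenE)
  thus ?thesis by (simp add: power2_eq_square)
qed

text \<open>Infinite descent on \<open>|X|\<close>. For odd \<open>Y\<close> one Pythagorean triple
  suffices, since \<open>(m^2 + n^2) (m^2 - n^2)\<close> is already the square
  \<open>(X*Y)^2\<close>; for even \<open>Y\<close> a second triple is needed.\<close>

lemma fermat_minus:
  fixes X Y Z :: int
  assumes "X^4 - Y^4 = Z^2" "Y \<noteq> 0" "Z \<noteq> 0"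
  shows False
  using assms
proof (induction "nat \<bar>X\<bar>" arbitrary: X Y Z rule: less_induct)
  case less
  have X0: "X \<noteq> 0"
  proof
    assume "X = 0"
    hence "Z^2 + (Y^2)^2 = 0" using less.prems(1) by simp
    thus False using less.prems by (simp add: add_nonneg_eq_0_iff)
  qed
  show False
  proof (cases "coprime X Y")
    case False
    define d where "d = gcd X Y"
    have d0: "d > 0" using X0 by (simp add: d_def)
    have d1: "d \<noteq> 1" using False by (simp add: d_def coprime_iff_gcd_eq_1)
    obtain X' where X': "X = d*X'" using gcd_dvd1[of X Y] unfolding d_def by (rule dvdE)
    obtain Y' where Y': "Y = d*Y'" using gcd_dvd2[of X Y] unfolding d_def by (rule dvdE)
    have e: "Z^2 = (d^2)^2*(X'^4 - Y'^4)" using less.prems(1) unfolding X' Y' by (simp add: power_mult_distrib algebra_simps)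
    hence "(d^2)^2 dvd Z^2" by (simp only: dvd_triv_left)
    hence "d^2 dvd Z" by (rule iffD1[OF pow_divides_pow_iff, rotated]) simp
    then obtain Z' where Z': "Z = d^2*Z'" by (rule dvdE)
    have "(d^2)^2*(X'^4 - Y'^4) = (d^2)^2*Z'^2" using e unfolding Z' power_mult_distrib by (rule sym)
    hence "X'^4 - Y'^4 = Z'^2" by (rule iffD1[OF mult_left_cancel, rotated]) (use d0 in simp)
    moreover have "Y' \<noteq> 0" "Z' \<noteq> 0" using less.prems Y' Z' by auto
    moreover have "X' \<noteq> 0" using X0 X' by auto
    hence "nat \<bar>X'\<bar> < nat \<bar>X\<bar>" unfolding X' using d0 d1 by (simp add: abs_mult)
    ultimately show False using less.hyps by blast
  next
    case cop: True
    have oddX: "odd X"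
    proof
      assume eX: "even X"
      have "odd Y"
      proof
        assume "even Y"
        hence "is_unit (2::int)" using coprime_common_divisor[OF cop eX] by blast
        thus False by simp
      qed
      hence "(Y^2)^2 mod 4 = 1" by (intro odd_square_mod4) simp
      moreover have "(X^2)^2 mod 4 = 0" using eX by (intro even_square_mod4) simp
      moreover have "(X^2)^2 = (Y^2)^2 + Z^2" using less.prems(1) by simp
      moreover have "Z^2 mod 4 = 0 \<or> Z^2 mod 4 = 1" using odd_square_mod4 even_square_mod4 by blast
      ultimately show False by presburger
    qed
    have eq: "Z^2 + (Y^2)^2 = (X^2)^2" "(Y^2)^2 + Z^2 = (X^2)^2" using less.prems(1) by simp_all
    have copZY: "coprime Z (Y^2)"
    proof (rule coprimeI_prime)
      show "Z \<noteq> 0 \<or> Y^2 \<noteq> 0" using less.prems by simp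
      fix p assume p: "prime p" "p dvd Z" "p dvd Y^2"
      have "p dvd (X^2)^2" unfolding eq(1)[symmetric] using p by (simp add: power2_eq_square)
      hence "p dvd X" using p(1) prime_dvd_power by blast
      moreover have "p dvd Y" using p prime_dvd_power by blast
      ultimately have "is_unit p" using cop coprime_common_divisor by blast
      thus False using p(1) not_prime_unit by blast
    qed
    have X2: "X^2 > 0" using X0 by simp
    show False
    proof (cases "even Y")
      case True
      hence ev: "even (Y^2)" by simp
      obtain m n where mn: "coprime m n" "Z = m^2 - n^2" "Y^2 = 2*m*n" "X^2 = m^2 + n^2"
        by (rule pythagorean_triple[OF eq(1) copZY ev X2])
      obtain e' f where ef: "coprime (2*e') f" "Y^2 = 2*(2*e')*f" "X^2 = (2*e')^2 + f^2"
      proof (cases "even m")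
        case True
        then obtain e' where "m = 2*e'" by (rule dvdE)
        thus ?thesis using that[of e' n] mn by simp
      next
        case False
        have "odd (m^2+n^2)" using oddX unfolding mn(4)[symmetric] by simp
        hence "even n" using False by simp
        then obtain e' where "n = 2*e'" by (rule dvdE)
        thus ?thesis using that[of e' m] mn by (simp add: coprime_commute ac_simps)
      qed
      obtain Y' where Y': "Y = 2*Y'" using True by (rule dvdE)
      have "Y' \<noteq> 0" using less.prems Y' by auto
      moreover have "e'*f = Y'^2" using ef(2) unfolding Y' by (simp add: power2_eq_square)
      moreover have "coprime e' f" using ef(1) by simp
      ultimately obtain c s r where c: "c = 1 \<or> c = -1" and e': "e' = c*s^2" and f: "f = c*r^2"
        using coprime_product_square_both[of e' f Y'] by blast
      have X2': "(r^2)^2 + (2*s^2)^2 = \<bar>X\<bar>^2" using ef(3) c unfolding e' f by (auto simp: power_mult_distrib)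
      have "coprime (r^2) (2*s^2)" using ef(1) c unfolding e' f by (auto simp: coprime_commute)
      moreover have "even (2*s^2)" by simp
      moreover have "\<bar>X\<bar> > 0" using X0 by simp
      ultimately obtain k l where kl: "coprime k l" "r^2 = k^2 - l^2" "2*s^2 = 2*k*l" "\<bar>X\<bar> = k^2 + l^2"
        using pythagorean_triple[OF X2'] by blast
      have s0: "s \<noteq> 0" using \<open>e'*f = Y'^2\<close> \<open>Y' \<noteq> 0\<close> e' by auto
      have r0: "r \<noteq> 0" using \<open>e'*f = Y'^2\<close> \<open>Y' \<noteq> 0\<close> f by auto
      have "k*l = s^2" using kl(3) by simp
      then obtain c' K L where c': "c' = 1 \<or> c' = -1" and k: "k = c'*K^2" and l: "l = c'*L^2"
        using coprime_product_square_both[OF kl(1) _ s0] by blast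
      have "K^4 - L^4 = r^2" using kl(2) c' unfolding k l by (auto simp: power_mult_distrib)
      moreover have L0: "L \<noteq> 0" using \<open>k*l = s^2\<close> s0 l by auto
      moreover have "nat \<bar>K\<bar> < nat \<bar>X\<bar>"
      proof -
        have "\<bar>K\<bar> \<le> \<bar>K\<bar>^4" by (cases "K = 0", simp, rule self_le_power) simp_all
        also have "\<dots> < K^4 + L^4" using L0 by simp
        also have "\<dots> = \<bar>X\<bar>" using kl(4) c' unfolding k l by (auto simp: power_mult_distrib)
        finally show ?thesis by simp
      qed
      ultimately show False using less.hyps r0 by blast
    next
      case False
      have "odd (Y^4)" "odd (X^4)" using False oddX by simp_all
      hence "even (Z^2)" using less.prems(1)[symmetric] by simp
      hence ev: "even Z" by simp
      have cop': "coprime (Y^2) Z" using copZY by (simp add: coprime_commute)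
      obtain m n where mn: "coprime m n" "Y^2 = m^2 - n^2" "Z = 2*m*n" "X^2 = m^2 + n^2"
        by (rule pythagorean_triple[OF eq(2) cop' ev X2])
      have n0: "n \<noteq> 0" using mn(3) less.prems by auto
      have "m^4 - n^4 = (m^2+n^2)*(m^2-n^2)" by (simp add: algebra_simps power2_eq_square power4_eq_xxxx)
      also have "\<dots> = (X*Y)^2" unfolding mn(2,4)[symmetric] by (simp add: power_mult_distrib)
      finally have "m^4 - n^4 = (X*Y)^2" .
      moreover have "X*Y \<noteq> 0" using X0 less.prems by simp
      moreover have "\<bar>m\<bar>^2 < \<bar>X\<bar>^2" using mn(4) n0 by simp
      hence "nat \<bar>m\<bar> < nat \<bar>X\<bar>" using power2_less_imp_less[of "\<bar>m\<bar>" "\<bar>X\<bar>"] by simp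
      ultimately show False using less.hyps n0 by blast
    qed
  qed
qed

text \<open>Infinite descent on \<open>|z|\<close> through two Pythagorean triples. The hypotenuse
  \<open>|m|\<close> of the second is a square because \<open>m\<close> is coprime to
  \<open>r*s\<close> and their product is a square.\<close>

lemma fermat_plus:
  fixes x y z :: int
  assumes "x^4 + y^4 = z^2" "x \<noteq> 0" "y \<noteq> 0"
  shows False
  using assms
proof (induction "nat \<bar>z\<bar>" arbitrary: x y z rule: less_induct)
  case less
  have z0: "z \<noteq> 0"
  proof
    assume "z = 0"
    hence "(x^2)^2 + (y^2)^2 = 0" using less.prems(1) by simp
    thus False using less.prems by (simp add: add_nonneg_eq_0_iff)
  qed
  show False
  proof (cases "coprime x y")
    case False
    define d where "d = gcd x y"
    have d0: "d > 0" using less.prems by (simp add: d_def)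
    have d1: "d \<noteq> 1" using False by (simp add: d_def coprime_iff_gcd_eq_1)
    obtain x' where x': "x = d*x'" using gcd_dvd1[of x y] unfolding d_def by (rule dvdE)
    obtain y' where y': "y = d*y'" using gcd_dvd2[of x y] unfolding d_def by (rule dvdE)
    have e: "z^2 = (d^2)^2*(x'^4 + y'^4)" using less.prems(1) unfolding x' y' by (simp add: power_mult_distrib algebra_simps)
    hence "(d^2)^2 dvd z^2" by (simp only: dvd_triv_left)
    hence "d^2 dvd z" by (rule iffD1[OF pow_divides_pow_iff, rotated]) simp
    then obtain z' where z': "z = d^2*z'" by (rule dvdE)
    have "(d^2)^2*(x'^4 + y'^4) = (d^2)^2*z'^2" using e unfolding z' power_mult_distrib by (rule sym)
    hence "x'^4 + y'^4 = z'^2" by (rule iffD1[OF mult_left_cancel, rotated]) (use d0 in simp)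
    moreover have "x' \<noteq> 0" "y' \<noteq> 0" using less.prems x' y' by auto
    moreover have "nat \<bar>z'\<bar> < nat \<bar>z\<bar>"
    proof -
      have "d^2 > 1" using d0 d1 by (simp add: one_less_power)
      moreover have "z' \<noteq> 0" using z0 z' by auto
      moreover from this have "d^2*\<bar>z'\<bar> > 0" using d0 by simp
      ultimately show ?thesis unfolding z' by (simp add: abs_mult)
    qed
    ultimately show False using less.hyps by blast
  next
    case True
    have "\<exists>x y. x^4 + y^4 = z^2 \<and> x \<noteq> 0 \<and> y \<noteq> 0 \<and> coprime x y \<and> even y"
    proof (cases "even y")
      case False
      have "even x"
      proof (rule ccontr)
        assume "odd x"
        hence "(x^2)^2 mod 4 = 1" by (intro odd_square_mod4) simp
        moreover have "(y^2)^2 mod 4 = 1" using False by (intro odd_square_mod4) simp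
        moreover have "(x^2)^2 + (y^2)^2 = z^2" using less.prems(1) by simp
        moreover have "z^2 mod 4 = 0 \<or> z^2 mod 4 = 1" using odd_square_mod4 even_square_mod4 by blast
        ultimately show False by presburger
      qed
      thus ?thesis using less.prems True by (intro exI[of _ y] exI[of _ x]) (simp add: add.commute coprime_commute)
    qed (use less.prems True in blast)
    then obtain x y where p: "x^4 + y^4 = z^2" "x \<noteq> 0" "y \<noteq> 0" and cop: "coprime x y" and ev: "even y" by blast
    have oddx: "odd x"
    proof
      assume "even x"
      hence "is_unit (2::int)" using coprime_common_divisor[OF cop] ev by blast
      thus False by simp
    qed
    have eq: "(x^2)^2 + (y^2)^2 = \<bar>z\<bar>^2" using p(1) by simp
    have cop2: "coprime (x^2) (y^2)" using cop by simp
    have ev2: "even (y^2)" using ev by simp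
    have zp: "\<bar>z\<bar> > 0" using z0 by simp
    obtain m n where mn: "coprime m n" "x^2 = m^2 - n^2" "y^2 = 2*m*n" "\<bar>z\<bar> = m^2 + n^2"
      by (rule pythagorean_triple[OF eq cop2 ev2 zp])
    have mn0: "m \<noteq> 0" "n \<noteq> 0" using mn(3) p(3) by auto
    have "even n"
    proof (rule ccontr)
      assume "odd n"
      hence "n^2 mod 4 = 1" by (rule odd_square_mod4)
      moreover have "x^2 mod 4 = 1" using oddx by (rule odd_square_mod4)
      moreover have "m^2 mod 4 = 0 \<or> m^2 mod 4 = 1" using odd_square_mod4 even_square_mod4 by blast
      ultimately show False using mn(2) by presburger
    qed
    have eq2: "x^2 + n^2 = \<bar>m\<bar>^2" using mn(2) by simp
    have copxn: "coprime x n"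
    proof (rule coprimeI_prime)
      show "x \<noteq> 0 \<or> n \<noteq> 0" using mn0 by simp
      fix q assume q: "prime q" "q dvd x" "q dvd n"
      have "m^2 = x^2 + n^2" using eq2 by simp
      hence "q dvd m^2" using q by (simp add: power2_eq_square)
      hence "q dvd m" using q(1) prime_dvd_power by blast
      hence "is_unit q" using mn(1) q(3) coprime_common_divisor by blast
      thus False using q(1) not_prime_unit by blast
    qed
    have mp: "\<bar>m\<bar> > 0" using mn0 by simp
    obtain r s where rs: "coprime r s" "x = r^2 - s^2" "n = 2*r*s" "\<bar>m\<bar> = r^2 + s^2"
      by (rule pythagorean_triple[OF eq2 copxn \<open>even n\<close> mp])
    obtain y' where y': "y = 2*y'" using ev by (rule dvdE)
    have y'0: "y' \<noteq> 0" using y' p(3) by auto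
    have "m*(r*s) = y'^2" using mn(3) unfolding y' rs(3) by (simp add: power2_eq_square)
    moreover have "coprime m (r*s)" using mn(1) unfolding rs(3) by simp
    ultimately obtain c M w where c: "c = 1 \<or> c = -1" and m: "m = c*M^2" and w: "r*s = c*w^2"
      using coprime_product_square_both[OF _ _ y'0] by blast
    have w0: "w \<noteq> 0" using w mn0 rs(3) by auto
    have "(c*r)*s = w^2" "coprime (c*r) s" using w c rs(1) by auto
    then obtain c' R S where c': "c' = 1 \<or> c' = -1" and R: "c*r = c'*R^2" and S: "s = c'*S^2"
      using coprime_product_square_both[OF _ _ w0] by blast
    have RS0: "R \<noteq> 0" "S \<noteq> 0" using R S w0 w c by auto
    have "r^2 = (c*r)^2" using c by auto
    hence "r^2 = R^4" unfolding R using c' by (auto simp: power_mult_distrib)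
    moreover have "s^2 = S^4" unfolding S using c' by (auto simp: power_mult_distrib)
    moreover have "\<bar>m\<bar> = M^2" unfolding m using c by (auto simp: abs_mult)
    ultimately have "R^4 + S^4 = M^2" using rs(4) by simp
    moreover have "nat \<bar>M\<bar> < nat \<bar>z\<bar>"
    proof -
      have "\<bar>M\<bar> \<le> \<bar>M\<bar>^2" by (cases "M = 0", simp, rule self_le_power) simp_all
      also have "\<dots> = \<bar>m\<bar>" using \<open>\<bar>m\<bar> = M^2\<close> by simp
      also have "\<dots> \<le> \<bar>m\<bar>^2" by (rule self_le_power) (use mn0 in simp_all)
      also have "\<dots> < m^2 + n^2" using mn0 by simp
      also have "\<dots> = \<bar>z\<bar>" using mn(4) by simp
      finally show ?thesis by simp
    qed
    ultimately show False using less.hyps RS0 by blast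
  qed
qed

section \<open>Rational solutions and the rational points of the curve\<close>

lemma rat_square_int:
  fixes x :: rat
  assumes "x^2 = of_int k"
  obtains m :: int where "x = of_int m"
proof -
  obtain p q where x: "x = of_int p / of_int q" and q: "q > 0" and cop: "coprime p q"
    by (rule rat_cases_coprime)
  have "of_int (p^2) = x^2 * (of_int q)^2" using q unfolding x by (simp add: power_divide)
  also have "\<dots> = of_int (k*q^2)" unfolding assms by simp
  finally have pq: "p^2 = k*q^2" by (simp only: of_int_eq_iff)
  hence "q dvd p^2" by (simp add: power2_eq_square)
  moreover have "coprime q (p^2)" using cop by (simp add: coprime_commute)
  ultimately have "is_unit q" using coprime_common_divisor[of q "p^2" q] by simp
  hence "q = 1" using q by simp
  hence "x = of_int p" using x by simp
  thus ?thesis by (rule that)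
qed

lemma fermat_plus_rat:
  fixes s t :: rat
  assumes "s^4 + 1 = t^2" shows "s = 0"
proof -
  obtain p q where s: "s = of_int p / of_int q" and q: "q > 0" by (rule rat_cases_coprime)
  have "(t*(of_int q)^2)^2 = (s^4+1)*(of_int q)^4" unfolding assms by (simp add: power_mult_distrib)
  also have "\<dots> = of_int (p^4+q^4)" using q unfolding s by (simp add: field_simps power_divide)
  finally have e: "(t*(of_int q)^2)^2 = of_int (p^4+q^4)" .
  then obtain z where z: "t*(of_int q)^2 = of_int z" by (rule rat_square_int)
  have "of_int (p^4+q^4) = (of_int (z^2) :: rat)" using e unfolding z by simp
  hence "p^4 + q^4 = z^2" by (simp only: of_int_eq_iff)
  hence "p = 0" using fermat_plus[of p q z] q by auto
  thus ?thesis by (simp add: s)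
qed

text \<open>The identity \<open>(p^4 + q^4)^2 - (p^4 - q^4)^2 = 4 p^4 q^4\<close> turns
  \<open>z^2 = 2 (p^4 + q^4)\<close> into a difference of fourth powers that is a square.\<close>

lemma fermat_double_rat:
  fixes s t :: rat
  assumes "s^4 + 1 = 2*t^2" "s \<noteq> 0" shows "s^2 = 1"
proof -
  obtain p q where s: "s = of_int p / of_int q" and q: "q > 0" by (rule rat_cases_coprime)
  have p: "p \<noteq> 0" using assms(2) s by auto
  have "(2*t*(of_int q)^2)^2 = 2*((s^4+1)*(of_int q)^4)" unfolding assms(1) by (simp add: power_mult_distrib)
  also have "(s^4+1)*(of_int q)^4 = of_int (p^4+q^4)" using q unfolding s by (simp add: field_simps power_divide)
  finally have e: "(2*t*(of_int q)^2)^2 = of_int (2*(p^4+q^4))" by simp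
  then obtain z where z: "2*t*(of_int q)^2 = of_int z" by (rule rat_square_int)
  have "of_int (z^2) = (of_int (2*(p^4+q^4)) :: rat)" using e unfolding z by simp
  hence z2: "z^2 = 2*(p^4+q^4)" by (simp only: of_int_eq_iff)
  have "z^4 - (2*(p*q))^4 + 0 = (2*(p^4-q^4))^2 + 0"
  proof -
    have "z^4 = (z^2)^2" by simp
    thus ?thesis unfolding z2 by (simp add: algebra_simps power2_eq_square power4_eq_xxxx)
  qed
  hence "z^4 - (2*(p*q))^4 = (2*(p^4-q^4))^2" by simp
  moreover have "2*(p*q) \<noteq> 0" using p q by simp
  ultimately have "2*(p^4-q^4) = 0" using fermat_minus[of z "2*(p*q)" "2*(p^4-q^4)"] by blast
  hence "(p^2)^2 = (q^2)^2" by simp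
  hence pq: "p^2 = q^2" by (rule power2_eq_imp_eq) simp_all
  have "s^2 = of_int (p^2) / of_int (q^2)" unfolding s by (simp add: power_divide)
  thus ?thesis unfolding pq using q by simp
qed

text \<open>A Mumford form needs a quadratic, so the point is paired with the point
  \<open>(1, 2)\<close>. For this class \<open>b = x\<close> and the norm of \<open>x^2 + 1\<close>
  is \<open>2 (x^2 + 1)\<close>; the conditions of \<open>selmer\<close> become the two equations of
  Fermat type for \<open>s^4 + 1\<close>.\<close>

lemma rational_points:
  fixes x y :: rat
  assumes xy: "y^2 = x^5 + 2*x^4 + 2*x^2 - x"
  shows "x = 0 \<or> x = 1 \<or> x = -1"
proof (rule ccontr)
  assume "\<not> ?thesis"
  hence x: "x \<noteq> 0" "x - 1 \<noteq> 0" "x \<noteq> -1" by auto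
  define v1 where "v1 = (y-2)/(x-1)"
  have v1: "v1*(x-1) = y - 2" using x by (simp add: v1_def)
  have M: "mumford (-(x+1)) x v1 (2-v1)"
  proof -
    have y: "y = v1*(x-1) + 2" using v1 by simp
    have q: "v1^2*(x-1) + 4*v1 = x^4+3*x^3+3*x^2+5*x+4"
    proof -
      have "(x-1)*(v1^2*(x-1) + 4*v1) = y^2 - 4" unfolding y by Groebner_Basis.algebra
      also have "\<dots> = (x-1)*(x^4+3*x^3+3*x^2+5*x+4)" unfolding xy by Groebner_Basis.algebra
      finally show ?thesis using x(2) mult_left_cancel by blast
    qed
    have "x*((-(x+1))^2-2*(-(x+1))-x) + (-(x+1))*(2 - v1^2 - (-(x+1))*((-(x+1))^2-2*(-(x+1))-x) - x*(2-(-(x+1)))) + 1 + 2*v1*(2-v1)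
       = (v1^2*(x-1) + 4*v1) - (x^4+3*x^3+3*x^2+5*x+4)" by Groebner_Basis.algebra
    moreover have "(2-v1)^2 + x*(2 - v1^2 - (-(x+1))*((-(x+1))^2-2*(-(x+1))-x) - x*(2-(-(x+1))))
       = - ((v1^2*(x-1) + 4*v1) - (x^4+3*x^3+3*x^2+5*x+4))" by Groebner_Basis.algebra
    ultimately show ?thesis unfolding mumford_def q by simp
  qed
  obtain s where s: "s \<noteq> 0" "x = s^2 \<or> x = -(s^2)" using selmer(1)[OF M x(1)] by blast
  have N: "(1-x)^2 + (-(x+1))^2 = 2*(s^4+1)" using s(2) by (auto simp: power2_eq_square power4_eq_xxxx algebra_simps)
  have "s^4 + 1 > 0" by (simp add: add_nonneg_pos)
  hence "(1-x)^2 + (-(x+1))^2 \<noteq> 0" unfolding N by simp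
  then obtain t where "2*(s^4+1) = t^2 \<or> 2*(s^4+1) = 2*t^2" using selmer(2)[OF M x(1)] unfolding N by blast
  hence "s^4 + 1 = 2*(t/2)^2 \<or> s^4 + 1 = t^2" by (auto simp: power_divide)
  hence "s^2 = 1" using fermat_plus_rat[of s] fermat_double_rat[of s] s(1) by auto
  hence "x = 1 \<or> x = -1" using s(2) by auto
  thus False using x by auto
qed

section \<open>Translation by two-torsion\<close>

text \<open>Translation by the rational classes of order two that belong to the factors \<open>x\<close> and \<open>x\<^sup>2 + 1\<close> of \<open>f\<close>.\<close>

lemma translate1:
  assumes D: "mumford a b v1 v0" and b: "b \<noteq> 0"
  obtains a2 b2 w1 w0 e where "mumford a2 b2 w1 w0" "b*b2 = -1" "b*a2 = 1 + b - kum a b v1" "b*kum a2 b2 w1 = a+b-1"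
    "((1-b2)^2+a2^2)*((1-b)^2+a^2) = e^2"
proof -
  \<comment> \<open>The interpolating polynomial is \<open>x (l x + m)\<close>: it vanishes at 0 and
    is congruent to \<open>v1 x + v0\<close>. Its square minus \<open>f\<close> is \<open>-x\<close>
    times both quadratics.\<close>
  define l where "l = -v0/b"
  define m where "m = v1 + l*a"
  define a2 where "a2 = 2 - a - l^2"
  define b2 where "b2 = -1/b"
  have v0: "v0 = -l*b" using b by (simp add: l_def)
  have v1: "v1 = m - l*a" by (simp add: m_def)
  have bb: "b*b2 = -1" using b by (simp add: b2_def)
  define w where "w = 2 - v1^2 - a*(a^2-2*a-b) - b*(2-a)"
  have D1: "b*(a^2-2*a-b) + a*w + 1 + 2*v1*v0 = 0" and D2: "v0^2 + b*w = 0"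
    using D unfolding mumford_def w_def by auto
  have "b*(w + b*l^2) = 0" using D2 unfolding v0 by Groebner_Basis.algebra
  hence w: "w = - b*l^2" using b by simp
  have f3: "2*l*m = - b - a2*a - b2"
  proof -
    have "b*(2*l*m + b + a2*a + b2) = 0" using D1 bb unfolding w v0 v1 a2_def by Groebner_Basis.algebra
    thus ?thesis using b by simp
  qed
  have f2: "m^2 - 2 = - a2*b - b2*a"
  proof -
    have "v1^2 = 2 - a*(a^2-2*a-b) - b*(2-a) + b*l^2" using w unfolding w_def by simp
    thus ?thesis using f3 unfolding v1 a2_def by Groebner_Basis.algebra
  qed
  have M: "mumford a2 b2 (a2*l - m) (b2*l)"
  proof (rule mumfordI[of 0 0 l "-1" a2 m "-a" b2 0 "-b" 0 _ l])
    show "l^2 + 2*0*m - 2 = -a + a2*(-1) + b2*0" by (simp add: a2_def)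
    show "2*0*0 + 2*l*m = -b + a2*(-a) + b2*(-1)" using f3 by simp
    show "m^2 + 2*l*0 - 2 = 0 + a2*(-b) + b2*(-a)" using f2 by simp
    show "2*m*0 + 1 = a2*0 + b2*(-b)" using bb by (simp add: mult.commute)
  qed simp_all
  have P: "kum a b v1 = 1 + b - b*a2"
  proof -
    have "v1^2 = 2 - a*(a^2-2*a-b) - b*(2-a) + b*l^2" using w unfolding w_def by simp
    thus ?thesis unfolding kum_def a2_def by (simp add: algebra_simps power2_eq_square power3_eq_cube)
  qed
  have P2: "b*kum a2 b2 (a2*l - m) = a+b-1"
  proof -
    have l2: "l^2 = 2 - a - a2" by (simp add: a2_def)
    have "(a2*l - m)^2 = a2^2*l^2 - a2*(2*l*m) + m^2" by (simp add: algebra_simps power2_eq_square)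
    hence e: "(a2*l - m)^2 = a2^2*(2-a-a2) - a2*(- b - a2*a - b2) + (2 - a2*b - b2*a)"
      unfolding l2 f3 using f2 by simp
    show ?thesis unfolding kum_def e using bb by Groebner_Basis.algebra
  qed
  \<comment> \<open>Evaluate the factorization at \<open>x = i\<close>, where \<open>f\<close>
    vanishes, and take norms.\<close>
  have N: "((1-b2)^2+a2^2)*((1-b)^2+a^2) = (l^2+m^2)^2"
    using f3 f2 bb unfolding a2_def by Groebner_Basis.algebra
  show ?thesis using that[OF M bb _ P2 N] P by simp
qed

text \<open>Now \<open>c = (l1 x + l0) (x^2 + 1)\<close>, and \<open>c^2 - f\<close> is
  \<open>l1^2 (x^2 + 1)\<close> times both quadratics.\<close>

lemma translate2:
  assumes D: "mumford a b v1 v0" and N: "(1-b)^2 + a^2 \<noteq> 0"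
    and irr: "\<And>x. x^2 + a*x + b \<noteq> 0" and ab: "\<not> (a = 2 \<and> b = -1)"
  obtains a2 b2 w1 w0 L l1 l0 where "mumford a2 b2 w1 w0" "L \<noteq> 0" "L = kum a b v1 - a - b + 1"
    "L*b2 = kum a b v1 + a + b - 1" "L*(a2+b2-1) = 4*(b-1)" "L*kum a2 b2 w1 = 4*(b+1)"
    "l1 \<noteq> 0" "l1^2*b*b2 = l0^2" "l1^4*(((1-b2)^2+a2^2)*((1-b)^2+a^2)) = 8"
proof -
  define N where "N = (1-b)^2 + a^2"
  have N0: "N \<noteq> 0" using N by (simp add: N_def)
  \<comment> \<open>\<open>l1 x + l0\<close> is \<open>v1 x + v0\<close> divided by
    \<open>x^2 + 1\<close> modulo \<open>x^2 + a x + b\<close>; \<open>N\<close> is the norm of the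
    divisor.\<close>
  define l1 where "l1 = ((1-b)*v1 + a*v0)/N"
  define l0 where "l0 = ((a^2+1-b)*v0 - a*b*v1)/N"
  have l1N: "N*l1 = (1-b)*v1 + a*v0" and l0N: "N*l0 = (a^2+1-b)*v0 - a*b*v1"
    using N0 by (auto simp: l1_def l0_def)
  have v1: "v1 = l1*(a^2+1-b) - a*l0"
  proof -
    have "N*(l1*(a^2+1-b) - a*l0) = (N*l1)*(a^2+1-b) - a*(N*l0)" by (simp add: algebra_simps)
    also have "\<dots> = N*v1" unfolding l1N l0N unfolding N_def by Groebner_Basis.algebra
    finally have "N*v1 = N*(l1*(a^2+1-b) - a*l0)" by (rule sym)
    thus ?thesis using N0 mult_left_cancel by blast
  qed
  have v0: "v0 = a*b*l1 + (1-b)*l0"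
  proof -
    have "N*(a*b*l1 + (1-b)*l0) = a*b*(N*l1) + (1-b)*(N*l0)" by (simp add: algebra_simps)
    also have "\<dots> = N*v0" unfolding l1N l0N unfolding N_def by Groebner_Basis.algebra
    finally have "N*v0 = N*(a*b*l1 + (1-b)*l0)" by (rule sym)
    thus ?thesis using N0 mult_left_cancel by blast
  qed
  define y1 where "y1 = 2*l1*l0 - 1 - a*l1^2"
  define y0 where "y0 = l0^2 + l1^2 - 2 - a*y1 - b*l1^2"
  define r1 where "r1 = 2*l1*l0 + 1 - a*y0 - b*y1"
  define r0 where "r0 = l0^2 - b*y0"
  define w where "w = 2 - v1^2 - a*(a^2-2*a-b) - b*(2-a)"
  have D1: "b*(a^2-2*a-b) + a*w + 1 + 2*v1*v0 = 0" and D2: "v0^2 + b*w = 0"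
    using D unfolding mumford_def w_def by auto
  have e1: "(a^2+1-b)*r1 - a*r0 = 0"
  proof -
    have "(a^2+1-b)*r1 - a*r0 = b*(a^2-2*a-b) + a*w + 1 + 2*v1*v0"
      unfolding w_def v1 v0 r1_def r0_def y0_def y1_def by Groebner_Basis.algebra
    thus ?thesis using D1 by simp
  qed
  have e0: "a*b*r1 + (1-b)*r0 = 0"
  proof -
    have "a*b*r1 + (1-b)*r0 = v0^2 + b*w"
      unfolding w_def v1 v0 r1_def r0_def y0_def y1_def by Groebner_Basis.algebra
    thus ?thesis using D2 by simp
  qed
  have "N*r1 = (1-b)*((a^2+1-b)*r1 - a*r0) + a*(a*b*r1 + (1-b)*r0)"
    "N*r0 = (a^2+1-b)*(a*b*r1 + (1-b)*r0) - a*b*((a^2+1-b)*r1 - a*r0)"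
    unfolding N_def by Groebner_Basis.algebra+
  hence "N*r1 = 0" "N*r0 = 0" unfolding e1 e0 by simp_all
  hence "r1 = 0" "r0 = 0" using N0 by simp_all
  hence r1: "2*l1*l0 + 1 = a*y0 + b*y1" and r0: "l0^2 = b*y0" unfolding r1_def r0_def by simp_all
  \<comment> \<open>For \<open>l1 = 0\<close> the new quadratic degenerates to a linear factor with
    root \<open>y0\<close>, the abscissa of a rational point of the curve. The three possible values
    are excluded by \<open>irr\<close> and \<open>ab\<close>.\<close>
  have l1: "l1 \<noteq> 0"
  proof
    assume l1: "l1 = 0"
    have y1: "y1 = -1" and y0: "y0 = l0^2 - 2 + a" by (simp_all add: y1_def y0_def l1)
    have q1: "1 = a*y0 - b" using r1 l1 y1 by simp
    have l: "l0^2 - (y0+2-a) = 0" using y0 by linarith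
    have b: "b = a*y0 - 1" using q1 by linarith
    have r: "l0^2 - (a*y0-1)*y0 = 0" using r0 unfolding b by simp
    have "((y0^2+1)*l0)^2 - (y0^5 + 2*y0^4 + 2*y0^2 - y0) =
      (y0^2+1)*((l0^2 - (a*y0-1)*y0) + y0^2*(l0^2 - (y0+2-a)))" by Groebner_Basis.algebra
    hence "((y0^2+1)*l0)^2 = y0^5 + 2*y0^4 + 2*y0^2 - y0" unfolding l r by simp
    hence "y0 = 0 \<or> y0 = 1 \<or> y0 = -1" by (rule rational_points)
    thus False
    proof (elim disjE)
      assume y: "y0 = 0"
      have "b = -1" "l0^2 = 0" "l0^2 = 2 - a" using q1 y0 r0 unfolding y by linarith+
      thus False using ab by simp
    next
      assume y: "y0 = 1"
      have "b = a - 1" "l0^2 = b" "l0^2 = 3 - a" using q1 y0 r0 unfolding y by linarith+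
      hence "a = 2" "b = 1" by simp_all
      thus False using irr[of "-1"] by simp
    next
      assume y: "y0 = -1"
      have "b = -a - 1" "l0^2 = -b" "l0^2 = 1 - a" using q1 y0 r0 unfolding y by linarith+
      hence "a = 0" "b = -1" by simp_all
      thus False using irr[of 1] by simp
    qed
  qed
  define a2 where "a2 = y1/l1^2"
  define b2 where "b2 = y0/l1^2"
  have y: "y1 = l1^2*a2" "y0 = l1^2*b2" using l1 by (auto simp: a2_def b2_def)
  have g3: "2*l1*l0 - 1 = l1^2*a2 + a*l1^2" using y1_def y by simp
  have g2: "l0^2 + l1^2 - 2 = l1^2*b2 + a*(l1^2*a2) + b*l1^2" using y0_def y by simp
  have g1: "2*l1*l0 + 1 = a*(l1^2*b2) + b*(l1^2*a2)" using r1 y by simp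
  have g0: "l0^2 = b*(l1^2*b2)" using r0 y by simp
  define w1 where "w1 = a2*(l0 - a2*l1) + b2*l1 - l1"
  define w0 where "w0 = b2*(l0 - a2*l1) - l0"
  have M: "mumford a2 b2 w1 w0"
  proof (rule mumfordI[of l1 "l1^2" l0 "a*l1^2" a2 l1 "(b+1)*l1^2" b2 l0 "a*l1^2" "b*l1^2" _ "l0 - a2*l1"])
    show "2*l1*l0 - 1 = a*l1^2 + a2*l1^2" using g3 by (simp add: algebra_simps)
    show "l0^2 + 2*l1*l1 - 2 = (b+1)*l1^2 + a2*(a*l1^2) + b2*l1^2" using g2 by (simp add: algebra_simps power2_eq_square)
    show "2*l1*l0 + 2*l0*l1 = a*l1^2 + a2*((b+1)*l1^2) + b2*(a*l1^2)" using g3 g1 by (simp add: algebra_simps power2_eq_square)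
    show "l1^2 + 2*l0*l0 - 2 = b*l1^2 + a2*(a*l1^2) + b2*((b+1)*l1^2)" using g2 g0 by (simp add: algebra_simps power2_eq_square)
    show "2*l1*l0 + 1 = a2*(b*l1^2) + b2*(a*l1^2)" using g1 by (simp add: algebra_simps)
    show "l0^2 = b2*(b*l1^2)" using g0 by (simp add: algebra_simps)
  qed (simp_all add: w1_def w0_def)
  define L where "L = l1^2*N"
  have L0: "L \<noteq> 0" using l1 N0 by (simp add: L_def)
  \<comment> \<open>This linear form vanishes where the translate reaches infinity, and there to
    even order, whence the square \<open>l1^2\<close>. The two quadratics enter symmetrically, so
    the identity serves for both.\<close>
  have trope: "kum a b (l1*(a^2+1-b) - a*l0) - a - b + 1 = l1^2*((1-b)^2+a^2)"
    if "2*l1*l0 - 1 = l1^2*a2 + a*l1^2" "l0^2 + l1^2 - 2 = l1^2*b2 + a*(l1^2*a2) + b*l1^2"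
      "2*l1*l0 + 1 = a*(l1^2*b2) + b*(l1^2*a2)" for a b a2 b2
  proof -
    have "l1^2*((1-b)^2+a^2) - (kum a b (l1*(a^2+1-b) - a*l0) - a - b + 1) =
      (a^3 - a*b)*(2*l1*l0 - 1 - (l1^2*a2 + a*l1^2)) - a^2*(l0^2 + l1^2 - 2 - (l1^2*b2 + a*(l1^2*a2) + b*l1^2))
      + a*(2*l1*l0 + 1 - (a*(l1^2*b2) + b*(l1^2*a2)))"
      unfolding kum_def by Groebner_Basis.algebra
    thus ?thesis unfolding that by simp
  qed
  have Leq: "L = kum a b v1 - a - b + 1"
    unfolding L_def N_def v1 using trope[OF g3 g2 g1] by simp
  have La: "L*(a2+b2-1) = 4*(b-1)"
  proof -
    have "L*(a2+b2-1) - 4*(b-1) = (a+b-1)*(2*l1*l0 - 1 - (l1^2*a2 + a*l1^2))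
       + (b-1-a)*(l0^2 + l1^2 - 2 - (l1^2*b2 + a*(l1^2*a2) + b*l1^2))
       + (1-a-b)*(2*l1*l0 + 1 - (a*(l1^2*b2) + b*(l1^2*a2))) + (a-b+1)*(l0^2 - b*(l1^2*b2))"
      unfolding L_def N_def by Groebner_Basis.algebra
    thus ?thesis unfolding g3 g2 g1 unfolding g0 by simp
  qed
  \<comment> \<open>At \<open>x = i\<close> the factorization, divided by \<open>x^2 + 1\<close>,
    says that \<open>l1^2\<close> times both values is \<open>2 + 2i\<close>, of norm 8.\<close>
  have N2: "l1^4*(((1-b2)^2+a2^2)*((1-b)^2+a^2)) = 8"
  proof -
    have re: "l1^2*((b-1)*(b2-1) - a*a2) = 2" using g2 g0 by (simp add: algebra_simps)
    have im: "l1^2*(a*(b2-1) + a2*(b-1)) = 2" using g3 g1 by (simp add: algebra_simps)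
    have "l1^4*(((1-b2)^2+a2^2)*((1-b)^2+a^2)) =
      (l1^2*((b-1)*(b2-1) - a*a2))^2 + (l1^2*(a*(b2-1) + a2*(b-1)))^2" by Groebner_Basis.algebra
    thus ?thesis unfolding re im by simp
  qed
  have LP: "L*kum a2 b2 w1 = 4*(b+1)"
  proof -
    have "kum a2 b2 (l1*(a2^2+1-b2) - a2*l0) - a2 - b2 + 1 = l1^2*((1-b2)^2+a2^2)"
      by (rule trope[of a a2 b b2]) (use g3 g2 g1 in \<open>simp_all only: ac_simps\<close>)
    moreover have "w1^2 = (l1*(a2^2+1-b2) - a2*l0)^2" unfolding w1_def by Groebner_Basis.algebra
    ultimately have "kum a2 b2 w1 = l1^2*((1-b2)^2+a2^2) + (a2 + b2 - 1)" unfolding kum_def by simp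
    hence "L*kum a2 b2 w1 = L*(l1^2*((1-b2)^2+a2^2)) + L*(a2+b2-1)"
      by (simp only: distrib_left)
    also have "L*(l1^2*((1-b2)^2+a2^2)) = l1^4*(((1-b2)^2+a2^2)*((1-b)^2+a^2))"
      unfolding L_def N_def by Groebner_Basis.algebra
    finally have "L*kum a2 b2 w1 = l1^4*(((1-b2)^2+a2^2)*((1-b)^2+a^2)) + L*(a2+b2-1)" .
    thus ?thesis unfolding N2 La by simp
  qed
  have Lb: "L*b2 = kum a b v1 + a + b - 1"
  proof -
    have "L*b2 - (L + 2*(a+b-1)) =
       a*(2*l1*l0 - 1 - (l1^2*a2 + a*l1^2)) + (b-1)*(l0^2 + l1^2 - 2 - (l1^2*b2 + a*(l1^2*a2) + b*l1^2))
       - a*(2*l1*l0 + 1 - (a*(l1^2*b2) + b*(l1^2*a2))) - (b-1)*(l0^2 - b*(l1^2*b2))"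
      unfolding L_def N_def by Groebner_Basis.algebra
    hence "L*b2 = L + 2*(a+b-1)" unfolding g3 g2 g1 unfolding g0 by simp
    thus ?thesis using Leq by simp
  qed
  have "l1^2*b*b2 = l0^2" using g0 by simp
  thus ?thesis using that[OF M L0 Leq Lb La LP l1 _ N2] by blast
qed

section \<open>Halving a divisor class\<close>

text \<open>A cubic \<open>c\<close> as in \<open>mumfordI\<close> whose quartic cofactor is fixed by \<open>x \<mapsto> -1/x\<close>; the square roots \<open>s\<close> and \<open>r\<close> of the
  norms of \<open>x\<close> and \<open>x\<^sup>2 + 2x - 1\<close> modulo \<open>u\<close> make it possible to prescribe \<open>c\<close> modulo \<open>x\<^sup>2 + 2x - 1\<close>.\<close>

lemma exists_cubic:
  fixes a b s r v1 v0 :: rat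
  assumes D: "mumford a b v1 v0" and b: "b = s^2" and s0: "s \<noteq> 0"
    and r: "r^2 = 2*(b+1)^2 - (a+b-1)^2" and r0: "r \<noteq> 0"
    and irr: "\<And>x. x^2 + a*x + b \<noteq> 0"
  shows "\<exists>c3 c2 c1 c0 q4 q3 q2.
     c3^2 = q4 \<and> 2*c3*c2 - 1 = q3 + a*q4 \<and> c2^2 + 2*c3*c1 - 2 = q2 + a*q3 + b*q4 \<and>
     2*c3*c0 + 2*c2*c1 = - q3 + a*q2 + b*q3 \<and> c1^2 + 2*c2*c0 - 2 = q4 - a*q3 + b*q2 \<and>
     2*c1*c0 + 1 = a*q4 - b*q3 \<and> c0^2 = b*q4 \<and> v1 = a*(c2-a*c3) + b*c3 - c1"
proof -
  \<comment> \<open>This factor occurs in the determinant of the linear system for \<open>p\<close>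
    and \<open>e\<close> below. The sign of the square root is free and is used to keep it
    nonzero.\<close>
  have "\<exists>r'. r'^2 = r^2 \<and> r' + (1+s^2) - s*(2-a) \<noteq> 0"
  proof (cases "a = 2")
    case True
    have "r^2 = (1+s^2)^2" unfolding r True b by Groebner_Basis.algebra
    moreover have "(1+s^2) + (1+s^2) - s*(2-a) \<noteq> 0"
      using True by (simp add: add_nonneg_eq_0_iff)
    ultimately show ?thesis by metis
  next
    case False
    have "r + (1+s^2) - s*(2-a) \<noteq> 0"
    proof
      assume "r + (1+s^2) - s*(2-a) = 0"
      hence "(2-a)*(1+s^2)*(a+2*s) = 0" using r unfolding b by Groebner_Basis.algebra
      moreover have "1 + s^2 \<noteq> 0" by (simp add: add_nonneg_eq_0_iff)
      ultimately have "a = -2*s" using False by auto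
      with irr[of s] show False unfolding b by (simp add: power2_eq_square)
    qed
    thus ?thesis by blast
  qed
  then obtain r' where r': "r'^2 = r^2" and nz: "r' + (1+s^2) - s*(2-a) \<noteq> 0" by blast
  have r'0: "r' \<noteq> 0" using r' r0 by auto
  define D where "D = s*(r'*(r' + (1+s^2) - s*(2-a)))"
  have D0: "D \<noteq> 0" unfolding D_def using s0 r'0 nz by simp
  define X1 where "X1 = r' - s*(2-a)"
  define Y1 where "Y1 = -(2-a)*(a+s)-(1+b)"
  define X0 where "X0 = s*(1+b)"
  define Y0 where "Y0 = s*(1+b-s*(2-a))"
  have det: "X1*Y0 - X0*Y1 = D" unfolding X1_def Y1_def X0_def Y0_def D_def
    using r r' unfolding b by Groebner_Basis.algebra
  define p where "p = (-v1*Y0 + v0*Y1)/D"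
  define e where "e = (-v0*X1 + v1*X0)/D"
  have e1: "p*X1 + e*Y1 = -v1" and e0: "p*X0 + e*Y0 = -v0"
  proof -
    have pD: "p*D = -v1*Y0 + v0*Y1" and eD: "e*D = -v0*X1 + v1*X0" using D0 by (simp_all add: p_def e_def)
    have "D*(p*X1 + e*Y1) = D*(-v1)" using pD eD det by Groebner_Basis.algebra
    thus "p*X1 + e*Y1 = -v1" using D0 mult_left_cancel by blast
    have "D*(p*X0 + e*Y0) = D*(-v0)" using pD eD det by Groebner_Basis.algebra
    thus "p*X0 + e*Y0 = -v0" using D0 mult_left_cancel by blast
  qed
  \<comment> \<open>That is, \<open>c = p x (u + r') + (e (x - s) - p s) (x^2 + 2x - 1)\<close>. In
    this family \<open>c0 = s*c3\<close>, which makes the outer coefficients of the quartic equal;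
    \<open>p\<close> and \<open>e\<close> were solved for so that \<open>c\<close> is congruent to
    \<open>-(v1 x + v0)\<close> modulo \<open>u\<close>.\<close>
  define c3 where "c3 = p + e"
  define c2 where "c2 = p*(a-s) + e*(2-s)"
  define c1 where "c1 = p*(b+r'-2*s) - e*(1+2*s)"
  define c0 where "c0 = s*c3"
  define l where "l = c2 - a*c3"
  have l1: "c1 + v1 = a*l + b*c3" using e1 unfolding X1_def Y1_def l_def c3_def c2_def c1_def b
    by Groebner_Basis.algebra
  have l0: "c0 + v0 = b*l" using e0 unfolding X0_def Y0_def l_def c3_def c2_def c0_def b
    by Groebner_Basis.algebra
  define w where "w = 2 - v1^2 - a*(a^2-2*a-b) - b*(2-a)"
  have D1: "b*(a^2-2*a-b) + a*w + 1 + 2*v1*v0 = 0" and D2: "v0^2 + b*w = 0"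
    using D unfolding mumford_def w_def by auto
  define q4 where "q4 = c3^2"
  define q3 where "q3 = -1 + 2*c3*l + a*c3^2"
  define q2 where "q2 = -(2-a) - 2*v1*c3 + l^2 + 2*a*c3*l + b*c3^2"
  define q1 where "q1 = -(a^2-2*a-b) - 2*(v1*l+v0*c3) + a*l^2 + 2*b*c3*l"
  define q0 where "q0 = -w - 2*v0*l + b*l^2"
  have v1: "v1 = a*l + b*c3 - c1" and v0: "v0 = b*l - c0" using l1 l0 by (simp_all add: algebra_simps)
  have c2: "c2 = l + a*c3" by (simp add: l_def)
  have f5: "2*c3*c2 - 1 = q3 + a*q4" unfolding q3_def q4_def c2 by Groebner_Basis.algebra
  have f4: "c2^2 + 2*c3*c1 - 2 = q2 + a*q3 + b*q4"
    unfolding q2_def q3_def q4_def c2 v1 by Groebner_Basis.algebra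
  have f3: "2*c3*c0 + 2*c2*c1 = q1 + a*q2 + b*q3"
    unfolding q1_def q2_def q3_def c2 v1 v0 by Groebner_Basis.algebra
  have f2: "c1^2 + 2*c2*c0 - 2 = q0 + a*q1 + b*q2"
    unfolding q0_def q1_def q2_def c2 w_def v0 using v1 by Groebner_Basis.algebra
  have f1: "2*c1*c0 + 1 = a*q0 + b*q1"
    using D1 v1 v0 unfolding q0_def q1_def by Groebner_Basis.algebra
  have f0: "c0^2 = b*q0"
    using D2 v0 unfolding q0_def by Groebner_Basis.algebra
  have b0: "b \<noteq> 0" using b s0 by simp
  have "b*q0 = b*q4" using f0 unfolding c0_def q4_def b by (metis power_mult_distrib)
  hence q0: "q0 = q4" using b0 by simp
  \<comment> \<open>Modulo \<open>x\<^sup>2 + 2x - 1\<close> the cubic \<open>c\<close> is \<open>p x (u + r')\<close>, whose square is \<open>x\<^sup>2 u\<close> times a constant.\<close>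
  define g where "g = b + 5 - 2*a + r'"
  \<comment> \<open>\<open>al x + be\<close> is the quartic modulo \<open>x^2 + 2x - 1\<close>. It
    has to be a multiple of \<open>x^2\<close>, that is of \<open>1 - 2x\<close>; with
    \<open>q0 = q4\<close> this reads \<open>q1 = -q3\<close>.\<close>
  define al where "al = -12*q4 + 5*q3 - 2*q2 + q1"
  define be where "be = 5*q4 - 2*q3 + q2 + q0"
  have g1: "(a-2)*al + (b+1)*be = p^2*((a-2)^2 + g^2)"
  proof -
    have "(a-2)*al + (b+1)*be =
      (c0 + c2 - 2*c3)^2 + (c1 - 2*c2 + 5*c3)^2"
      using f5 f4 f3 f2 f1 f0 unfolding al_def be_def q4_def by Groebner_Basis.algebra
    moreover have "c0 + c2 - 2*c3 = p*(a-2)" unfolding c0_def c2_def c3_def by Groebner_Basis.algebra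
    moreover have "c1 - 2*c2 + 5*c3 = p*g" unfolding c1_def c2_def c3_def g_def by Groebner_Basis.algebra
    ultimately show ?thesis by Groebner_Basis.algebra
  qed
  have g2: "(a-2)*be + (b+1)*al - 2*(a-2)*al = p^2*(2*(a-2)*g - 2*g^2)"
  proof -
    have "(a-2)*be + (b+1)*al - 2*(a-2)*al =
      2*(c0 + c2 - 2*c3)*(c1 - 2*c2 + 5*c3) - 2*(c1 - 2*c2 + 5*c3)^2"
      using f5 f4 f3 f2 f1 f0 unfolding al_def be_def q4_def by Groebner_Basis.algebra
    moreover have "c0 + c2 - 2*c3 = p*(a-2)" unfolding c0_def c2_def c3_def by Groebner_Basis.algebra
    moreover have "c1 - 2*c2 + 5*c3 = p*g" unfolding c1_def c2_def c3_def g_def by Groebner_Basis.algebra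
    ultimately show ?thesis by Groebner_Basis.algebra
  qed
  have "r^2*(al + 2*be) = 0" using g1 g2 r r' unfolding g_def by Groebner_Basis.algebra
  hence "al + 2*be = 0" using r0 by simp
  hence q1: "q1 = -q3" unfolding al_def be_def q0 by simp
  have "c3^2 = q4 \<and> 2*c3*c2 - 1 = q3 + a*q4 \<and> c2^2 + 2*c3*c1 - 2 = q2 + a*q3 + b*q4 \<and>
     2*c3*c0 + 2*c2*c1 = - q3 + a*q2 + b*q3 \<and> c1^2 + 2*c2*c0 - 2 = q4 - a*q3 + b*q2 \<and>
     2*c1*c0 + 1 = a*q4 - b*q3 \<and> c0^2 = b*q4 \<and> v1 = a*(c2-a*c3) + b*c3 - c1"
    using f5 f4 f3 f2 f1 f0 v1 unfolding q0 q1 l_def q4_def by simp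
  thus ?thesis by blast
qed

text \<open>Write \<open>p\<^sup>*(x) = x\<^sup>n p(-1/x)\<close> for the reversal of a polynomial of formal degree \<open>n\<close>; it fixes \<open>f\<close>. With
  \<open>u = x\<^sup>2 + a x + b\<close> and \<open>d = (n x + m) u\<close> the three equations are \<open>4 f = d\<^sup>2 + (d\<^sup>*)\<^sup>2 - v (x\<^sup>2 + 1) u u\<^sup>*\<close>, so \<open>(d\<^sup>*/2)\<^sup>2 = f\<close>
  modulo \<open>u\<close>.\<close>

definition half_datum :: "rat \<Rightarrow> rat \<Rightarrow> rat \<Rightarrow> rat \<Rightarrow> rat \<Rightarrow> bool" where
  "half_datum a b m n v \<longleftrightarrow> v*b - n^2 - b^2*m^2 = 0 \<and>
    4 - 2*n*(m+a*n) + 2*(b*m)*(a*m+b*n) + v*a*(b-1) = 0 \<and>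
    8 - (m+a*n)^2 - 2*n*(a*m+b*n) - (a*m+b*n)^2 - 2*(b*m)*(m+a*n) + v*(b+1+b^2-a^2) = 0"

lemma half_datumD:
  assumes "half_datum a b m n v"
  shows "v*b - n^2 - b^2*m^2 = 0"
    and "4 - 2*n*(m+a*n) + 2*(b*m)*(a*m+b*n) + v*a*(b-1) = 0"
    and "8 - (m+a*n)^2 - 2*n*(a*m+b*n) - (a*m+b*n)^2 - 2*(b*m)*(m+a*n) + v*(b+1+b^2-a^2) = 0"
  using assms unfolding half_datum_def by blast+

text \<open>The value \<open>v1\<close> of the Mumford form \<open>(u, v)\<close> with \<open>v = d\<^sup>*/2\<close> modulo \<open>u\<close>.\<close>

definition half_slope :: "rat \<Rightarrow> rat \<Rightarrow> rat \<Rightarrow> rat \<Rightarrow> rat" where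
  "half_slope a b m n = (b*m*(a^2-b) + a*(a*m+b*n) + (m+a*n))/2"

text \<open>If a cubic \<open>d\<close> satisfies \<open>d d\<^sup>* = (g x\<^sup>2 + 2 a x - g) Q\<close> with \<open>Q\<^sup>* = Q\<close>, then \<open>d = (n x + m) e\<close> with \<open>Q = k e e\<^sup>*\<close>,
  because the quadratic has the rational roots \<open>-m/n\<close> and \<open>n/m\<close>.\<close>

lemma factor_antipalindromic:
  fixes a g t d3 d2 d1 d0 q4 q3 q2 :: rat
  assumes t: "g^2 + a^2 = t^2" and t0: "t \<noteq> 0"
    and e6: "d3*d0 = g*q4" and e5: "d2*d0 - d3*d1 = g*q3 + 2*a*q4"
    and e4: "d1*d0 - d2*d1 + d3*d2 = g*q2 + 2*a*q3 - g*q4"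
    and e3: "d0^2 - d1^2 + d2^2 - d3^2 = 2*a*q2 - 2*g*q3"
  shows "\<exists>n m k e2 e1 e0. k \<noteq> 0 \<and> n*m = k*g \<and> m^2 - n^2 = 2*k*a \<and>
     d3 = n*e2 \<and> d2 = m*e2 + n*e1 \<and> d1 = m*e1 + n*e0 \<and> d0 = m*e0 \<and>
     q4 = k*(e0*e2) \<and> q3 = k*(e1*(e0-e2)) \<and> q2 = k*(e2^2+e0^2-e1^2)"
proof -
  have "\<exists>t'. t'^2 = t^2 \<and> a + t' \<noteq> 0"
  proof (cases "a + t = 0")
    case True
    thus ?thesis using t0 by (intro exI[of _ "-t"]) auto
  qed auto
  then obtain t' where t': "t'^2 = t^2" and "a + t' \<noteq> 0" by blast
  define h where "h = a + t'"
  have h0: "h \<noteq> 0" using \<open>a + t' \<noteq> 0\<close> by (simp add: h_def)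
  have gh: "h^2 - g^2 = 2*a*h" using t t' unfolding h_def by Groebner_Basis.algebra
  have "\<exists>n m k e2 e1 e0. k \<noteq> 0 \<and> n*m = k*g \<and> m^2 - n^2 = 2*k*a \<and>
     d3 = n*e2 \<and> d2 = m*e2 + n*e1 \<and> d1 = m*e1 + n*e0 \<and> d0 = m*e0"
  proof -
    \<comment> \<open>Up to the factor \<open>h^6\<close>, this is \<open>d\<close> times its
      reversal at the root \<open>g/h\<close> of the quadratic. So \<open>d\<close> vanishes at
      \<open>g/h\<close> or \<open>-h/g\<close>; the homogeneous form admits
      \<open>g = 0\<close>.\<close>
    have "(d3*g^3 + d2*g^2*h + d1*g*h^2 + d0*h^3) * (d0*g^3 - d1*g^2*h + d2*g*h^2 - d3*h^3) = 0"
      using e6 e5 e4 e3 gh by Groebner_Basis.algebra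
    then consider (1) "d3*g^3 + d2*g^2*h + d1*g*h^2 + d0*h^3 = 0" | (2) "d0*g^3 - d1*g^2*h + d2*g*h^2 - d3*h^3 = 0"
      by auto
    thus ?thesis
    proof cases
      case 1
      define e2 where "e2 = d3/h"
      define e1 where "e1 = (d2 + g*e2)/h"
      define e0 where "e0 = (d1 + g*e1)/h"
      have d3: "d3 = h*e2" and d2: "d2 = h*e1 - g*e2" and d1: "d1 = h*e0 - g*e1"
        using h0 by (simp_all add: e2_def e1_def e0_def)
      have "h^3*(d0 + g*e0) = 0" using 1 unfolding d3 d2 d1 by Groebner_Basis.algebra
      hence d0: "d0 = -g*e0" using h0 by simp
      have "-h \<noteq> 0 \<and> h*(-g) = (-h)*g \<and> (-g)^2 - h^2 = 2*(-h)*a \<and>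
        d3 = h*e2 \<and> d2 = (-g)*e2 + h*e1 \<and> d1 = (-g)*e1 + h*e0 \<and> d0 = (-g)*e0"
        using h0 gh d3 d2 d1 d0 by (simp add: algebra_simps)
      thus ?thesis by blast
    next
      case 2
      define y2 where "y2 = d0/h"
      define y1 where "y1 = (g*y2 - d1)/h"
      define y0 where "y0 = (d2 + g*y1)/h"
      have d0: "d0 = h*y2" and d1: "d1 = g*y2 - h*y1" and d2: "d2 = h*y0 - g*y1"
        using h0 by (simp_all add: y2_def y1_def y0_def)
      have "h^3*(d3 - g*y0) = 0" using 2 unfolding d0 d2 d1 by Groebner_Basis.algebra
      hence d3: "d3 = g*y0" using h0 by simp
      have "h \<noteq> 0 \<and> g*h = h*g \<and> h^2 - g^2 = 2*h*a \<and>
        d3 = g*y0 \<and> d2 = h*y0 + g*(-y1) \<and> d1 = h*(-y1) + g*y2 \<and> d0 = h*y2"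
        using h0 gh d3 d2 d1 d0 by (simp add: algebra_simps)
      thus ?thesis by blast
    qed
  qed
  then obtain n m k e2 e1 e0 where k: "k \<noteq> 0" and nm: "n*m = k*g" "m^2 - n^2 = 2*k*a"
    and d: "d3 = n*e2" "d2 = m*e2 + n*e1" "d1 = m*e1 + n*e0" "d0 = m*e0" by blast
  define y4 where "y4 = q4 - k*(e0*e2)"
  define y3 where "y3 = q3 - k*(e1*(e0-e2))"
  define y2 where "y2 = q2 - k*(e2^2+e0^2-e1^2)"
  have z: "g*y4 = 0" "g*y3 + 2*a*y4 = 0" "g*y2 + 2*a*y3 - g*y4 = 0" "2*a*y2 - 2*g*y3 = 0"
    using e6 e5 e4 e3 nm unfolding d y4_def y3_def y2_def by Groebner_Basis.algebra+
  have "y4 = 0 \<and> y3 = 0 \<and> y2 = 0"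
  proof (cases "g = 0")
    case True
    hence "a \<noteq> 0" using t t0 by auto
    thus ?thesis using z True by auto
  next
    case False
    thus ?thesis using z by auto
  qed
  hence "q4 = k*(e0*e2)" "q3 = k*(e1*(e0-e2))" "q2 = k*(e2^2+e0^2-e1^2)"
    unfolding y4_def y3_def y2_def by auto
  with k nm d show ?thesis by blast
qed

text \<open>Apply the preceding lemma to \<open>d = c - c\<^sup>*\<close>: reversing \<open>c\<^sup>2 - f = u Q\<close> and subtracting gives
  \<open>(c - c\<^sup>*) (c + c\<^sup>*) = (u - u\<^sup>*) Q\<close>.\<close>

lemma half_from_cubic:
  fixes a b t v1 c3 c2 c1 c0 q4 q3 q2 :: rat
  assumes t: "(1-b)^2 + a^2 = t^2" and t0: "t \<noteq> 0"
    and irr: "\<And>x. x^2 + a*x + b \<noteq> 0"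
    and f6: "c3^2 = q4" and f5: "2*c3*c2 - 1 = q3 + a*q4" and f4: "c2^2 + 2*c3*c1 - 2 = q2 + a*q3 + b*q4"
    and f3: "2*c3*c0 + 2*c2*c1 = - q3 + a*q2 + b*q3" and f2: "c1^2 + 2*c2*c0 - 2 = q4 - a*q3 + b*q2"
    and f1: "2*c1*c0 + 1 = a*q4 - b*q3" and f0: "c0^2 = b*q4" and v1: "v1 = a*(c2-a*c3) + b*c3 - c1"
  shows "\<exists>a' b' m n v K. K \<noteq> 0 \<and> half_datum a' b' m n v \<and>
      K = v + 2*m*n \<and> K*a = 2*(m^2-n^2) \<and> K*b = v - 2*m*n \<and>
      2*c3 = n+b'*m \<and> 2*c2 = m+a'*n-a'*m-b'*n \<and> 2*c1 = m+a'*n+a'*m+b'*n \<and> 2*c0 = b'*m-n \<and>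
      v1^2+a^3-2*a^2-a*b+b-1 = 1-b+a*b + K/4*b' - 2*c0*c2 + 2*a*c0*c3 + b*(2-a+K/4*(1+b'^2-a'^2+b*b')-2*c1*c3)"
proof -
  define g where "g = 1 - b"
  have b: "b = 1 - g" by (simp add: g_def)
  have "\<exists>n m k e2 e1 e0. k \<noteq> 0 \<and> n*m = k*g \<and> m^2 - n^2 = 2*k*a \<and>
     c3 - c0 = n*e2 \<and> c2 + c1 = m*e2 + n*e1 \<and> c1 - c2 = m*e1 + n*e0 \<and> c0 + c3 = m*e0 \<and>
     q4 = k*(e0*e2) \<and> q3 = k*(e1*(e0-e2)) \<and> q2 = k*(e2^2+e0^2-e1^2)"
  proof (rule factor_antipalindromic)
    show "g^2 + a^2 = t^2" using t by (simp add: g_def)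
    show "(c3 - c0)*(c0 + c3) = g*q4" using f6 f0 unfolding b by (simp add: algebra_simps power2_eq_square)
    show "(c2 + c1)*(c0 + c3) - (c3 - c0)*(c1 - c2) = g*q3 + 2*a*q4"
      using f5 f1 unfolding b by Groebner_Basis.algebra
    show "(c1-c2)*(c0+c3) - (c2+c1)*(c1-c2) + (c3-c0)*(c2+c1) = g*q2 + 2*a*q3 - g*q4"
      using f4 f2 unfolding b by Groebner_Basis.algebra
    show "(c0+c3)^2 - (c1-c2)^2 + (c2+c1)^2 - (c3-c0)^2 = 2*a*q2 - 2*g*q3"
      using f3 unfolding b by Groebner_Basis.algebra
  qed (rule t0)
  then obtain n m k e2 e1 e0 where k: "k \<noteq> 0" and nm: "n*m = k*g" "m^2 - n^2 = 2*k*a"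
    and d: "c3 - c0 = n*e2" "c2 + c1 = m*e2 + n*e1" "c1 - c2 = m*e1 + n*e0" "c0 + c3 = m*e0"
    and q: "q4 = k*(e0*e2)" "q3 = k*(e1*(e0-e2))" "q2 = k*(e2^2+e0^2-e1^2)" by blast
  \<comment> \<open>\<open>e2 x^2 + e1 x + e0\<close> is to represent the half. If its degree
    dropped, its root would be a root of the quartic, hence the abscissa of a rational point of the
    curve, and \<open>x^2 + a x + b\<close> would be reducible.\<close>
  have e2: "e2 \<noteq> 0"
  proof
    assume e2: "e2 = 0"
    hence q4: "q4 = 0" and c3: "c3 = 0" and c0: "c0 = 0" using q f6 f0 by auto
    have q3: "q3 = -1" using f5 c3 q4 by simp
    hence k01: "k*e1*e0 = -1" using q e2 by simp
    hence e10: "e1 \<noteq> 0" "e0 \<noteq> 0" by auto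
    define x where "x = -e0/e1"
    have x0: "x \<noteq> 0" and e0x: "e0 = -x*e1" using e10 by (auto simp: x_def)
    have q2x: "x*q2 = x^2 - 1"
    proof -
      have "q2 = k*(e0^2-e1^2)" using q e2 by simp
      moreover have "k*(x*e1^2) = 1" using k01 unfolding e0x by (simp add: power2_eq_square algebra_simps)
      ultimately show ?thesis unfolding e0x by Groebner_Basis.algebra
    qed
    have "(c2*x^2+c1*x)^2 = x^5 + 2*x^4 + 2*x^2 - x"
      using f5 f4 f3 f2 f1 f0 f6 q2x q3 unfolding q4 c3 c0 by Groebner_Basis.algebra
    hence "x = 1 \<or> x = -1" using rational_points x0 by blast
    hence q2: "q2 = 0" using q2x by auto
    have 1: "c2^2 = 2 - a" "2*c2*c1 = 1 - b" "c1^2 = 2 + a" "b = 1"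
      using f4 f3 f2 f1 unfolding q2 q3 q4 c3 c0 by auto
    hence "c2 = 0 \<or> c1 = 0" by auto
    hence "a = 2 \<or> a = -2" using 1 by auto
    thus False using irr[of 1] irr[of "-1"] \<open>b = 1\<close> by auto
  qed
  define a' where "a' = e1/e2"
  define b' where "b' = e0/e2"
  define n' where "n' = n*e2"
  define m' where "m' = m*e2"
  define k' where "k' = k*e2^2"
  have e: "e1 = a'*e2" "e0 = b'*e2" using e2 by (auto simp: a'_def b'_def)
  have k'0: "k' \<noteq> 0" using k e2 by (simp add: k'_def)
  have nm': "n'*m' = k'*(1-b)" "m'^2 - n'^2 = 2*k'*a"
    using nm unfolding n'_def m'_def k'_def g_def by Groebner_Basis.algebra+
  have d': "c3 - c0 = n'" "c2 + c1 = m' + a'*n'" "c1 - c2 = a'*m' + b'*n'" "c0 + c3 = b'*m'"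
    using d unfolding e n'_def m'_def by (auto simp: algebra_simps)
  have q': "q4 = k'*b'" "q3 = k'*(a'*(b'-1))" "q2 = k'*(1+b'^2-a'^2)"
    using q unfolding e k'_def by (auto simp: algebra_simps power2_eq_square)
  \<comment> \<open>Write \<open>u\<close> for \<open>x^2 + a x + b\<close> and \<open>Q\<close> for
    the quartic. The sum of \<open>c^2 - f = u Q\<close> and its reversal has
    \<open>(1+b) (x^2 + 1) Q\<close> on the right; since the reversal of \<open>d\<close> is the sum
    of \<open>c\<close> and its reversal, this is the equation of \<open>half_datum\<close> with
    this \<open>v\<close>.\<close>
  define v where "v = 2*k'*(1+b)"
  have c: "2*c3 = n'+b'*m'" "2*c0 = b'*m'-n'" "2*c2 = m'+a'*n'-a'*m'-b'*n'" "2*c1 = m'+a'*n'+a'*m'+b'*n'"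
    using d' by (simp_all add: algebra_simps)
  have K: "4*k' = v + 2*m'*n'" "(4*k')*a = 2*(m'^2-n'^2)" "(4*k')*b = v - 2*m'*n'"
    using nm' unfolding v_def by (simp_all add: algebra_simps)
  have E6: "v*b' - n'^2 - b'^2*m'^2 = 0"
    using f6 f0 q' c nm' unfolding v_def by Groebner_Basis.algebra
  have E5: "4 - 2*n'*(m'+a'*n') + 2*(b'*m')*(a'*m'+b'*n') + v*a'*(b'-1) = 0"
    using f5 f1 q' d' nm' unfolding v_def by Groebner_Basis.algebra
  have E4: "8 - (m'+a'*n')^2 - 2*n'*(a'*m'+b'*n') - (a'*m'+b'*n')^2 - 2*(b'*m')*(m'+a'*n') + v*(b'+1+b'^2-a'^2) = 0"
    using f4 f2 q' d' nm' unfolding v_def by Groebner_Basis.algebra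
  have P: "v1^2+a^3-2*a^2-a*b+b-1 = 1-b+a*b + k'*b' - 2*c0*c2 + 2*a*c0*c3 + b*(2-a+k'*(1+b'^2-a'^2+b*b')-2*c1*c3)"
  proof -
    define l where "l = c2 - a*c3"
    have c2: "c2 = l + a*c3" by (simp add: l_def)
    have l1: "2*c3*l = 1 + q3 - a*q4" using f5 unfolding c2 f6[symmetric] by (simp add: algebra_simps power2_eq_square)
    have l2: "l^2 = 2 - a + q2 + b*q4 - 2*c1*c3" using f4 f6 l1 unfolding c2 by Groebner_Basis.algebra
    have l3: "2*l*c1 = - q3 + a*q2 + b*q3 - 2*c3*c0 - 2*a*c3*c1" using f3 unfolding c2 by Groebner_Basis.algebra
    have c1: "c1^2 = 2 + q4 - a*q3 + b*q2 - 2*l*c0 - 2*a*c3*c0" using f2 unfolding c2 by Groebner_Basis.algebra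
    have "v1^2 = a^2*l^2 + b^2*c3^2 + c1^2 + a*b*(2*c3*l) - a*(2*l*c1) - 2*b*c3*c1"
      using v1 unfolding l_def by Groebner_Basis.algebra
    also have "\<dots> = 2 - 2*b + 2*a*b + q4 - 2*c0*l + b*l^2 - a^3 + 2*a^2"
      unfolding l1 l3 c1 l2 f6 by Groebner_Basis.algebra
    finally have "v1^2+a^3-2*a^2-a*b+b-1 = 1-b+a*b + q4 - 2*c0*c2 + 2*a*c0*c3 + b*(2-a+q2+b*q4-2*c1*c3)"
      unfolding l2 c2 by (simp add: algebra_simps)
    thus ?thesis unfolding q' by (simp add: algebra_simps)
  qed
  have H: "half_datum a' b' m' n' v" unfolding half_datum_def using E6 E5 E4 by blast
  have "4*k' \<noteq> 0 \<and> half_datum a' b' m' n' v \<and>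
      4*k' = v + 2*m'*n' \<and> (4*k')*a = 2*(m'^2-n'^2) \<and> (4*k')*b = v - 2*m'*n' \<and>
      2*c3 = n'+b'*m' \<and> 2*c2 = m'+a'*n'-a'*m'-b'*n' \<and> 2*c1 = m'+a'*n'+a'*m'+b'*n' \<and> 2*c0 = b'*m'-n' \<and>
      v1^2+a^3-2*a^2-a*b+b-1 = 1-b+a*b + (4*k')/4*b' - 2*c0*c2 + 2*a*c0*c3 + b*(2-a+(4*k')/4*(1+b'^2-a'^2+b*b')-2*c1*c3)"
  proof (intro conjI)
    show "4*k' \<noteq> 0" using k'0 by simp
  qed ((fact H K c)+, use P in simp)
  thus ?thesis by blast
qed

section \<open>Duplication formulas in Kummer coordinates\<close>

lemma mumford_half:
  fixes a b m n v :: rat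
  assumes H: "half_datum a b m n v"
  shows "mumford a b (half_slope a b m n) ((b*m*a*b + b*(a*m+b*n) - n)/2)"
proof -
  note E6 = half_datumD(1)[OF H] and E5 = half_datumD(2)[OF H] and E4 = half_datumD(3)[OF H]
  define v1 where "v1 = (b*m*(a^2-b) + a*(a*m+b*n) + (m+a*n))/2"
  define v0 where "v0 = (b*m*a*b + b*(a*m+b*n) - n)/2"
  have v: "2*v1 = b*m*(a^2-b) + a*(a*m+b*n) + (m+a*n)" "2*v0 = b*m*a*b + b*(a*m+b*n) - n"
    by (simp_all add: v1_def v0_def)
  have "4*(b*(a^2-2*a-b) + a*(2 - v1^2 - a*(a^2-2*a-b) - b*(2-a)) + 1 + 2*v1*v0) = 0"
    using v E6 E5 E4 by Groebner_Basis.algebra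
  moreover have "4*(v0^2 + b*(2 - v1^2 - a*(a^2-2*a-b) - b*(2-a))) = 0"
    using v E6 E5 E4 by Groebner_Basis.algebra
  ultimately show ?thesis unfolding mumford_def half_slope_def v1_def v0_def by simp
qed

text \<open>The first Kummer coordinate of the double times \<open>4*K\<close>, as
  \<open>half_first_coordinate\<close> shows.\<close>

definition half_quartic :: "rat \<Rightarrow> rat \<Rightarrow> rat \<Rightarrow> rat \<Rightarrow> rat \<Rightarrow> rat" where
  "half_quartic a b m n v = - 2*a*b*m*n*v - 4*a*b*m^2*v + 6*a*m*n^3 + 8*a*m^2*n^2 - 2*a*m^3*n + 6*b*m^2*n^2 + 8*b*m^3*n - 2*b*m^4
        - 4*b^2*m*n*v + 3*b^2*m^2*v - 2*a*b*v^2 + 4*a*n^2*v - 4*b*m*n*v + b*m^2*v - 5*b*n^2*v + b^2*v^2 +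
        8*m*n^3 - 2*m^2*n^2 + 6*n^4 + 4*a*m^2 + m^2*v + 2*n^2*v"

text \<open>The cofactors below are Groebner basis certificates.\<close>

lemma half_relations:
  assumes H: "half_datum a b m n v" and P: "P = kum a b (half_slope a b m n)" and q: "q = 1-a-b"
  shows "2*(b-1)*q*(2*v-2*(m^2-n^2)) = 4*(v-m^2-n^2)*(b*P-q)"
    and "2*(b-1)*q*(-2*v-2*(m^2-n^2)) = -4*(v-m^2-n^2)*(b*q+P)"
    and "2*(b-1)*q*(-4*m*n-2*(m^2-n^2)) = (v-m^2-n^2)*(4*b^2-4-2*P*q)"
    and "2*(b-1)*q*half_quartic a b m n v = 4*(b-1)*q*P*(v+m^2-n^2) - 4*(v-m^2-n^2)*(b*q*P+q^2-8*b)"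
proof -
  note E6 = half_datumD(1)[OF H] and E5 = half_datumD(2)[OF H] and E4 = half_datumD(3)[OF H]
  have P4: "4*P = (b*m*(a^2-b) + a*(a*m+b*n) + (m+a*n))^2 + 4*(a^3-2*a^2-a*b+b-1)"
    unfolding P kum_def half_slope_def by (simp add: power_divide)
  let ?G = "half_quartic a b m n v"
  let ?E6 = "v*b - n^2 - b^2*m^2"
  let ?E5 = "4 - 2*n*(m+a*n) + 2*(b*m)*(a*m+b*n) + v*a*(b-1)"
  let ?E4 = "8 - (m+a*n)^2 - 2*n*(a*m+b*n) - (a*m+b*n)^2 - 2*(b*m)*(m+a*n) + v*(b+1+b^2-a^2)"
  let ?P4 = "4*P - (- 8*a*b*m*n + 2*a*b*m^2 + a^2*b*v + a^2*m^2 - 3*a^2*n^2 - 6*b^2*m*n - 2*b^2*m^2 - 3*b^2*n^2 +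
        b^3*v - 3*a*b*v + 6*a*n^2 + 8*b*m*n - 2*b*m^2 - 2*b*n^2 + 2*b^2*v - a*v - 2*m*n + m^2 + 2*n^2 + 4*a +
        4*b)"
  let ?a1 = "2*(b-1)*q*(2*v-2*(m^2-n^2)) - (4*(v-m^2-n^2)*(b*P-q))"
  let ?a3 = "2*(b-1)*q*(-2*v-2*(m^2-n^2)) - (-4*(v-m^2-n^2)*(b*q+P))"
  let ?a2 = "2*(b-1)*q*(-4*m*n-2*(m^2-n^2)) - ((v-m^2-n^2)*(4*b^2-4-2*P*q))"
  have "2 * ?P4 = (- 2*a*b^2*m^2 - a*b^2*n^2 - 2*a^2*b*m*n + a^3*m^2 - a^3*n^2 - 2*b^3*m*n - 2*a*b*m^2 + 2*a*b*n^2 +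
      2*a^2*m*n - 2*a^4 + a*m^2 + 2*a*n^2 + 4*a^2*b - 2*b^2 + 2*m*n + 8*a - 4*b) * ?E6 + (a^2*b*m^2 - b^3*m^2
      + 4*a*b*m*n + a^2*n^2 + b^2*n^2 + 2*a^3 + b*m^2 - 2*a*b - n^2 - 2*a - 2) * ?E5 + (a*b^2*m^2 + 2*b^2*m*n
      - a*n^2 - 2*b*m*n - 2*a^2) * ?E4"
    using P4 by Groebner_Basis.algebra
  hence P4: "?P4 = 0" unfolding E6 E5 E4 by simp
  have "1 * (?a1) = (- 10*a*b*m^2*n^2 - 2*a*b*m^4 + 2*a*b^2*m^2*v + a*b^2*n^2*v + 2*a^2*b*m*n*v - 2*a^2*m*n^3 - 2*a^2*m^3*n
      - a^3*m^2*v + a^3*n^2*v - 4*b^2*m*n^3 - 2*b^2*m^3*n + 2*b^3*m*n*v + a*b*m^2*v - 3*a*b*n^2*v -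
      6*a*m^2*n^2 + 2*a*n^4 - 3*a^2*b*m^2 + a^2*b*n^2 - 4*a^2*m*n*v - 4*b*m*n^3 - 4*b*m^3*n + 2*b^2*m*n*v +
      b^3*n^2 + 8*a*b*m*n + 6*a*b*m^2 - a*n^2*v - a^2*b*v + 4*a^2*m^2 + 4*a^2*n^2 + 2*b*m*n*v + 6*b^2*m*n +
      2*b^2*m^2 + 2*b^2*n^2 - b^3*v + 2*m*n^3 + 3*a*b*v + 16*a*m*n - 14*a*n^2 + 8*b*m*n + 3*b*m^2 + 6*b*n^2 -
      2*b^2*v + a*v + 2*m*n - 4*n^2 - 8*a - 8*b + 4) * (?E6) + (4*a*b*m*n^3 - a^2*b*m^2*v + a^2*m^2*n^2 +
      a^2*n^4 - b^2*m^2*n^2 - b^2*m^4 + b^2*n^4 + b^3*m^2*v - 4*a*b*m*n*v - 2*a*b^2*m^2 + 4*a*m*n^3 +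
      2*b*m^2*n^2 + 2*b*n^4 - 2*b^2*n^2*v + 2*a*b*m^2 + 3*b^2*m^2 - n^4 + b*m^2 - 3*b*n^2 - n^2) * (?E5) +
      (2*a*b*m^2*n^2 - a*b^2*m^2*v + 2*b^2*m*n^3 + 2*b^2*m^3*n + a*b*n^2*v - 2*a*n^4 - 2*b^2*m*n*v - b^3*m^2 -
      b*m^2 + 2*b*n^2) * (?E4) + (b*m^2 + b*n^2 - b*v) * (?P4)"
    unfolding q by Groebner_Basis.algebra
  hence a1: "?a1 = 0" unfolding E6 E5 E4 P4 by simp
  thus "2*(b-1)*q*(2*v-2*(m^2-n^2)) = 4*(v-m^2-n^2)*(b*P-q)" by simp
  have "1 * (?a3) = (8*a*m^2 + 8*a*n^2 + 4*a^2*v - 2*b*m^2 - 2*b*n^2 + b^2*v - 8*a*v + 2*m^2 + 2*n^2 - v) * (?E6) + (2*a*b*v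
      - 2*a*m^2 - 2*a*n^2 + 3*b*m^2 + 3*b*n^2 - 3*b*v - m^2 - n^2 + v) * (?E5) + (- 3*b*m^2 - 3*b*n^2 + b^2*v
      + b*v + m^2 + n^2) * (?E4) + (- 1*b*m^2 - b*n^2 + b*v - m^2 - n^2 + v) * (?P4) + (1) * (?a1)"
    unfolding q by Groebner_Basis.algebra
  hence a3: "?a3 = 0" unfolding E6 E5 E4 P4 a1 by simp
  thus "2*(b-1)*q*(-2*v-2*(m^2-n^2)) = -4*(v-m^2-n^2)*(b*q+P)" by simp
  have "2 * (?a2) = (16*a*b^2*m*n + 28*a*b^2*m^2 + 14*a*b^2*n^2 + a*b^3*v + 4*a^2*b*m*n + 21*a^2*b*m^2 + 9*a^2*b*n^2 +
      8*a^2*b^2*v + 4*a^3*b*v + 4*a^3*m^2 + 14*b^3*m*n - 4*b^3*m^2 - 3*b^3*n^2 + 2*b^4*v - 20*a*b*m^2 -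
      22*a*b*n^2 - 10*a*b^2*v - 9*a^2*b*v + 12*a^2*m*n - 9*a^2*m^2 - 21*a^2*n^2 - 2*a^3*v - 8*b^2*m*n +
      10*b^2*m^2 + 9*b^2*n^2 - 3*b^3*v - 16*a*m*n + 10*a*m^2 + 18*a*n^2 + 5*a^2*v - 18*b*m*n - 7*b*m^2 -
      8*b*n^2 - b^2*v + 24*a*b - 5*a*v + 8*a^2 + 2*b*v + 16*b^2 + 12*m*n + m^2 + 2*n^2 - 8*a - 12*b + 4) *
      (?E6) + (5*a*b^2*m^2 - a*b^2*n^2 + 4*a*b^3*v - 2*a^2*b*n^2 + 2*a^2*b^2*v + 13*b^3*m^2 + 6*b^3*n^2 +
      4*a*b*m*n - 7*a*b^2*v - 2*a^2*b*v + a^2*m^2 + 3*a^2*n^2 - 12*b^2*m^2 - 7*b^2*n^2 - 6*b^3*v - 4*a*m*n -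
      a*m^2 + 5*a*n^2 - a^2*v + 5*b*m^2 + 12*b*n^2 - a*v - 2*m^2 - 7*n^2 + 2*v) * (?E5) + (- 3*a*b^2*m^2 -
      3*a*b^2*n^2 + a*b^3*v - 7*b^3*m^2 - 6*b^3*n^2 + 2*b^4*v + 2*a*b*m^2 + 4*a*b*n^2 + 2*b^2*m*n + 9*b^2*m^2
      + 8*b^2*n^2 - a*m^2 - 3*a*n^2 - 4*b*m*n - 5*b*m^2 - 6*b*n^2 + a*v + 2*m*n + m^2 + 2*n^2) * (?E4) + (-
      1*a*b^2*m^2 - a*b^2*n^2 - 2*b^3*m^2 - 2*b^3*n^2 + a*b^2*v + 2*b^3*v + a*m^2 + a*n^2 + b*m^2 + b*n^2 -
      a*v - b*v - m^2 - n^2 + v) * (?P4) + (a*b + 2*b^2) * (?a1)"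
    unfolding q by Groebner_Basis.algebra
  hence a2: "?a2 = 0" unfolding E6 E5 E4 P4 a1 by simp
  thus "2*(b-1)*q*(-4*m*n-2*(m^2-n^2)) = (v-m^2-n^2)*(4*b^2-4-2*P*q)" by simp
  have "4 * (2*(b-1)*q*?G - (4*(b-1)*q*P*(v+m^2-n^2) - 4*(v-m^2-n^2)*(b*q*P+q^2-8*b))) = (112*P*a*b - 48*P*b^2 - 24*P*m^2 - 24*P*n^2 + 12*a*b*v - 64*a*b^2 + 32*a*m*n - 72*a*m^2 - 152*a*n^2 -
      32*a^2*b - 24*a^2*v - 48*b*m*n - 60*b*m^2 - 20*b*n^2 + 16*b^2*v + 48*b^3 - 144*P*a + 64*P*b + 24*P*v +
      128*a*b + 100*a*v + 32*a^2 + 8*b*v - 64*b^2 + 48*m*n + 72*m^2 + 32*n^2 - 16*P - 96*a + 32*b - 36*v - 96)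
      * (?E6) + (- 32*P*a*b + 32*P*b^2 + 4*P*m^2 + 4*P*n^2 - 32*a*m*n + 12*a*m^2 + 12*a*n^2 - 8*a^2*v -
      4*b*m^2 - 52*b*n^2 + 16*b^2*v - 32*b^3 + 32*P*a - 64*P*b - 4*P*v - 12*a*v - 4*b*v + 64*b^2 - 4*m^2 +
      44*n^2 + 32*P - 64*b - 4*v + 64) * (?E5) + (16*P*a*b - 16*P*b^2 - 4*P*m^2 - 4*P*n^2 - 12*a*b*v - 4*a*m^2
      + 12*a*n^2 - 16*b*m*n + 16*b*m^2 + 56*b*n^2 - 16*b^2*v + 16*b^3 - 16*P*a + 32*P*b + 4*P*v + 8*a*v -
      4*b*v - 32*b^2 + 16*m*n - 4*m^2 - 44*n^2 - 16*P + 32*b + 8*v - 32) * (?E4) + (4*P*m^2 + 4*P*n^2 +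
      4*a*m^2 + 4*a*n^2 + 12*b*m^2 + 12*b*n^2 - 4*P*v - 4*a*v - 12*b*v + 4*m^2 + 4*n^2 - 4*v) * (?P4) + (-
      4*P*a^2 + 4*P*b^2 + a*b*v - 4*a*b^2 - 4*a*m*n + 3*a*m^2 + 3*a*n^2 + 2*a^2*v - 5*b*m^2 - 5*b*n^2 + b^2*v
      - 4*b^3 - 4*P*b - 4*a*v + 3*b*v + 4*b^2 - 7*m^2 - 7*n^2 - 4*P + 8*v - 8) * (?a1) + (8*P*a*b - 8*P*b^2 -
      2*a*b*v - 8*a*n^2 - 16*b*m*n - 6*b*m^2 + 2*b*n^2 + 8*b^3 + 8*P*a - 2*a*v + 8*n^2 + 8*P - 2*v) * (?a2) +
      (4*P*a^2 + 4*a*m*n) * (?a3)"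
    unfolding q half_quartic_def by Groebner_Basis.algebra
  hence c1: "2*(b-1)*q*?G - (4*(b-1)*q*P*(v+m^2-n^2) - 4*(v-m^2-n^2)*(b*q*P+q^2-8*b)) = 0" unfolding E6 E5 E4 P4 a1 a2 a3 by simp
  thus "2*(b-1)*q*?G = 4*(b-1)*q*P*(v+m^2-n^2) - 4*(v-m^2-n^2)*(b*q*P+q^2-8*b)" by simp
qed

text \<open>Replaces \<open>half_relations\<close> where the factor \<open>b - 1\<close> there
  vanishes.\<close>

lemma half_relations_one:
  assumes H: "half_datum a 1 m n v" and P: "P = kum a 1 (half_slope a 1 m n)"
  shows "(2*a+a^2)*half_quartic a 1 m n v = 4*((2*m*n+a*n^2)*(P^2-a^2+8))"
    and "(2*a+a^2)*(2*v-2*(m^2-n^2)) = (2*m*n+a*n^2)*(4*(P+a))"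
    and "(2*a+a^2)*(-4*m*n-2*(m^2-n^2)) = (2*m*n+a*n^2)*(2*P*a)"
    and "(2*a+a^2)*(-2*v-2*(m^2-n^2)) = (2*m*n+a*n^2)*(-4*(P-a))"
proof -
  have v: "v = m^2+n^2" using half_datumD(1)[OF H] by simp
  have "2*(a*(m^2-n^2)) = 2*(-2)" using half_datumD(2)[OF H] by (simp add: algebra_simps power2_eq_square)
  hence E5: "a*(m^2-n^2) = -2" by simp
  have E4: "8 - (m+a*n)^2 - 2*n*(a*m+n) - (a*m+n)^2 - 2*m*(m+a*n) + (m^2+n^2)*(3-a^2) = 0"
    using half_datumD(3)[OF H] unfolding v by simp
  have P: "P = (a*(a*m+n))^2 + a^3-2*a^2-a"
    unfolding P kum_def half_slope_def by (simp add: field_simps power2_eq_square)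
  show "(2*a+a^2)*half_quartic a 1 m n v = 4*((2*m*n+a*n^2)*(P^2-a^2+8))"
    "(2*a+a^2)*(2*v-2*(m^2-n^2)) = (2*m*n+a*n^2)*(4*(P+a))"
    "(2*a+a^2)*(-4*m*n-2*(m^2-n^2)) = (2*m*n+a*n^2)*(2*P*a)"
    "(2*a+a^2)*(-2*v-2*(m^2-n^2)) = (2*m*n+a*n^2)*(-4*(P-a))"
    using E5 E4 unfolding P half_quartic_def v power_one by Groebner_Basis.algebra+
qed

text \<open>Replaces \<open>half_relations\<close> where the factor \<open>q\<close> there
  vanishes.\<close>

lemma half_relations_zero:
  assumes H: "half_datum a b m n v" and P: "P = kum a b (half_slope a b m n)"
    and a: "a = 1-b" and b: "b \<noteq> 1" and v': "v = m^2+n^2" and Y: "Y = b*m*(2*n+(1-b)*m)"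
  shows "2*b*(1-b^2)*half_quartic a b m n v = 4*(Y*(P^2+8*b))"
    and "2*b*(1-b^2)*(2*v-2*(m^2-n^2)) = Y*(4*(b*P))"
    and "2*b*(1-b^2)*(-4*m*n-2*(m^2-n^2)) = Y*(4*b^2-4)"
    and "2*b*(1-b^2)*(-2*v-2*(m^2-n^2)) = Y*(-4*P)"
proof -
  have "(b-1)*(n^2-b*m^2) = 0" using half_datumD(1)[OF H] unfolding v' by (simp add: algebra_simps power2_eq_square)
  hence n: "n^2 = b*m^2" using b by simp
  have v: "v = (1+b)*m^2" unfolding v' n by (simp add: algebra_simps)
  have "(1-b^2)*(m*(2*n+(1-b)*m)) = 4"
    using half_datumD(2)[OF H] n unfolding a v by Groebner_Basis.algebra
  note E5 = this
  have P': "4*P = ((1-b^2)*(m*(2-b)+n))^2 - 4*(1-b^2)*(2-b)"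
    unfolding P kum_def half_slope_def a by (simp add: field_simps power2_eq_square power3_eq_cube)
  have "4*P - 2*(1-b^2)^2*m^2 = (1-b^2)*((1-b^2)*(n^2-b*m^2) + (2-b)*((1-b^2)*(m*(2*n+(1-b)*m)) - 4))"
    using P' by Groebner_Basis.algebra
  hence "4*P - 2*(1-b^2)^2*m^2 = 0" unfolding n E5 by simp
  hence P'': "2*P = (1-b^2)^2*m^2" by simp
  have "(1-b^2)*Y = b*((1-b^2)*(m*(2*n+(1-b)*m)))" unfolding Y by Groebner_Basis.algebra
  hence Y': "(1-b^2)*Y = 4*b" unfolding E5 by simp
  have YP: "2*(Y*P) = 4*b*((1-b^2)*m^2)" using P'' Y' by Groebner_Basis.algebra
  have "4*a*m^2 = (1-b)*m^2*((1-b^2)*(m*(2*n+(1-b)*m)))" unfolding E5 a by simp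
  hence G': "half_quartic a b m n v = 2*(b^2+1)*(b+1)^2*m^4 + 16*b*(1-b)*m^3*n"
    using n unfolding half_quartic_def v unfolding a by Groebner_Basis.algebra
  have "8*Y = 2*Y*((1-b^2)*(m*(2*n+(1-b)*m)))" unfolding E5 by simp
  hence Y2: "8*Y = 2*(1-b^2)*b*m^2*(2*n+(1-b)*m)^2" unfolding Y by Groebner_Basis.algebra
  have "4*(Y*(P^2+8*b)) = (2*(Y*P))*(2*P) + 4*b*(8*Y)" by Groebner_Basis.algebra
  also have "\<dots> = 2*b*(1-b^2)*half_quartic a b m n v" unfolding YP P'' Y2 G' using n by Groebner_Basis.algebra
  finally show "2*b*(1-b^2)*half_quartic a b m n v = 4*(Y*(P^2+8*b))" ..
  show "2*b*(1-b^2)*(2*v-2*(m^2-n^2)) = Y*(4*(b*P))" using YP unfolding v n by Groebner_Basis.algebra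
  show "2*b*(1-b^2)*(-4*m*n-2*(m^2-n^2)) = Y*(4*b^2-4)"
  proof -
    have "2*b*(1-b^2)*(-4*m*n-2*(m^2-b*m^2)) = -4*b*((1-b^2)*(m*(2*n+(1-b)*m)))" by Groebner_Basis.algebra
    also have "\<dots> = -4*((1-b^2)*Y)" unfolding E5 Y' by simp
    also have "\<dots> = Y*(4*b^2-4)" by Groebner_Basis.algebra
    finally show ?thesis unfolding n .
  qed
  show "2*b*(1-b^2)*(-2*v-2*(m^2-n^2)) = Y*(-4*P)" using YP unfolding v n by Groebner_Basis.algebra
qed

lemma half_first_coordinate:
  fixes a b m n v A B K PP :: rat
  assumes H: "half_datum a b m n v"
    and K: "K = v + 2*m*n" and A: "K*A = 2*(m^2-n^2)" and B: "K*B = v-2*m*n" and K0: "K \<noteq> 0"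
    and c: "2*c3 = n+b*m" "2*c2 = m+a*n-a*m-b*n" "2*c1 = m+a*n+a*m+b*n" "2*c0 = b*m-n"
    and PP: "PP = 1-B+A*B + K/4*b - 2*c0*c2 + 2*A*c0*c3 + B*(2-A+K/4*(1+b^2-a^2+B*b)-2*c1*c3)"
  shows "4*(K*PP) = half_quartic a b m n v" (is "_ = ?G")
proof -
  note E6 = half_datumD(1)[OF H] and E5 = half_datumD(2)[OF H] and E4 = half_datumD(3)[OF H]
  define kB where "kB = v-2*m*n"
  define kA where "kA = 2*(m^2-n^2)"
  have 1: "K*K*PP = K*K - K*kB + kA*kB + K*K*K*b/4 - K*K*2*c0*c2 + 2*K*kA*c0*c3 + 2*K*kB - kA*kB + K*K*kB*(1+b^2-a^2)/4 + kB*kB*K*b/4 - 2*K*kB*c1*c3"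
    using A B unfolding PP kA_def kB_def by Groebner_Basis.algebra
  have c': "c3 = (n+b*m)/2" "c2 = (m+a*n-a*m-b*n)/2" "c1 = (m+a*n+a*m+b*n)/2" "c0 = (b*m-n)/2"
    using c by auto
  have 2: "4*(K*K*PP) = 4*K*K - 4*K*kB + 4*kA*kB + K*K*K*b - K*K*2*(b*m-n)*(m+a*n-a*m-b*n) + 2*K*kA*(b*m-n)*(n+b*m)+ 8*K*kB - 4*kA*kB + K*K*kB*(1+b^2-a^2) + kB*kB*K*b - 2*K*kB*(m+a*n+a*m+b*n)*(n+b*m)"
    unfolding 1 c' by (simp add: field_simps)
  have "4*(K*K*PP) = K * ?G"
    unfolding 2 using E4 E5 E6 unfolding half_quartic_def kA_def kB_def K by Groebner_Basis.algebra
  hence "K*(4*(K*PP)) = K*?G" by (simp add: algebra_simps)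
  thus ?thesis using K0 by simp
qed

lemma half_eliminate:
  fixes X Z P s Y b q :: rat
  assumes s: "X*s = 2*Y*(b*q+P)" and Z: "X*(4*Z) = 2*X*P*s - 4*Y*(b*q*P+q^2-8*b)"
  shows "X*Z = Y*(P^2-q^2+8*b)"
proof -
  have "2*X*P*s = 2*P*(X*s)" by simp
  also have "\<dots> = 4*Y*P*(b*q+P)" unfolding s by simp
  finally show ?thesis using Z by (simp add: algebra_simps power2_eq_square)
qed

text \<open>Doubling on the Kummer surface; \<open>A\<close>, \<open>B\<close> belong to the double, \<open>a\<close>, \<open>b\<close> to its half.\<close>

lemma half_coordinates:
  fixes a b m n v A B K PP P q :: rat
  assumes H: "half_datum a b m n v"
    and K: "K = v + 2*m*n" and A: "K*A = 2*(m^2-n^2)" and B: "K*B = v-2*m*n" and K0: "K \<noteq> 0"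
    and c: "2*c3 = n+b*m" "2*c2 = m+a*n-a*m-b*n" "2*c1 = m+a*n+a*m+b*n" "2*c0 = b*m-n"
    and PP: "PP = 1-B+A*B + K/4*b - 2*c0*c2 + 2*A*c0*c3 + B*(2-A+K/4*(1+b^2-a^2+B*b)-2*c1*c3)"
    and P: "P = kum a b (half_slope a b m n)" and q: "q = 1 - a - b"
    and AB: "\<not> (A = 2 \<and> B = 1)"
  shows "\<exists>l. l \<noteq> 0 \<and> PP = l*(P^2-q^2+8*b) \<and> B+1-A = l*(4*(b*P-q)) \<and>
     B-1-A = l*(4*b^2-4-2*P*q) \<and> -B-1-A = l*(-4*(b*q+P))"
proof -
  note E6 = half_datumD(1)[OF H] and E5 = half_datumD(2)[OF H] and E4 = half_datumD(3)[OF H]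
  note G = half_first_coordinate[OF H K A B K0 c PP]
  note R = half_relations[OF H P q]
  have Z1: "K*(B+1-A) = 2*v-2*(m^2-n^2)" using A B K by (simp add: algebra_simps)
  have Z2: "K*(B-1-A) = -4*m*n-2*(m^2-n^2)" using A B K by (simp add: algebra_simps)
  have Z3: "K*(-B-1-A) = -2*v-2*(m^2-n^2)" using A B K by (simp add: algebra_simps)
  \<comment> \<open>The factor \<open>l\<close> cannot vanish because \<open>B+1-A\<close> and
    \<open>B-1-A\<close> differ by 2.\<close>
  have fin: ?thesis if X: "X \<noteq> 0" and 1: "X*(K*PP) = Y*(P^2-q^2+8*b)" and 2: "X*(K*(B+1-A)) = Y*(4*(b*P-q))"
    and 3: "X*(K*(B-1-A)) = Y*(4*b^2-4-2*P*q)" and 4: "X*(K*(-B-1-A)) = Y*(-4*(b*q+P))" for X Y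
  proof -
    define l where "l = Y/(X*K)"
    have Y: "Y = l*(X*K)" using X K0 by (simp add: l_def)
    have XK: "X*K \<noteq> 0" using X K0 by simp
    have e: "z = l*w" if "X*(K*z) = Y*w" for z w
    proof -
      have "X*K*z = X*K*(l*w)" using that unfolding Y by (simp only: ac_simps)
      thus ?thesis using XK by simp
    qed
    note e = e[OF 1] e[OF 2] e[OF 3] e[OF 4]
    have "l \<noteq> 0"
    proof
      assume "l = 0"
      hence "B+1-A = 0" "B-1-A = 0" using e by auto
      thus False by simp
    qed
    thus ?thesis using e by blast
  qed
  show ?thesis
  proof (cases "2*(b-1)*q = 0")
    case False
    have "2*(b-1)*q*(K*PP) = (v-m^2-n^2)*(P^2-q^2+8*b)"
    proof (rule half_eliminate[where s = "v+m^2-n^2"])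
      show "2*(b-1)*q*(v+m^2-n^2) = 2*(v-m^2-n^2)*(b*q+P)" using R(2) by (simp add: algebra_simps)
      show "2*(b-1)*q*(4*(K*PP)) = 2*(2*(b-1)*q)*P*(v+m^2-n^2) - 4*(v-m^2-n^2)*(b*q*P+q^2-8*b)" using R(4) unfolding G[symmetric] by (simp add: algebra_simps)
    qed
    thus ?thesis
    proof (rule fin[OF False])
      show "2*(b-1)*q*(K*(B+1-A)) = (v-m^2-n^2)*(4*(b*P-q))" using R(1) unfolding Z1 by Groebner_Basis.algebra
      show "2*(b-1)*q*(K*(B-1-A)) = (v-m^2-n^2)*(4*b^2-4-2*P*q)" unfolding Z2 by (rule R(3))
      show "2*(b-1)*q*(K*(-B-1-A)) = (v-m^2-n^2)*(-4*(b*q+P))" using R(2) unfolding Z3 by Groebner_Basis.algebra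
    qed
  next
    case t: True
    show ?thesis
    proof (cases "b = 1")
      case b: True
      note H1 = H[unfolded b] and P1 = P[unfolded b]
      note R1 = half_relations_one[OF H1 P1]
      have G1: "4*(K*PP) = half_quartic a 1 m n v" using G unfolding b .
      have q1: "q = -a" using q b by simp
      have v: "v = m^2 + n^2" using half_datumD(1)[OF H1] by simp
      have nm: "2*(a*(m^2-n^2)) = -4" using half_datumD(2)[OF H1] by (simp add: algebra_simps power2_eq_square)
      \<comment> \<open>Otherwise the cofactor \<open>2*a + a^2\<close> would be zero. The double
        would then be \<open>(x + 1)^2\<close>, which \<open>AB\<close> excludes;
        \<open>b = 0\<close> is ruled out in the same way below.\<close>
      have "a \<noteq> -2"
      proof
        assume a: "a = -2"
        have "m^2 - n^2 = 1" using nm a by simp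
        moreover have "8*v = 8*(1 + 2*m*n)"
          using half_datumD(3)[OF H1] calculation v unfolding a by (simp add: algebra_simps power2_eq_square)
        ultimately have v': "v = 1 + 2*m*n" and nm: "m^2 - n^2 = 1" by simp_all
        hence "(m-n)^2 = 1" using v power2_diff[of m n] by simp
        moreover have "(m-n)*(m+n) = 1" using nm by (simp add: algebra_simps power2_eq_square)
        ultimately have n: "n = 0" by (auto simp: power2_eq_1_iff)
        hence "m^2 = 1" "v = 1" "K = 1" using nm v' K by auto
        hence "A = 2" "B = 1" using A B n by auto
        thus False using AB by simp
      qed
      moreover have "a \<noteq> 0" using nm by auto
      ultimately have X: "2*a+a^2 \<noteq> 0" by (simp add: power2_eq_square flip: distrib_right)
      show ?thesis unfolding b q1
      proof (rule fin[OF X, unfolded b q1])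
        show "(2*a+a^2)*(K*PP) = (2*m*n+a*n^2)*(P^2-(-a)^2+8*1)" using R1(1) unfolding G1[symmetric] by simp
        show "(2*a+a^2)*(K*(B+1-A)) = (2*m*n+a*n^2)*(4*(1*P- -a))" using R1(2) unfolding Z1 by simp
        show "(2*a+a^2)*(K*(B-1-A)) = (2*m*n+a*n^2)*(4*1^2-4-2*P*(-a))" using R1(3) unfolding Z2 by simp
        show "(2*a+a^2)*(K*(-B-1-A)) = (2*m*n+a*n^2)*(-4*(1*(-a)+P))" using R1(4) unfolding Z3 by simp
      qed
    next
      case b: False
      hence q0: "q = 0" using t by simp
      hence a: "a = 1 - b" using q by simp
      have b0: "b \<noteq> 0"
      proof
        assume "b = 0"
        hence ab: "a = 1" "b = 0" using a by simp_all
        note H0 = H[unfolded ab]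
        have "n = 0" using half_datumD(1)[OF H0] by simp
        moreover have "m^2 = 4" using half_datumD(3)[OF H0] \<open>n = 0\<close> by simp
        moreover have "v = 4" using half_datumD(2)[OF H0] \<open>n = 0\<close> by simp
        ultimately have "A = 2" "B = 1" using A B K by auto
        thus False using AB by simp
      qed
      have v: "v = m^2+n^2" using R(4) b0 unfolding q0 by simp
      have "b \<noteq> -1"
      proof
        assume "b = -1"
        hence ab: "a = 2" "b = -1" using a by simp_all
        note H0 = H[unfolded ab]
        show False using half_datumD(1,2)[OF H0] by (simp add: algebra_simps power2_eq_square)
      qed
      hence X: "2*b*(1-b^2) \<noteq> 0" using b b0 by (simp add: power2_eq_1_iff)
      note R0 = half_relations_zero[OF H P a b v HOL.refl]
      show ?thesis
      proof (rule fin[OF X])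
        let ?Y = "b*m*(2*n+(1-b)*m)"
        have cancel: "x*z = w" if "x*(4*z) = 4*w" for x z w :: rat
          using that by simp
        show "2*b*(1-b^2)*(K*PP) = ?Y*(P^2-q^2+8*b)"
          unfolding q0 power_zero_numeral diff_0_right by (rule cancel[OF R0(1)[folded G]])
        show "2*b*(1-b^2)*(K*(B+1-A)) = ?Y*(4*(b*P-q))" using R0(2) unfolding Z1 q0 diff_0_right .
        show "2*b*(1-b^2)*(K*(B-1-A)) = ?Y*(4*b^2-4-2*P*q)" using R0(3) unfolding Z2 q0 mult_zero_right diff_0_right .
        show "2*b*(1-b^2)*(K*(-B-1-A)) = ?Y*(-4*(b*q+P))" using R0(4) unfolding Z3 q0 mult_zero_right add_0_left .
      qed
    qed
  qed
qed

text \<open>The vector \<open>(p0,p1,p2,p3)\<close> stands for \<open>p0 + p1 \<zeta> + p2 \<zeta>\<^sup>2 + p3 \<zeta>\<^sup>3\<close> with a primitive eighth root of unity \<open>\<zeta>\<close>, so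
  \<open>i = \<zeta>\<^sup>2\<close> and \<open>\<surd>2 = \<zeta> - \<zeta>\<^sup>3\<close>. In \<open>Phi\<close>, \<open>(s0,s1,s2,s3)\<close> is the square of the complex conjugate. The relation
  \<open>wsim\<close> is equality up to rational factors and translation by rational points of order two.\<close>

type_synonym vec = "rat \<times> rat \<times> rat \<times> rat"

fun scale :: "rat \<Rightarrow> vec \<Rightarrow> vec" where
  "scale c (p0,p1,p2,p3) = (c*p0, c*p1, c*p2, c*p3)"

fun mul_i :: "vec \<Rightarrow> vec" where
  "mul_i (p0,p1,p2,p3) = (-p2, -p3, p0, p1)"

fun mul_sqrt2 :: "vec \<Rightarrow> vec" where
  "mul_sqrt2 (p0,p1,p2,p3) = (p1-p3, p0+p2, p1+p3, p2-p0)"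

fun Phi :: "vec \<Rightarrow> vec" where
  "Phi (p0,p1,p2,p3) =
    (let s0 = p0^2-p2^2-2*p1*p3; s1 = -2*(p0*p3+p1*p2); s2 = p3^2-p1^2-2*p0*p2; s3 = 2*(p2*p3-p0*p1)
     in (s0, s1-s2, s1+s3-s2, s3-s2))"

inductive wsim :: "vec \<Rightarrow> vec \<Rightarrow> bool" where
  refl: "wsim p p"
| scale: "wsim p q \<Longrightarrow> c \<noteq> 0 \<Longrightarrow> wsim p (scale c q)"
| mul_i: "wsim p q \<Longrightarrow> wsim p (mul_i q)"
| mul_sqrt2: "wsim p q \<Longrightarrow> wsim p (mul_sqrt2 q)"

lemma wsim_trans: "wsim q r \<Longrightarrow> wsim p q \<Longrightarrow> wsim p r"
  by (induction rule: wsim.induct) (auto intro: wsim.intros)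

lemma vec_simps:
  "scale c (scale d p) = scale (c*d) p" "mul_i (scale c p) = scale c (mul_i p)"
  "mul_sqrt2 (scale c p) = scale c (mul_sqrt2 p)" "mul_i (mul_i p) = scale (-1) p"
  "mul_sqrt2 (mul_sqrt2 p) = scale 2 p" "mul_sqrt2 (mul_i p) = mul_i (mul_sqrt2 p)" "scale 1 p = p"
  by (cases p; simp add: algebra_simps)+

lemma wsim_sym: "wsim p q \<Longrightarrow> wsim q p"
proof (induction rule: wsim.induct)
  case (refl p) show ?case by (rule wsim.refl)
next
  case (scale p q c)
  have "wsim (scale c q) (scale (1/c) (scale c q))" using scale.hyps by (intro wsim.scale wsim.refl) auto
  also have "scale (1/c) (scale c q) = q" using scale.hyps by (simp add: vec_simps)
  finally show ?case by (rule wsim_trans[OF scale.IH])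
next
  case (mul_i p q)
  have "wsim (mul_i q) (mul_i (mul_i (mul_i (mul_i q))))" by (intro wsim.mul_i wsim.refl)
  also have "mul_i (mul_i (mul_i (mul_i q))) = q" by (simp add: vec_simps)
  finally show ?case by (rule wsim_trans[OF mul_i.IH])
next
  case (mul_sqrt2 p q)
  have "wsim (mul_sqrt2 q) (scale (1/2) (mul_sqrt2 (mul_sqrt2 q)))" by (intro wsim.intros) simp
  also have "scale (1/2) (mul_sqrt2 (mul_sqrt2 q)) = q" by (simp add: vec_simps)
  finally show ?case by (rule wsim_trans[OF mul_sqrt2.IH])
qed

text \<open>Modulo rational scalars, \<open>i\<close> and \<open>\<surd>2\<close> generate a group
  of order four; this is the normal form of \<open>wsim\<close>.\<close>

definition W_multiple :: "rat \<Rightarrow> vec \<Rightarrow> vec \<Rightarrow> bool" where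
  "W_multiple c p q \<longleftrightarrow> c \<noteq> 0 \<and> (p = scale c q \<or> p = scale c (mul_i q) \<or> p = scale c (mul_sqrt2 q) \<or> p = scale c (mul_i (mul_sqrt2 q)))"

lemma wsim_W_multiple:
  assumes "wsim p q"
  obtains c where "W_multiple c p q"
proof -
  from wsim_sym[OF assms] have "\<exists>c. W_multiple c p q"
  proof (induction rule: wsim.induct)
    case (refl p)
    have "W_multiple 1 p p" by (simp add: W_multiple_def vec_simps)
    thus ?case ..
  next
    case (scale p q c)
    then obtain d where "W_multiple d q p" by blast
    hence "W_multiple (c*d) (scale c q) p" using scale.hyps unfolding W_multiple_def by (auto simp: vec_simps)
    thus ?case ..
  next
    case (mul_i p q)
    then obtain d where "W_multiple d q p" by blast
    hence "W_multiple d (mul_i q) p \<or> W_multiple (-d) (mul_i q) p" unfolding W_multiple_def by (auto simp: vec_simps)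
    thus ?case by blast
  next
    case (mul_sqrt2 p q)
    then obtain d where "W_multiple d q p" by blast
    hence "W_multiple d (mul_sqrt2 q) p \<or> W_multiple (2*d) (mul_sqrt2 q) p" unfolding W_multiple_def by (auto simp: vec_simps mult.commute)
    thus ?case by blast
  qed
  thus ?thesis using that by (elim exE)
qed

lemma W_multiple_wsim: "W_multiple c p q \<Longrightarrow> wsim p q"
  unfolding W_multiple_def by (elim conjE disjE) (simp, rule wsim_sym, intro wsim.intros, assumption)+

text \<open>Squaring the conjugate turns the factors \<open>i\<close> and \<open>\<surd>2\<close>
  into the rational factors -1 and 2: doubling forgets translations by two-torsion.\<close>

lemma Phi_wsim: "wsim p q \<Longrightarrow> wsim (Phi p) (Phi q)"
proof (induction rule: wsim.induct)
  case (refl p) show ?case by (rule wsim.refl)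
next
  case (scale p q c)
  have "Phi (scale c q) = scale (c^2) (Phi q)" by (cases q) (simp add: Let_def algebra_simps power2_eq_square)
  thus ?case using scale by (auto intro: wsim.intros)
next
  case (mul_i p q)
  have "Phi (mul_i q) = scale (-1) (Phi q)" by (cases q) (simp add: Let_def algebra_simps power2_eq_square)
  thus ?case using mul_i by (auto intro: wsim.intros)
next
  case (mul_sqrt2 p q)
  have "Phi (mul_sqrt2 q) = scale 2 (Phi q)" by (cases q) (simp add: Let_def algebra_simps power2_eq_square)
  thus ?case using mul_sqrt2 by (auto intro: wsim.intros)
qed

text \<open>A linear change of the classical Kummer coordinates, of which \<open>kum a b v\<close>
  is the fourth shifted by \<open>1 + b\<close>. It is chosen so that \<open>translate1\<close> and
  \<open>translate2\<close> become multiplication by \<open>i\<close> and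
  \<open>\<surd>2\<close>.\<close>

definition xi :: "rat \<Rightarrow> rat \<Rightarrow> rat \<Rightarrow> vec" where
  "xi a b v = (kum a b v, 2, 1-a-b, -2*b)"

section \<open>Every rational class is a double up to translation\<close>

definition halvable :: "vec \<Rightarrow> bool" where
  "halvable p \<longleftrightarrow> (\<exists>a b v1 v0. mumford a b v1 v0 \<and> wsim p (Phi (xi a b v1)))"

lemma halvable_wsim: "wsim p q \<Longrightarrow> halvable q \<Longrightarrow> halvable p"
  unfolding halvable_def using wsim_trans by blast

text \<open>The first vector stands for the two-torsion and is the double of the class of
  \<open>x^2 + 1\<close>. The other two are doubles of each other.\<close>

lemma halvable_torsion: "halvable (1,0,0,0)" "halvable (1,1,0,0)" "halvable (0,1,1,0)"
proof -
  have "mumford 0 1 0 0" "mumford 1 0 2 0" "mumford (-1) 0 2 0" by (simp_all add: mumford_def)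
  moreover have "W_multiple (1/8) (1,0,0,0) (Phi (xi 0 1 0))" by (simp add: xi_def kum_def W_multiple_def)
  moreover have "W_multiple (1/8) (1,1,0,0) (Phi (xi (-1) 0 2)) \<or> W_multiple (-1/8) (1,1,0,0) (Phi (xi (-1) 0 2))"
    by (simp add: xi_def kum_def W_multiple_def)
  moreover have "W_multiple (1/8) (0,1,1,0) (Phi (xi 1 0 2)) \<or> W_multiple (-1/8) (0,1,1,0) (Phi (xi 1 0 2))"
    by (simp add: xi_def kum_def W_multiple_def)
  ultimately show "halvable (1,0,0,0)" "halvable (1,1,0,0)" "halvable (0,1,1,0)"
    unfolding halvable_def using W_multiple_wsim by blast+
qed

lemma mumford_root:
  assumes D: "mumford a b v1 v0" and x: "x^2 + a*x + b = 0"
  shows "(v1*x+v0)^2 = x^5 + 2*x^4 + 2*x^2 - x"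
proof -
  define w where "w = 2 - v1^2 - a*(a^2-2*a-b) - b*(2-a)"
  have D1: "b*(a^2-2*a-b) + a*w + 1 + 2*v1*v0 = 0" and D2: "v0^2 + b*w = 0"
    using D unfolding mumford_def w_def by auto
  have "x^5 + 2*x^4 + 2*x^2 - x - (v1*x+v0)^2 = (x^2+a*x+b)*(x^3+(2-a)*x^2+(a^2-2*a-b)*x+w)
    - (b*(a^2-2*a-b) + a*w + 1 + 2*v1*v0)*x - (v0^2 + b*w)" unfolding w_def by Groebner_Basis.algebra
  thus ?thesis unfolding D1 D2 x by simp
qed

text \<open>Both roots are abscissas of rational points, so \<open>rational_points\<close> leaves
  six quadratics, and \<open>x^2\<close> fails because 0 is a simple root of
  \<open>f\<close>.\<close>

lemma halvable_reducible:
  assumes D: "mumford a b v1 v0" and x: "x^2 + a*x + b = 0"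
  shows "halvable (xi a b v1)"
proof -
  define y where "y = -a - x"
  have a: "a = -(x+y)" by (simp add: y_def)
  have b: "b = x*y" using x unfolding y_def by (simp add: algebra_simps power2_eq_square)
  have y: "y^2 + a*y + b = 0" unfolding a b by (simp add: algebra_simps power2_eq_square)
  note vx = mumford_root[OF D x] and vy = mumford_root[OF D y]
  have "x = 0 \<or> x = 1 \<or> x = -1" "y = 0 \<or> y = 1 \<or> y = -1"
    using rational_points[OF vx] rational_points[OF vy] by auto
  hence "(a = 0 \<and> b = 0) \<or> (a = -1 \<and> b = 0) \<or> (a = 1 \<and> b = 0) \<or> (a = 0 \<and> b = -1) \<or> (a = -2 \<and> b = 1) \<or> (a = 2 \<and> b = 1)"
    unfolding a b by auto
  then consider "a = 0" "b = 0" | "a = -1" "b = 0" | "a = 1" "b = 0" | "a = 0" "b = -1" | "a = -2" "b = 1" | "a = 2" "b = 1" by blast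
  hence "\<exists>c. W_multiple c (xi a b v1) (1,1,0,0) \<or> W_multiple c (xi a b v1) (0,1,1,0)"
  proof cases
    case 1
    thus ?thesis using D by (auto simp: mumford_def)
  next
    case 2
    have "v0 = 0" using D 2 by (simp add: mumford_def)
    hence "v1^2 = 4" using D 2 by (simp add: mumford_def power2_eq_square)
    hence "W_multiple 2 (xi a b v1) (0,1,1,0)" using 2 by (simp add: W_multiple_def xi_def kum_def)
    thus ?thesis by blast
  next
    case 3
    have "v0 = 0" using D 3 by (simp add: mumford_def)
    hence "v1^2 = 4" using D 3 by (simp add: mumford_def power2_eq_square)
    hence "W_multiple 2 (xi a b v1) (1,1,0,0)" using 3 by (simp add: W_multiple_def xi_def kum_def)
    thus ?thesis by blast
  next
    case 4
    hence v: "v1 = 0 \<or> v0 = 0" "v0^2 + v1^2 = 4" using D by (simp_all add: mumford_def)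
    hence "v1 = 0 \<or> v1^2 = 4" by auto
    hence "W_multiple 2 (xi a b v1) (1,1,0,0) \<or> W_multiple 2 (xi a b v1) (0,1,1,0)"
      using 4 by (auto simp: W_multiple_def xi_def kum_def)
    thus ?thesis by blast
  next
    case 5
    have "v0^2 = v1^2 - 12" "v1*v0 = 8 - v1^2" using D 5 by (simp_all add: mumford_def)
    hence "4*v1^2 = 64" by Groebner_Basis.algebra
    hence "W_multiple 2 (xi a b v1) (1,1,0,0)" using 5 by (simp add: W_multiple_def xi_def kum_def)
    thus ?thesis by blast
  next
    case 6
    have "v0^2 = v1^2 - 4" "v1*v0 = v1^2 - 4" using D 6 by (simp_all add: mumford_def)
    hence "4*v1^2 = 16" by Groebner_Basis.algebra
    hence "W_multiple (-2) (xi a b v1) (0,1,1,0)" using 6 by (simp add: W_multiple_def xi_def kum_def)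
    thus ?thesis by blast
  qed
  thus ?thesis using W_multiple_wsim halvable_wsim halvable_torsion(2,3) by blast
qed

text \<open>If the norms of \<open>x\<close> and \<open>x^2 + 1\<close> are squares, so is the third
  one, by \<open>mumford_norm\<close>, and the cubic for halving exists. It vanishes only for
  \<open>x^2 + 2x - 1\<close>, as 2 is not a square; that class has order two.\<close>

lemma halvable_trivial_class:
  assumes D: "mumford a b v1 v0" and irr: "\<And>x. x^2 + a*x + b \<noteq> 0"
    and b: "b = s^2" and s0: "s \<noteq> 0" and t: "(1-b)^2 + a^2 = t^2" and t0: "t \<noteq> 0"
  shows "halvable (xi a b v1)"
proof (cases "a = 2 \<and> b = -1")
  case True
  have "v0^2 + v1^2 = 0" using D True by (simp add: mumford_def)
  hence "v1 = 0" by (simp add: sum_power2_eq_zero_iff)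
  hence "W_multiple 2 (xi a b v1) (1,0,0,0)" using True by (simp add: W_multiple_def xi_def kum_def)
  thus ?thesis using W_multiple_wsim halvable_wsim halvable_torsion(1) by blast
next
  case False
  define r where "r = (v1^2*b - v1*v0*a + v0^2)/(s*t)"
  have st: "s*t \<noteq> 0" using s0 t0 by simp
  have "(s*t)^2*(2*(b+1)^2 - (a+b-1)^2) = (v1^2*b - v1*v0*a + v0^2)^2"
    using mumford_norm[OF D] unfolding t unfolding b by (simp add: power_mult_distrib ac_simps)
  hence r: "r^2 = 2*(b+1)^2 - (a+b-1)^2" unfolding r_def power_divide using st by (simp add: field_simps)
  have r0: "r \<noteq> 0"
  proof
    assume "r = 0"
    hence e: "2*(b+1)^2 = (a+b-1)^2" using r by simp
    have "b + 1 = 0"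
    proof (rule ccontr)
      assume b1: "b + 1 \<noteq> 0"
      hence "((a+b-1)/(b+1))^2 = of_int 2" unfolding power_divide e[symmetric] by simp
      then obtain m where "(a+b-1)/(b+1) = of_int m" by (rule rat_square_int)
      hence "of_int (m^2) = (of_int 2 :: rat)" using \<open>((a+b-1)/(b+1))^2 = of_int 2\<close> by simp
      hence "m^2 = 2" by (simp only: of_int_eq_iff)
      hence "2*1^2 = m^2" by simp
      hence "(1::int) = 0" by (rule two_squares_int)
      thus False by simp
    qed
    hence "b = -1" "a = 2" using e by auto
    thus False using False by simp
  qed
  obtain c3 c2 c1 c0 q4 q3 q2 where c: "c3^2 = q4" "2*c3*c2 - 1 = q3 + a*q4" "c2^2 + 2*c3*c1 - 2 = q2 + a*q3 + b*q4"
     "2*c3*c0 + 2*c2*c1 = - q3 + a*q2 + b*q3" "c1^2 + 2*c2*c0 - 2 = q4 - a*q3 + b*q2"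
     "2*c1*c0 + 1 = a*q4 - b*q3" "c0^2 = b*q4" "v1 = a*(c2-a*c3) + b*c3 - c1"
    using exists_cubic[OF D b s0 r r0 irr] by blast
  obtain a' b' m n v K where K: "K \<noteq> 0"
      and H: "half_datum a' b' m n v"
      and Kv: "K = v + 2*m*n" "K*a = 2*(m^2-n^2)" "K*b = v - 2*m*n"
      and cc: "2*c3 = n+b'*m" "2*c2 = m+a'*n-a'*m-b'*n" "2*c1 = m+a'*n+a'*m+b'*n" "2*c0 = b'*m-n"
      and PP: "v1^2+a^3-2*a^2-a*b+b-1 = 1-b+a*b + K/4*b' - 2*c0*c2 + 2*a*c0*c3 + b*(2-a+K/4*(1+b'^2-a'^2+b*b')-2*c1*c3)"
    using half_from_cubic[OF t t0 irr c] by blast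
  define w1 where "w1 = half_slope a' b' m n"
  have M: "mumford a' b' w1 ((b'*m*a'*b' + b'*(a'*m+b'*n) - n)/2)" unfolding w1_def by (rule mumford_half[OF H])
  have AB: "\<not> (a = 2 \<and> b = 1)" using irr[of "-1"] by auto
  obtain l where l: "l \<noteq> 0" "kum a b v1 = l*((kum a' b' w1)^2-(1-a'-b')^2+8*b')" "b+1-a = l*(4*(b'*kum a' b' w1-(1-a'-b')))"
     "b-1-a = l*(4*b'^2-4-2*kum a' b' w1*(1-a'-b'))" "-b-1-a = l*(-4*(b'*(1-a'-b')+kum a' b' w1))"
    using half_coordinates[OF H Kv K cc PP[folded kum_def] HOL.refl HOL.refl AB] unfolding w1_def by blast
  have "xi a b v1 = scale l (Phi (xi a' b' w1))"
  proof -
    have "2 = (b+1-a) - (b-1-a)" "1-a-b = (b+1-a) + (-b-1-a) - (b-1-a)" "-2*b = (-b-1-a) - (b-1-a)" by simp_all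
    hence e: "2 = l*(4*(b'*kum a' b' w1-(1-a'-b'))) - l*(4*b'^2-4-2*kum a' b' w1*(1-a'-b'))"
      "1-a-b = l*(4*(b'*kum a' b' w1-(1-a'-b'))) + l*(-4*(b'*(1-a'-b')+kum a' b' w1)) - l*(4*b'^2-4-2*kum a' b' w1*(1-a'-b'))"
      "-2*b = l*(-4*(b'*(1-a'-b')+kum a' b' w1)) - l*(4*b'^2-4-2*kum a' b' w1*(1-a'-b'))"
      unfolding l(3,4,5)[symmetric] by simp_all
    show ?thesis unfolding xi_def Phi.simps Let_def scale.simps prod.inject
      using l(2) e by (simp add: algebra_simps power2_eq_square)
  qed
  hence "wsim (xi a b v1) (Phi (xi a' b' w1))" using wsim_sym[OF wsim.scale[OF wsim.refl l(1)]] by simp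
  thus ?thesis unfolding halvable_def using M by blast
qed

text \<open>By \<open>selmer\<close> only the sign of \<open>b\<close> can be wrong.
  \<open>translate1\<close> changes it and keeps the square class of the norm of
  \<open>x^2 + 1\<close>.\<close>

lemma halvable_square_norm:
  assumes D: "mumford a b v1 v0" and t: "(1-b)^2 + a^2 = t^2" and t0: "t \<noteq> 0"
  shows "halvable (xi a b v1)"
proof (cases "\<exists>x. x^2 + a*x + b = 0")
  case True
  thus ?thesis using halvable_reducible[OF D] by blast
next
  case False
  hence irr: "x^2 + a*x + b \<noteq> 0" for x by blast
  have b0: "b \<noteq> 0" using irr[of 0] by simp
  obtain s where s: "s \<noteq> 0" "b = s^2 \<or> b = -(s^2)" using selmer(1)[OF D b0] by blast
  show ?thesis
  proof (cases "b = s^2")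
    case True
    show ?thesis by (rule halvable_trivial_class[OF D irr True s(1) t t0])
  next
    case False
    hence bs: "b = -(s^2)" using s by simp
    obtain a2 b2 w1 w0 e where M: "mumford a2 b2 w1 w0" and bb: "b*b2 = -1" and ba: "b*a2 = 1 + b - kum a b v1"
      and bP: "b*kum a2 b2 w1 = a+b-1" and N: "((1-b2)^2+a2^2)*((1-b)^2+a^2) = e^2"
      by (rule translate1[OF D b0])
    have "scale b (xi a2 b2 w1) = mul_i (xi a b v1)"
      unfolding xi_def scale.simps mul_i.simps prod.inject using bb ba bP by (simp add: algebra_simps)
    hence sim: "wsim (xi a b v1) (xi a2 b2 w1)"
      using wsim_trans[OF wsim_sym[OF wsim.scale[OF wsim.refl b0]] , of "xi a b v1" "xi a2 b2 w1"] wsim.mul_i[OF wsim.refl[of "xi a b v1"]] by simp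
    have "halvable (xi a2 b2 w1)"
    proof (cases "(\<exists>x. x^2 + a2*x + b2 = 0)")
      case True
      thus ?thesis using halvable_reducible[OF M] by blast
    next
      case False
      hence irr2: "x^2 + a2*x + b2 \<noteq> 0" for x by blast
      have b2: "b2 = (1/s)^2" using bb s(1) unfolding bs by (simp add: power_divide field_simps)
      have N2: "(1-b2)^2+a2^2 = (e/t)^2" using N t0 unfolding t power_divide by (simp add: field_simps)
      show ?thesis
      proof (cases "e/t = 0")
        case True
        hence "(1-b2)^2+a2^2 = 0" unfolding N2 True by simp
        hence "b2 = 1" "a2 = 0" by (simp_all add: sum_power2_eq_zero_iff)
        hence "W_multiple 2 (xi a2 b2 w1) (1,0,0,0)" using M
          by (auto simp: mumford_def W_multiple_def xi_def kum_def)
        thus ?thesis using W_multiple_wsim halvable_wsim halvable_torsion(1) by blast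
      next
        case False
        show ?thesis by (rule halvable_trivial_class[OF M irr2 b2 _ N2 False]) (use s in simp)
      qed
    qed
    thus ?thesis using halvable_wsim[OF sim] by blast
  qed
qed

text \<open>\<open>translate2\<close> changes the norm of \<open>x^2 + 1\<close> by a factor 2 up to
  squares, so the translations account for all square classes in \<open>selmer\<close>.\<close>

lemma halvable_all:
  assumes D: "mumford a b v1 v0"
  shows "halvable (xi a b v1)"
proof (cases "\<exists>x. x^2 + a*x + b = 0")
  case True
  thus ?thesis using halvable_reducible[OF D] by blast
next
  case False
  hence irr: "x^2 + a*x + b \<noteq> 0" for x by blast
  have b0: "b \<noteq> 0" using irr[of 0] by simp
  show ?thesis
  proof (cases "(1-b)^2 + a^2 = 0 \<or> (a = 2 \<and> b = -1)")
    case True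
    hence "W_multiple 2 (xi a b v1) (1,0,0,0)"
    proof
      assume "(1-b)^2 + a^2 = 0"
      hence "b = 1" "a = 0" by (simp_all add: sum_power2_eq_zero_iff)
      thus ?thesis using D by (auto simp: mumford_def W_multiple_def xi_def kum_def)
    next
      assume ab: "a = 2 \<and> b = -1"
      have "v0^2 + v1^2 = 0" using D ab by (simp add: mumford_def)
      hence "v1 = 0" by (simp add: sum_power2_eq_zero_iff)
      thus ?thesis using ab by (simp add: W_multiple_def xi_def kum_def)
    qed
    thus ?thesis using W_multiple_wsim halvable_wsim halvable_torsion(1) by blast
  next
    case False
    hence N0: "(1-b)^2 + a^2 \<noteq> 0" and ab: "\<not> (a = 2 \<and> b = -1)" by auto
    obtain t where t: "t \<noteq> 0" "(1-b)^2 + a^2 = t^2 \<or> (1-b)^2 + a^2 = 2*t^2" using selmer(2)[OF D b0 N0] by blast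
    show ?thesis
    proof (cases "(1-b)^2 + a^2 = t^2")
      case True
      show ?thesis by (rule halvable_square_norm[OF D True t(1)])
    next
      case False
      hence t2: "(1-b)^2 + a^2 = 2*t^2" using t by simp
      obtain a2 b2 w1 w0 L l1 l0 where M: "mumford a2 b2 w1 w0" and L0: "L \<noteq> 0" and L: "L = kum a b v1 - a - b + 1"
        and Lb: "L*b2 = kum a b v1 + a + b - 1" and La: "L*(a2+b2-1) = 4*(b-1)" and LP: "L*kum a2 b2 w1 = 4*(b+1)"
        and l1: "l1 \<noteq> 0" and "l1^2*b*b2 = l0^2" and N: "l1^4*(((1-b2)^2+a2^2)*((1-b)^2+a^2)) = 8"
        by (rule translate2[OF D N0 irr ab])
      have "scale L (xi a2 b2 w1) = scale 2 (mul_sqrt2 (xi a b v1))"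
        unfolding xi_def scale.simps mul_sqrt2.simps prod.inject using L Lb La LP by (simp add: algebra_simps)
      moreover have "wsim (xi a b v1) (scale 2 (mul_sqrt2 (xi a b v1)))" by (intro wsim.intros) simp
      moreover have "wsim (scale L (xi a2 b2 w1)) (xi a2 b2 w1)" by (intro wsim_sym[OF wsim.scale[OF wsim.refl L0]])
      ultimately have sim: "wsim (xi a b v1) (xi a2 b2 w1)" using wsim_trans by metis
      have "(1-b2)^2+a2^2 = (2/(l1^2*t))^2"
      proof -
        have "l1^4*(((1-b2)^2+a2^2)*(2*t^2)) = 8" using N unfolding t2 .
        thus ?thesis using l1 t(1) by (simp add: field_simps power_mult_distrib power_divide)
      qed
      moreover have "2/(l1^2*t) \<noteq> 0" using l1 t(1) by simp
      ultimately have "halvable (xi a2 b2 w1)" by (rule halvable_square_norm[OF M])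
      thus ?thesis using halvable_wsim[OF sim] by blast
    qed
  qed
qed

section \<open>Contraction of the doubling map\<close>

fun vec_of_int :: "int \<times> int \<times> int \<times> int \<Rightarrow> vec" where
  "vec_of_int (p0,p1,p2,p3) = (of_int p0, of_int p1, of_int p2, of_int p3)"

text \<open>Not divisible by \<open>\<surd>2\<close> in the ring generated by
  \<open>\<zeta>\<close>.\<close>

fun primitive_vec :: "int \<times> int \<times> int \<times> int \<Rightarrow> bool" where
  "primitive_vec (p0,p1,p2,p3) \<longleftrightarrow> odd (p0+p2) \<or> odd (p1+p3)"

text \<open>Multiplication by \<open>mul_sqrt2 / 2\<close> halves the sum of squares of an integral vector that is not primitive.\<close>

lemma exists_primitive_int:
  assumes "(p0,p1,p2,p3) \<noteq> (0,0,0,0)"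
  shows "\<exists>q. primitive_vec q \<and> wsim (vec_of_int (p0,p1,p2,p3)) (vec_of_int q)"
  using assms
proof (induction "nat (p0^2+p1^2+p2^2+p3^2)" arbitrary: p0 p1 p2 p3 rule: less_induct)
  case less
  show ?case
  proof (cases "primitive_vec (p0,p1,p2,p3)")
    case True
    thus ?thesis using wsim.refl by blast
  next
    case False
    hence "even (p0+p2)" "even (p1+p3)" by auto
    then obtain k l where "p0+p2 = 2*k" "p1+p3 = 2*l" by (elim evenE)
    hence k: "p2 = 2*k - p0" and l: "p3 = 2*l - p1" by simp_all
    have sim: "wsim (vec_of_int (p0,p1,p2,p3)) (vec_of_int (p1-l, k, l, k-p0))"
    proof -
      have "vec_of_int (p1-l, k, l, k-p0) = scale (1/2) (mul_sqrt2 (vec_of_int (p0,p1,p2,p3)))"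
        unfolding k l by simp
      thus ?thesis using wsim.scale[OF wsim.mul_sqrt2[OF wsim.refl], of "1/2"] by (simp del: vec_of_int.simps)
    qed
    have two: "p0^2+p1^2+p2^2+p3^2 = 2*((p1-l)^2+k^2+l^2+(k-p0)^2)"
      unfolding k l by (simp add: power2_eq_square algebra_simps)
    have "p0^2+p1^2+p2^2+p3^2 \<noteq> 0"
    proof
      assume "p0^2+p1^2+p2^2+p3^2 = 0"
      hence "p0 = 0 \<and> p1 = 0 \<and> p2 = 0 \<and> p3 = 0"
        using zero_le_power2[of p0] zero_le_power2[of p1] zero_le_power2[of p2] zero_le_power2[of p3]
        by (smt (verit) power2_eq_iff_nonneg power_zero_numeral zero_eq_power2)
      thus False using less.prems by simp
    qed
    moreover have "0 \<le> (p1-l)^2+k^2+l^2+(k-p0)^2" by simp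
    ultimately have pos: "0 < (p1-l)^2+k^2+l^2+(k-p0)^2" using two \<open>0 \<le> (p1-l)^2+k^2+l^2+(k-p0)^2\<close>
      by (metis less_le mult_zero_right)
    hence "nat ((p1-l)^2+k^2+l^2+(k-p0)^2) < nat (p0^2+p1^2+p2^2+p3^2)" unfolding two by simp
    moreover have "(p1-l, k, l, k-p0) \<noteq> (0,0,0,0)" using pos by auto
    ultimately obtain q where "primitive_vec q" "wsim (vec_of_int (p1-l, k, l, k-p0)) (vec_of_int q)"
      using less.hyps by blast
    thus ?thesis using wsim_trans[OF _ sim] by blast
  qed
qed

lemma exists_primitive:
  assumes "v \<noteq> (0,0,0,0)"
  obtains q where "primitive_vec q" "wsim v (vec_of_int q)"
proof -
  obtain v0 v1 v2 v3 where v: "v = (v0,v1,v2,v3)" by (cases v)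
  have "\<exists>n d. d > 0 \<and> x * of_int d = (of_int n :: rat)" for x
  proof -
    obtain n d :: int where x: "x = of_int n / of_int d" "d > 0" by (rule rat_cases_coprime)
    hence "x * of_int d = of_int n" by simp
    thus ?thesis using x(2) by blast
  qed
  then obtain n d where nd: "\<And>x. d x > 0" "\<And>x::rat. x * of_int (d x) = of_int (n x)" by metis
  define c where "c = d v0 * d v1 * d v2 * d v3"
  have c: "c > 0" unfolding c_def using nd(1) by simp
  define p where "p = (n v0 * (d v1 * d v2 * d v3), n v1 * (d v0 * d v2 * d v3), n v2 * (d v0 * d v1 * d v3), n v3 * (d v0 * d v1 * d v2))"
  have e: "vec_of_int p = scale (of_int c) v"
    unfolding v p_def c_def vec_of_int.simps scale.simps of_int_mult nd(2)[symmetric] by (simp add: ac_simps)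
  have "p \<noteq> (0,0,0,0)"
  proof
    assume "p = (0,0,0,0)"
    thus False using e c assms unfolding v by simp
  qed
  then obtain q where q: "primitive_vec q" "wsim (vec_of_int p) (vec_of_int q)"
    using exists_primitive_int by (cases p) blast
  have "wsim v (vec_of_int p)" unfolding e using c by (intro wsim.intros) simp
  thus ?thesis using that[OF q(1)] wsim_trans[OF q(2)] by simp
qed

text \<open>Proportional by a 2-adic unit, so that congruences modulo powers of 2 carry
  over.\<close>

fun int_proportional :: "int \<times> int \<times> int \<times> int \<Rightarrow> int \<times> int \<times> int \<times> int \<Rightarrow> bool" where
  "int_proportional (p0,p1,p2,p3) (q0,q1,q2,q3) \<longleftrightarrow>
    (\<exists>x y. odd x \<and> odd y \<and> y*p0 = x*q0 \<and> y*p1 = x*q1 \<and> y*p2 = x*q2 \<and> y*p3 = x*q3)"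

lemma cross_multiply:
  fixes c :: rat
  obtains x y :: int where "coprime x y" "\<And>p q. of_int p = c * of_int q \<Longrightarrow> y*p = x*q"
proof -
  obtain x y where c: "c = of_int x / of_int y" and y: "y > 0" and cop: "coprime x y" by (rule rat_cases_coprime)
  have cy: "c * of_int y = of_int x" using y unfolding c by simp
  have "y*p = x*q" if "of_int p = c * of_int q" for p q
  proof -
    have "(of_int (y*p) :: rat) = of_int (x*q)" unfolding of_int_mult that cy[symmetric] by (simp add: ac_simps)
    thus ?thesis by (simp only: of_int_eq_iff)
  qed
  thus ?thesis by (rule that[OF cop])
qed

text \<open>At the prime \<open>1 - \<zeta>\<close> above 2 primitive vectors have valuation 0 or 1,
  a rational number a multiple of 4. So \<open>c\<close> is a 2-adic unit.\<close>

lemma primitive_scale: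
  assumes "primitive_vec (p0,p1,p2,p3)" "primitive_vec (q0,q1,q2,q3)"
    and e: "vec_of_int (p0,p1,p2,p3) = scale c (vec_of_int (q0,q1,q2,q3))"
  shows "int_proportional (p0,p1,p2,p3) (q0,q1,q2,q3)"
proof -
  obtain x y where cop: "coprime x y" and ee: "\<And>p q. of_int p = c * of_int q \<Longrightarrow> y*p = x*q"
    using cross_multiply[of c] by blast
  have E: "y*p0 = x*q0" "y*p1 = x*q1" "y*p2 = x*q2" "y*p3 = x*q3" using e by (auto intro: ee)
  have E2: "y*(p0+p2) = x*(q0+q2)" "y*(p1+p3) = x*(q1+q3)" using E by (simp_all add: algebra_simps)
  have "odd x"
  proof
    assume x: "even x"
    hence "odd y" using cop coprime_common_divisor[of x y 2] by auto
    hence "even (p0+p2) \<and> even (p1+p3)" using E2 x by (metis even_mult_iff)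
    thus False using assms(1) by simp
  qed
  moreover have "odd y"
  proof
    assume x: "even y"
    hence "even (q0+q2) \<and> even (q1+q3)" using E2 \<open>odd x\<close> by (metis even_mult_iff)
    thus False using assms(2) by simp
  qed
  ultimately show ?thesis using E by auto
qed

text \<open>The same comparison fails here, because \<open>\<surd>2\<close> has valuation 2.\<close>

lemma primitive_scale_sqrt2:
  assumes p: "primitive_vec (p0,p1,p2,p3)" and q: "primitive_vec (q0,q1,q2,q3)"
    and e: "vec_of_int (p0,p1,p2,p3) = scale c (mul_sqrt2 (vec_of_int (q0,q1,q2,q3)))"
  shows False
proof -
  obtain x y where cop: "coprime x y" and ee: "\<And>p q. of_int p = c * of_int q \<Longrightarrow> y*p = x*q"
    using cross_multiply[of c] by blast
  have E: "y*p0 = x*(q1-q3)" "y*p1 = x*(q0+q2)" "y*p2 = x*(q1+q3)" "y*p3 = x*(q2-q0)" using e by (auto intro!: ee)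
  have E2: "y*(p0+p2) = 2*(x*q1)" "y*(p1+p3) = 2*(x*q2)" using E by (simp_all add: algebra_simps)
  have "even y"
  proof (rule ccontr)
    assume "odd y"
    moreover have "even (y*(p0+p2))" "even (y*(p1+p3))" unfolding E2 by simp_all
    ultimately have "even (p0+p2) \<and> even (p1+p3)" by simp
    thus False using p by simp
  qed
  hence x: "odd x" using cop coprime_common_divisor[of x y 2] by auto
  obtain z where z: "y = 2*z" using \<open>even y\<close> by blast
  have "x*(q0+q2) = 2*(z*p1)" "x*(q1+q3) = 2*(z*p2)" using E unfolding z by (simp_all add: ac_simps)
  hence "even (x*(q0+q2))" "even (x*(q1+q3))" by simp_all
  hence "even (q0+q2) \<and> even (q1+q3)" using x by simp
  thus False using q by simp
qed

lemma primitive_wsim: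
  assumes p: "primitive_vec (p0,p1,p2,p3)" and q: "primitive_vec (q0,q1,q2,q3)"
    and sim: "wsim (vec_of_int (p0,p1,p2,p3)) (vec_of_int (q0,q1,q2,q3))"
  shows "int_proportional (p0,p1,p2,p3) (q0,q1,q2,q3) \<or> int_proportional (p0,p1,p2,p3) (-q2,-q3,q0,q1)"
proof -
  obtain c where c: "W_multiple c (vec_of_int (p0,p1,p2,p3)) (vec_of_int (q0,q1,q2,q3))"
    by (rule wsim_W_multiple[OF sim])
  have i: "mul_i (vec_of_int (q0,q1,q2,q3)) = vec_of_int (-q2,-q3,q0,q1)" by simp
  have iq: "primitive_vec (-q2,-q3,q0,q1)" using q by auto
  from c consider "vec_of_int (p0,p1,p2,p3) = scale c (vec_of_int (q0,q1,q2,q3))"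
    | "vec_of_int (p0,p1,p2,p3) = scale c (vec_of_int (-q2,-q3,q0,q1))"
    | "vec_of_int (p0,p1,p2,p3) = scale c (mul_sqrt2 (vec_of_int (q0,q1,q2,q3)))"
    | "vec_of_int (p0,p1,p2,p3) = scale c (mul_sqrt2 (vec_of_int (-q2,-q3,q0,q1)))"
    unfolding W_multiple_def vec_simps(6)[symmetric] i by blast
  thus ?thesis
  proof cases
    case 1 thus ?thesis using primitive_scale[OF p q] by blast
  next
    case 2 thus ?thesis using primitive_scale[OF p iq] by blast
  next
    case 3 thus ?thesis using primitive_scale_sqrt2[OF p q] by blast
  next
    case 4 thus ?thesis using primitive_scale_sqrt2[OF p iq] by blast
  qed
qed

section \<open>Chains of halves in primitive vectors\<close>

definition good :: "int \<times> int \<times> int \<times> int \<Rightarrow> bool" where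
  "good p \<longleftrightarrow> primitive_vec p \<and> (\<exists>a b v1 v0. mumford a b v1 v0 \<and> wsim (vec_of_int p) (xi a b v1))"

lemma good_half:
  assumes "good p"
  obtains q where "good q" "wsim (vec_of_int p) (Phi (vec_of_int q))"
proof -
  obtain a b v1 v0 where "mumford a b v1 v0" and s: "wsim (vec_of_int p) (xi a b v1)"
    using assms unfolding good_def by blast
  hence "halvable (xi a b v1)" by (intro halvable_all)
  then obtain a' b' v1' v0' where D: "mumford a' b' v1' v0'" and s': "wsim (xi a b v1) (Phi (xi a' b' v1'))"
    unfolding halvable_def by blast
  have "xi a' b' v1' \<noteq> (0,0,0,0)" by (simp add: xi_def)
  then obtain q where q: "primitive_vec q" "wsim (xi a' b' v1') (vec_of_int q)" by (rule exists_primitive)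
  have "good q" unfolding good_def using q(1) D wsim_sym[OF q(2)] by blast
  moreover have "wsim (vec_of_int p) (Phi (vec_of_int q))"
    using wsim_trans[OF Phi_wsim[OF q(2)] wsim_trans[OF s' s]] .
  ultimately show ?thesis by (rule that)
qed

lemma good_mul_i:
  assumes "good (p0,p1,p2,p3)"
  shows "good (-p2,-p3,p0,p1)"
proof -
  have "wsim (mul_i (vec_of_int (p0,p1,p2,p3))) (vec_of_int (p0,p1,p2,p3))" by (rule wsim_sym[OF wsim.mul_i[OF wsim.refl]])
  hence "wsim (vec_of_int (-p2,-p3,p0,p1)) (vec_of_int (p0,p1,p2,p3))" by simp
  hence "wsim (vec_of_int (-p2,-p3,p0,p1)) (xi a b v1)" if "wsim (vec_of_int (p0,p1,p2,p3)) (xi a b v1)" for a b v1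
    by (rule wsim_trans[OF that])
  moreover have "primitive_vec (-p2,-p3,p0,p1)" using assms unfolding good_def by auto
  ultimately show ?thesis using assms unfolding good_def by blast
qed

text \<open>Not divisible by \<open>1 - \<zeta>\<close>. Primitive vectors without this property are
  divisible by it exactly once.\<close>

fun mixed_parity :: "int \<times> int \<times> int \<times> int \<Rightarrow> bool" where
  "mixed_parity (p0,p1,p2,p3) \<longleftrightarrow> odd (p0+p2+p1+p3)"

fun int_Phi :: "int \<times> int \<times> int \<times> int \<Rightarrow> int \<times> int \<times> int \<times> int" where
  "int_Phi (p0,p1,p2,p3) =
    (let s0 = p0^2-p2^2-2*p1*p3; s1 = -2*(p0*p3+p1*p2); s2 = p3^2-p1^2-2*p0*p2; s3 = 2*(p2*p3-p0*p1)
     in (s0, s1-s2, s1+s3-s2, s3-s2))"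

text \<open>\<open>int_Phi\<close> divided by \<open>\<surd>2\<close>. On vectors of valuation 1,
  normalized as in \<open>sqrt2_Phi_parity\<close>, the squaring makes this division exact.\<close>

fun sqrt2_Phi :: "int \<times> int \<times> int \<times> int \<Rightarrow> int \<times> int \<times> int \<times> int" where
  "sqrt2_Phi (p0,p1,p2,p3) =
    (let s0 = p0^2-p2^2-2*p1*p3; s2 = p3^2-p1^2-2*p0*p2; A = -(p0*p3+p1*p2); B = p2*p3-p0*p1
     in (A-B, (s0-s2) div 2+A+B, A+B-s2, A+B-(s0+s2) div 2))"

lemma vec_of_int_Phi: "vec_of_int (int_Phi p) = Phi (vec_of_int p)"
  by (cases p) (simp add: Let_def)

lemma int_Phi_parity:
  assumes "mixed_parity p" and "int_Phi p = (r0,r1,r2,r3)"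
  shows "odd (r0+r2)" "even (r1+r3)"
proof -
  obtain p0 p1 p2 p3 where p: "p = (p0,p1,p2,p3)" by (cases p)
  show "odd (r0+r2)" "even (r1+r3)" using assms unfolding p by (auto simp: Let_def)
qed

lemma sqrt2_Phi_parity:
  assumes "odd p0" "even p2" "odd (p1+p3)" and "sqrt2_Phi (p0,p1,p2,p3) = (r0,r1,r2,r3)"
  shows "odd r0" "even r2" "odd (r1+r3)" "Phi (vec_of_int (p0,p1,p2,p3)) = mul_sqrt2 (vec_of_int (r0,r1,r2,r3))"
    "2*r1 = p0^2-p2^2-2*p1*p3-(p3^2-p1^2-2*p0*p2) - 2*(p0*p3+p1*p2) + 2*(p2*p3-p0*p1)"
    "2*r3 = - 2*(p0*p3+p1*p2) + 2*(p2*p3-p0*p1) - (p0^2-p2^2-2*p1*p3+(p3^2-p1^2-2*p0*p2))"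
proof -
  define s0 s2 A B where defs: "s0 = p0^2-p2^2-2*p1*p3" "s2 = p3^2-p1^2-2*p0*p2" "A = -(p0*p3+p1*p2)" "B = p2*p3-p0*p1"
  have r: "r0 = A-B" "r1 = (s0-s2) div 2+A+B" "r2 = A+B-s2" "r3 = A+B-(s0+s2) div 2"
    using assms(4) by (simp_all add: Let_def defs)
  have s: "even (s0-s2)" "even (s0+s2)" and s2: "odd s2" unfolding defs using assms(1-3) by auto
  have AB: "odd (A+B)" "odd (A-B)" unfolding defs using assms(1-3) by auto
  show "odd r0" "even r2" unfolding r using AB s2 by auto
  obtain k where k: "s0 - s2 = 2*k" using s(1) by blast
  have h: "(s0-s2) div 2 = k" "(s0+s2) div 2 = k + s2" using k by auto
  show "odd (r1+r3)" unfolding r h using s2 by simp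
  show "2*r1 = p0^2-p2^2-2*p1*p3-(p3^2-p1^2-2*p0*p2) - 2*(p0*p3+p1*p2) + 2*(p2*p3-p0*p1)"
    "2*r3 = - 2*(p0*p3+p1*p2) + 2*(p2*p3-p0*p1) - (p0^2-p2^2-2*p1*p3+(p3^2-p1^2-2*p0*p2))"
    using k unfolding r h unfolding defs by (simp_all add: algebra_simps)
  have "Phi (vec_of_int (p0,p1,p2,p3)) = vec_of_int (s0, 2*A-s2, 2*A+2*B-s2, 2*B-s2)" by (simp add: defs Let_def)
  also have "\<dots> = mul_sqrt2 (vec_of_int (r0,r1,r2,r3))"
  proof -
    have s0: "s0 = 2*k + s2" using k by simp
    show ?thesis unfolding r h s0 by simp
  qed
  finally show "Phi (vec_of_int (p0,p1,p2,p3)) = mul_sqrt2 (vec_of_int (r0,r1,r2,r3))" .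
qed

lemma int_proportional_parity:
  assumes "int_proportional (p0,p1,p2,p3) (q0,q1,q2,q3)"
  shows "(even p0 \<longleftrightarrow> even q0) \<and> (even p1 \<longleftrightarrow> even q1) \<and> (even p2 \<longleftrightarrow> even q2) \<and> (even p3 \<longleftrightarrow> even q3)"
proof -
  obtain x y where xy: "odd x" "odd y" "y*p0 = x*q0" "y*p1 = x*q1" "y*p2 = x*q2" "y*p3 = x*q3" using assms by auto
  have "even p = even q" if "y*p = x*q" for p q using that xy(1,2) by (metis even_mult_iff)
  thus ?thesis using xy(3-6) by blast
qed

text \<open>Halving preserves the valuation at \<open>1 - \<zeta>\<close>, so each of the two kinds
  of vectors can be treated by itself.\<close>

lemma good_step:
  assumes p: "good (p0,p1,p2,p3)"
  obtains (mixed) q r0 r1 r2 r3 where "good q" "mixed_parity q" "mixed_parity (p0,p1,p2,p3)" "int_Phi q = (r0,r1,r2,r3)"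
    "int_proportional (p0,p1,p2,p3) (r0,r1,r2,r3) \<or> int_proportional (p0,p1,p2,p3) (-r2,-r3,r0,r1)"
  | (odd) q0 q1 q2 q3 r0 r1 r2 r3 where "good (q0,q1,q2,q3)" "odd q0" "even q2" "odd (q1+q3)" "\<not> mixed_parity (p0,p1,p2,p3)"
    "sqrt2_Phi (q0,q1,q2,q3) = (r0,r1,r2,r3)"
    "int_proportional (p0,p1,p2,p3) (r0,r1,r2,r3) \<or> int_proportional (p0,p1,p2,p3) (-r2,-r3,r0,r1)"
proof -
  obtain q where q: "good q" and sim: "wsim (vec_of_int (p0,p1,p2,p3)) (Phi (vec_of_int q))" by (rule good_half[OF p])
  have p': "primitive_vec (p0,p1,p2,p3)" using p unfolding good_def by blast
  show ?thesis
  proof (cases "mixed_parity q")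
    case True
    obtain r0 r1 r2 r3 where r: "int_Phi q = (r0,r1,r2,r3)" by (cases "int_Phi q")
    note rp = int_Phi_parity[OF True r]
    have r': "primitive_vec (r0,r1,r2,r3)" using rp by simp
    have ip: "int_proportional (p0,p1,p2,p3) (r0,r1,r2,r3) \<or> int_proportional (p0,p1,p2,p3) (-r2,-r3,r0,r1)"
      by (rule primitive_wsim[OF p' r' sim[folded vec_of_int_Phi, unfolded r]])
    hence mp: "mixed_parity (p0,p1,p2,p3)" using rp by (auto dest!: int_proportional_parity simp del: int_proportional.simps)
    show ?thesis by (rule mixed[OF q True mp r ip])
  next
    case False
    obtain t0 t1 t2 t3 where t: "q = (t0,t1,t2,t3)" by (cases q)
    have par: "odd (t0+t2)" "odd (t1+t3)" using False q unfolding t good_def by auto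
    have "\<exists>q0 q1 q2 q3. good (q0,q1,q2,q3) \<and> odd q0 \<and> even q2 \<and> odd (q1+q3) \<and> wsim (vec_of_int q) (vec_of_int (q0,q1,q2,q3))"
    proof (cases "odd t0")
      case True
      moreover have "even t2" "odd (t1+t3)" using par True by auto
      ultimately show ?thesis using q wsim.refl[of "vec_of_int q"] unfolding t by blast
    next
      case False
      have "wsim (vec_of_int q) (mul_i (vec_of_int q))" by (intro wsim.intros)
      hence "wsim (vec_of_int q) (vec_of_int (-t2,-t3,t0,t1))" unfolding t by simp
      moreover have "good (-t2,-t3,t0,t1)" using q good_mul_i unfolding t by blast
      moreover have "odd (-t2)" "even t0" "odd (-t3+t1)" using False par by auto
      ultimately show ?thesis by blast
    qed
    then obtain q0 q1 q2 q3 where q': "good (q0,q1,q2,q3)" "odd q0" "even q2" "odd (q1+q3)"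
      "wsim (vec_of_int q) (vec_of_int (q0,q1,q2,q3))" by blast
    obtain r0 r1 r2 r3 where r: "sqrt2_Phi (q0,q1,q2,q3) = (r0,r1,r2,r3)" by (cases "sqrt2_Phi (q0,q1,q2,q3)")
    note rp = sqrt2_Phi_parity[OF q'(2-4) r]
    have "wsim (vec_of_int (p0,p1,p2,p3)) (mul_sqrt2 (vec_of_int (r0,r1,r2,r3)))"
      using wsim_trans[OF Phi_wsim[OF q'(5)] sim] unfolding rp(4) .
    hence s: "wsim (vec_of_int (p0,p1,p2,p3)) (vec_of_int (r0,r1,r2,r3))"
      by (rule wsim_trans[OF wsim_sym[OF wsim.mul_sqrt2[OF wsim.refl]]])
    have r': "primitive_vec (r0,r1,r2,r3)" using rp(1-3) by simp
    have ip: "int_proportional (p0,p1,p2,p3) (r0,r1,r2,r3) \<or> int_proportional (p0,p1,p2,p3) (-r2,-r3,r0,r1)"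
      by (rule primitive_wsim[OF p' r' s])
    hence mp: "\<not> mixed_parity (p0,p1,p2,p3)" using rp(1-3) by (auto dest!: int_proportional_parity simp del: int_proportional.simps)
    show ?thesis by (rule odd[OF q'(1-4) mp r ip])
  qed
qed

text \<open>The vectors in question are \<open>2\<close>-adic limits of iterates of \<open>Phi\<close>, which contracts towards \<open>(1,0,0,0)\<close> and \<open>(0,0,1,0)\<close>.\<close>

fun near_mixed :: "nat \<Rightarrow> int \<times> int \<times> int \<times> int \<Rightarrow> bool" where
  "near_mixed k (p0,p1,p2,p3) \<longleftrightarrow> 2^k dvd p1 \<and> 2^k dvd p3 \<and> (2^k dvd p0 \<or> 2^k dvd p2)"

lemma odd_dvd_cancel:
  assumes "odd y" "(2::int)^k dvd q" "y*p = x*q"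
  shows "2^k dvd p"
proof -
  have "2^k dvd y*p" unfolding assms(3) using assms(2) by simp
  moreover have "coprime (2^k) y" using assms(1) by (simp add: coprime_left_2_iff_odd)
  ultimately show ?thesis by (simp add: coprime_dvd_mult_right_iff)
qed

lemma near_mixed_proportional:
  assumes "int_proportional (p0,p1,p2,p3) (q0,q1,q2,q3)" "near_mixed k (q0,q1,q2,q3)"
  shows "near_mixed k (p0,p1,p2,p3)"
proof -
  obtain x y where xy: "odd y" "y*p0 = x*q0" "y*p1 = x*q1" "y*p2 = x*q2" "y*p3 = x*q3" using assms(1) by auto
  note c = xy(2-5)[THEN odd_dvd_cancel[OF xy(1), rotated 1]]
  show ?thesis using c[of k] assms(2) by auto
qed

text \<open>The gain comes from the factor 2 of the mixed products, and in
  \<open>p3^2 - p1^2\<close> from the even factor \<open>p3 + p1\<close>.\<close>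

lemma near_mixed_Phi:
  assumes "near_mixed k (p0,p1,p2,p3)" "even (p1+p3)" "int_Phi (p0,p1,p2,p3) = (r0,r1,r2,r3)"
  shows "near_mixed (Suc k) (r0,r1,r2,r3)"
proof -
  define s0 s1 s2 s3 where s: "s0 = p0^2-p2^2-2*p1*p3" "s1 = -2*(p0*p3+p1*p2)" "s2 = p3^2-p1^2-2*p0*p2" "s3 = 2*(p2*p3-p0*p1)"
  have r: "r1 = s1-s2" "r2 = s1+s3-s2" "r3 = s3-s2" using assms(3) unfolding s by (simp_all add: Let_def)
  have d: "2^k dvd p1" "2^k dvd p3" "2^k dvd p0 \<or> 2^k dvd p2" using assms(1) by auto
  have "2^Suc k dvd s1" "2^Suc k dvd s3" unfolding s using d by (auto simp del: mult_minus_left intro!: mult_dvd_mono)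
  moreover have "2^Suc k dvd s2"
  proof -
    have "p3^2-p1^2 = (p3+p1)*(p3-p1)" by (simp add: power2_eq_square algebra_simps)
    moreover have "2*2^k dvd (p3+p1)*(p3-p1)" using d assms(2) by (intro mult_dvd_mono) auto
    moreover have "2*2^k dvd 2*p0*p2" using d by (auto simp: mult.assoc)
    ultimately show ?thesis unfolding s by simp
  qed
  ultimately show ?thesis unfolding r by simp
qed

lemma good_near_mixed:
  assumes "good p" "mixed_parity p"
  shows "near_mixed k p"
  using assms
proof (induction k arbitrary: p)
  case 0
  show ?case by (cases p) simp
next
  case (Suc k)
  obtain p0 p1 p2 p3 where p: "p = (p0,p1,p2,p3)" by (cases p)
  \<comment> \<open>Every vector of this kind is itself an image under \<open>int_Phi\<close>, which
    makes \<open>u1 + u3\<close> even.\<close>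
  have even: "even (u1+u3)" if u: "good (u0,u1,u2,u3)" "mixed_parity (u0,u1,u2,u3)" for u0 u1 u2 u3
    using u(1)
  proof (cases rule: good_step)
    case (mixed q r0 r1 r2 r3)
    have "odd (r0+r2)" "even (r1+r3)" using int_Phi_parity mixed by blast+
    thus ?thesis using mixed(5) by (auto dest!: int_proportional_parity simp del: int_proportional.simps)
  next
    case odd thus ?thesis using u by simp
  qed
  from Suc.prems(1)[unfolded p] show ?case
  proof (cases rule: good_step)
    case (mixed q r0 r1 r2 r3)
    obtain q0 q1 q2 q3 where q: "q = (q0,q1,q2,q3)" by (cases q)
    have "near_mixed (Suc k) (r0,r1,r2,r3)"
      using near_mixed_Phi[OF Suc.IH[OF mixed(1,2), unfolded q] even mixed(4)[unfolded q]] mixed(1,2) unfolding q by blast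
    moreover from this have "near_mixed (Suc k) (-r2,-r3,r0,r1)" by auto
    ultimately show ?thesis using mixed(5) near_mixed_proportional unfolding p by blast
  next
    case odd thus ?thesis using Suc.prems(2) p by simp
  qed
qed

lemma pow2_dvd_small:
  assumes "(2::int)^nat n dvd m" "\<bar>m\<bar> \<le> n"
  shows "m = 0"
proof (rule ccontr)
  assume "m \<noteq> 0"
  hence "\<bar>2^nat n\<bar> \<le> \<bar>m\<bar>" using assms(1) by (rule dvd_imp_le_int)
  moreover have "int (nat n) < 2^nat n" by (rule of_nat_less_two_power)
  moreover have "0 \<le> n" using assms(2) by linarith
  ultimately show False using assms(2) by simp
qed

lemma good_mixed:
  assumes "good p" "mixed_parity p"
  shows "wsim (vec_of_int p) (1,0,0,0)"
proof -
  obtain p0 p1 p2 p3 where p: "p = (p0,p1,p2,p3)" by (cases p)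
  define n where "n = \<bar>p0\<bar> + \<bar>p1\<bar> + \<bar>p2\<bar> + \<bar>p3\<bar>"
  have "near_mixed (nat n) p" by (rule good_near_mixed[OF assms])
  hence *: "p1 = 0" "p3 = 0" "p0 = 0 \<or> p2 = 0" unfolding p using pow2_dvd_small[of n] unfolding n_def by fastforce+
  moreover have "odd (p0+p2)" using assms(2) unfolding p * by simp
  ultimately have "W_multiple (of_int (p0+p2)) (vec_of_int p) (1,0,0,0)" unfolding p W_multiple_def by auto
  thus ?thesis by (rule W_multiple_wsim)
qed

section \<open>Vectors of odd valuation and the cycle of length two\<close>

lemma sqrt2_Phi_pos:
  assumes "odd p" and r: "sqrt2_Phi (p, p+2*x, 2*y, 2*w) = (r0,r1,r2,r3)"
  shows "r0 = p^2+2*p*(x-w-y)-4*x*y-4*y*w"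
    and "r1 = -4*p*w-4*x*w-4*x*y+4*y*w+2*(x^2-y^2-w^2)"
    and "r2 = 2*p*(x+y-w)-4*x*y+4*y*w-4*w^2+4*x^2"
    and "r3 = -(p^2)-4*x*y+4*y*w+4*x*w+2*(x^2+y^2-w^2)"
proof -
  have "odd (p+2*x+2*w)" using assms(1) by simp
  note R = sqrt2_Phi_parity[OF assms(1) _ this r]
  have "2*r1 = 2*(-4*p*w-4*x*w-4*x*y+4*y*w+2*(x^2-y^2-w^2))"
    using R(5) by (simp add: algebra_simps power2_eq_square)
  thus "r1 = -4*p*w-4*x*w-4*x*y+4*y*w+2*(x^2-y^2-w^2)" by simp
  have "2*r3 = 2*(-(p^2)-4*x*y+4*y*w+4*x*w+2*(x^2+y^2-w^2))"
    using R(6) by (simp add: algebra_simps power2_eq_square)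
  thus "r3 = -(p^2)-4*x*y+4*y*w+4*x*w+2*(x^2+y^2-w^2)" by simp
  show "r0 = p^2+2*p*(x-w-y)-4*x*y-4*y*w" "r2 = 2*p*(x+y-w)-4*x*y+4*y*w-4*w^2+4*x^2"
    using r by (simp_all add: Let_def algebra_simps power2_eq_square)
qed

text \<open>Complex conjugation, which maps \<open>\<zeta>\<close> to
  \<open>-\<zeta>^3\<close>.\<close>

fun vec_conj :: "int \<times> int \<times> int \<times> int \<Rightarrow> int \<times> int \<times> int \<times> int" where
  "vec_conj (p0,p1,p2,p3) = (p0,-p3,-p2,-p1)"

text \<open>By this symmetry it suffices to study the map near one of the two points of the
  cycle.\<close>

lemma sqrt2_Phi_conj:
  assumes "odd p0" "even p2" "odd (p1+p3)"
  shows "sqrt2_Phi (vec_conj (p0,p1,p2,p3)) = vec_conj (sqrt2_Phi (p0,p1,p2,p3))"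
proof -
  obtain r0 r1 r2 r3 where r: "sqrt2_Phi (p0,p1,p2,p3) = (r0,r1,r2,r3)" by (cases "sqrt2_Phi (p0,p1,p2,p3)")
  obtain t0 t1 t2 t3 where t: "sqrt2_Phi (p0,-p3,-p2,-p1) = (t0,t1,t2,t3)" by (cases "sqrt2_Phi (p0,-p3,-p2,-p1)")
  have *: "even (-p2)" "odd (-p3+-p1)" using assms(2,3) by auto
  have "t0 = r0" "t2 = -r2" using r t by (auto simp: Let_def)
  moreover have "2*t1 = 2*(-r3)" "2*t3 = 2*(-r1)"
    using sqrt2_Phi_parity(5,6)[OF assms r] sqrt2_Phi_parity(5,6)[OF assms(1) * t] by (simp_all add: algebra_simps)
  ultimately show ?thesis using r t by simp
qed

text \<open>\<open>sqrt2_Phi\<close> interchanges neighbourhoods of the multiples of \<open>(1,1,0,0)\<close> and of its conjugate \<open>(1,0,0,-1)\<close>. It needs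
  two steps to gain a factor 2; the intermediate congruences are \<open>nearer_odd\<close> and, at the start, \<open>nearer_two\<close>.\<close>

fun near_odd :: "int \<Rightarrow> int \<times> int \<times> int \<times> int \<Rightarrow> bool" where
  "near_odd m (p0,p1,p2,p3) \<longleftrightarrow> m dvd p1-p0 \<and> m dvd p2 \<and> m dvd p3"

fun nearer_odd :: "int \<Rightarrow> int \<times> int \<times> int \<times> int \<Rightarrow> bool" where
  "nearer_odd m (p0,p1,p2,p3) \<longleftrightarrow> m dvd p2 \<and> 2*m dvd p3 \<and> 2*m dvd p1-p0-p2"

fun nearer_two :: "int \<times> int \<times> int \<times> int \<Rightarrow> bool" where
  "nearer_two (p0,p1,p2,p3) \<longleftrightarrow> 2 dvd p2 \<and> 4 dvd p1-p0 \<and> 4 dvd p2-p3"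

text \<open>Terms quadratic in the deviations gain the extra factor 2 only from modulus 4 on; this
  is why modulus 2 is treated apart.\<close>

lemma sqrt2_Phi_near_odd:
  assumes near: "near_odd (4*n) (p0,p1,p2,p3)" and p: "odd p0" and r: "sqrt2_Phi (p0,p1,p2,p3) = r"
  shows "nearer_odd (4*n) (vec_conj r)"
proof -
  obtain r0 r1 r2 r3 where r': "r = (r0,r1,r2,r3)" by (cases r)
  from near obtain x y w where "p1 - p0 = 4*n*x" "p2 = 4*n*y" "p3 = 4*n*w" unfolding near_odd.simps by (elim conjE dvdE)
  hence e: "p1 = p0+2*(2*n*x)" "p2 = 2*(2*n*y)" "p3 = 2*(2*n*w)" by simp_all
  note R = sqrt2_Phi_pos[OF p r[unfolded r' e]]
  have "r1 = 2*(4*n)*(- 2*n*w*x + 2*n*w*y - n*w^2 - 2*n*x*y + n*x^2 - n*y^2 - p0*w)"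
    "r2 = 4*n*(4*n*w*y - 4*n*w^2 - 4*n*x*y + 4*n*x^2 - p0*w + p0*x + p0*y)"
    "r0+r3-r2 = 2*(4*n)*(2*n*w*x - 2*n*w*y + n*w^2 - 2*n*x*y - n*x^2 + n*y^2 - p0*y)"
    unfolding R by (simp_all add: algebra_simps power2_eq_square)
  hence "2*(4*n) dvd r1" "4*n dvd r2" "2*(4*n) dvd r0+r3-r2" by (metis dvd_triv_left)+
  moreover have "-r3-r0- -r2 = -(r0+r3-r2)" by simp
  ultimately show ?thesis unfolding r' vec_conj.simps nearer_odd.simps by (simp only: dvd_minus_iff)
qed

lemma sqrt2_Phi_nearer_odd:
  assumes near: "nearer_odd (4*n) (p0,p1,p2,p3)" and p: "odd p0" and r: "sqrt2_Phi (p0,p1,p2,p3) = r"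
  shows "near_odd (2*(4*n)) (vec_conj r)"
proof -
  obtain r0 r1 r2 r3 where r': "r = (r0,r1,r2,r3)" by (cases r)
  from near obtain y w z where "p2 = 4*n*y" "p3 = 2*(4*n)*w" "p1-p0-p2 = 2*(4*n)*z" unfolding nearer_odd.simps by (elim conjE dvdE)
  hence e: "p1 = p0+2*(2*n*(y+2*z))" "p2 = 2*(2*n*y)" "p3 = 2*(4*n*w)" by (simp_all add: algebra_simps)
  note R = sqrt2_Phi_pos[OF p r[unfolded r' e]]
  have "r1 = 2*(4*n)*(- 8*n*w*z - 4*n*w^2 - 2*n*y^2 + 4*n*z^2 - 2*p0*w)"
    "r2 = 2*(4*n)*(4*n*w*y - 8*n*w^2 + 4*n*y*z + 8*n*z^2 - p0*w + p0*y + p0*z)"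
    "r0+r3 = 2*(4*n)*(4*n*w*y + 8*n*w*z - 4*n*w^2 - 4*n*y*z - 2*n*y^2 + 4*n*z^2 - p0*w + p0*z)"
    unfolding R by (simp_all add: algebra_simps power2_eq_square)
  hence "2*(4*n) dvd r1" "2*(4*n) dvd r2" "2*(4*n) dvd r0+r3" by (metis dvd_triv_left)+
  moreover have "-r3-r0 = -(r0+r3)" by simp
  ultimately show ?thesis unfolding r' vec_conj.simps near_odd.simps by (simp only: dvd_minus_iff)
qed

lemma sqrt2_Phi_near_two:
  assumes near: "near_odd 2 (p0,p1,p2,p3)" and p: "odd p0" and r: "sqrt2_Phi (p0,p1,p2,p3) = r"
  shows "nearer_two (vec_conj r)"
proof -
  obtain r0 r1 r2 r3 where r': "r = (r0,r1,r2,r3)" by (cases r)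
  from near obtain x y w where "p1 - p0 = 2*x" "p2 = 2*y" "p3 = 2*w" unfolding near_odd.simps by (elim conjE dvdE)
  hence e: "p1 = p0+2*x" "p2 = 2*y" "p3 = 2*w" by simp_all
  note R = sqrt2_Phi_pos[OF p r[unfolded r' e]]
  have "r1-r2 = 2*(- p0*w - p0*x - p0*y - 2*w*x + w^2 - x^2 - y^2)"
    "r0+r3 = 2*(- p0*w + p0*x - p0*y + 2*w*x - w^2 - 4*x*y + x^2 + y^2)"
    "r2 = 2*(- p0*w + p0*x + p0*y + 2*w*y - 2*w^2 - 2*x*y + 2*x^2)"
    unfolding R by (simp_all add: algebra_simps power2_eq_square)
  moreover have "even (- p0*w - p0*x - p0*y - 2*w*x + w^2 - x^2 - y^2)"
    "even (- p0*w + p0*x - p0*y + 2*w*x - w^2 - 4*x*y + x^2 + y^2)" using p by auto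
  ultimately have "2*2 dvd r1-r2" "2*2 dvd r0+r3" "2 dvd r2" by (metis mult_dvd_mono dvd_refl dvd_triv_left)+
  thus ?thesis unfolding r' vec_conj.simps nearer_two.simps by presburger
qed

lemma sqrt2_Phi_nearer_two:
  assumes near: "nearer_two (p0,p1,p2,p3)" and p: "odd p0" and r: "sqrt2_Phi (p0,p1,p2,p3) = r"
  shows "near_odd (2^2) (vec_conj r)"
proof -
  obtain r0 r1 r2 r3 where r': "r = (r0,r1,r2,r3)" by (cases r)
  from near obtain y x z where yxz: "p2 = 2*y" "p1-p0 = 4*x" "p2-p3 = 4*z" unfolding nearer_two.simps by (elim conjE dvdE)
  define w where "w = y - 2*z"
  have e: "p1 = p0 + 2*(2*x)" "p2 = 2*(w+2*z)" "p3 = 2*w" using yxz unfolding w_def by simp_all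
  note R = sqrt2_Phi_pos[OF p r[unfolded r' e]]
  have "r1 = 4*(- p0*w - 4*w*x - 4*x*z + 2*x^2 - 2*z^2)"
    "r2 = 4*(p0*x + p0*z - 2*w*x + 2*w*z - 4*x*z + 4*x^2)"
    "r0+r3 = 4*(- p0*w + p0*x - p0*z - 2*w*x + 2*w*z - 8*x*z + 2*x^2 + 2*z^2)"
    unfolding R by (simp_all add: algebra_simps power2_eq_square)
  hence "4 dvd r1" "4 dvd r2" "4 dvd r0+r3" by (metis dvd_triv_left)+
  thus ?thesis unfolding r' vec_conj.simps near_odd.simps by simp presburger
qed

lemma odd_dvd_cancel_linear:
  assumes "int_proportional (p0,p1,p2,p3) (q0,q1,q2,q3)" and "(2::int)^k dvd c0*q0+c1*q1+c2*q2+c3*q3"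
  shows "2^k dvd c0*p0+c1*p1+c2*p2+c3*p3"
proof -
  obtain x y where xy: "odd y" "y*p0 = x*q0" "y*p1 = x*q1" "y*p2 = x*q2" "y*p3 = x*q3" using assms(1) by auto
  have "y*(c0*p0+c1*p1+c2*p2+c3*p3) = c0*(y*p0)+c1*(y*p1)+c2*(y*p2)+c3*(y*p3)" by (simp add: algebra_simps)
  also have "\<dots> = x*(c0*q0+c1*q1+c2*q2+c3*q3)" unfolding xy by (simp add: algebra_simps)
  finally show ?thesis by (rule odd_dvd_cancel[OF xy(1) assms(2)])
qed

lemma near_odd_proportional:
  assumes "int_proportional (p0,p1,p2,p3) (q0,q1,q2,q3)"
  shows "near_odd (2^k) (q0,q1,q2,q3) \<Longrightarrow> near_odd (2^k) (p0,p1,p2,p3)"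
    and "nearer_odd (2^k) (q0,q1,q2,q3) \<Longrightarrow> nearer_odd (2^k) (p0,p1,p2,p3)"
    and "nearer_two (q0,q1,q2,q3) \<Longrightarrow> nearer_two (p0,p1,p2,p3)"
proof -
  note l = odd_dvd_cancel_linear[OF assms]
  have l: "2^j dvd q2 \<Longrightarrow> 2^j dvd p2" "2^j dvd q3 \<Longrightarrow> 2^j dvd p3" "2^j dvd q1-q0 \<Longrightarrow> 2^j dvd p1-p0"
    "2^j dvd q1-q0-q2 \<Longrightarrow> 2^j dvd p1-p0-p2" "2^j dvd q2-q3 \<Longrightarrow> 2^j dvd p2-p3" for j
    using l[of j 0 0 1 0] l[of j 0 0 0 1] l[of j "-1" 1 0 0] l[of j "-1" 1 "-1" 0] l[of j 0 0 1 "-1"]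
    by (simp_all add: algebra_simps)
  show "near_odd (2^k) (q0,q1,q2,q3) \<Longrightarrow> near_odd (2^k) (p0,p1,p2,p3)" using l[of k] by auto
  show "nearer_odd (2^k) (q0,q1,q2,q3) \<Longrightarrow> nearer_odd (2^k) (p0,p1,p2,p3)" using l[of k] l[of "Suc k"] by auto
  show "nearer_two (q0,q1,q2,q3) \<Longrightarrow> nearer_two (p0,p1,p2,p3)" using l[of 1] l[of 2] by auto
qed

text \<open>The last condition chooses between \<open>p\<close> and its multiple by
  \<open>i\<close>.\<close>

definition good_odd :: "int \<times> int \<times> int \<times> int \<Rightarrow> bool" where
  "good_odd p \<longleftrightarrow> good p \<and> \<not> mixed_parity p \<and> odd (fst p)"

lemma good_odd_step:
  assumes "good_odd (p0,p1,p2,p3)"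
  obtains q0 q1 q2 q3 r0 r1 r2 r3 where "good_odd (q0,q1,q2,q3)" "sqrt2_Phi (q0,q1,q2,q3) = (r0,r1,r2,r3)"
    "int_proportional (p0,p1,p2,p3) (r0,r1,r2,r3)"
proof -
  have p: "good (p0,p1,p2,p3)" "\<not> mixed_parity (p0,p1,p2,p3)" "odd p0" using assms unfolding good_odd_def by auto
  from p(1) show ?thesis
  proof (cases rule: good_step)
    case mixed thus ?thesis using p(2) by blast
  next
    case (odd q0 q1 q2 q3 r0 r1 r2 r3)
    have "good_odd (q0,q1,q2,q3)" using odd unfolding good_odd_def by auto
    moreover have "even r2" by (rule sqrt2_Phi_parity[OF odd(2-4,6)])
    hence "int_proportional (p0,p1,p2,p3) (r0,r1,r2,r3)"
      using odd(7) p(3) by (auto dest!: int_proportional_parity simp del: int_proportional.simps)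
    ultimately show ?thesis by (rule that[OF _ odd(6)])
  qed
qed

text \<open>Each such vector is an image of another one, so a congruence valid for all of them, up
  to conjugation, can be pushed forward and improved.\<close>

lemma good_odd_transfer:
  assumes A: "\<And>q. good_odd q \<Longrightarrow> A q \<or> A (vec_conj q)" and p: "good_odd p"
    and AB: "\<And>p0 p1 p2 p3 r. A (p0,p1,p2,p3) \<Longrightarrow> odd p0 \<Longrightarrow> sqrt2_Phi (p0,p1,p2,p3) = r \<Longrightarrow> B (vec_conj r)"
    and B: "\<And>p0 p1 p2 p3 q0 q1 q2 q3. int_proportional (p0,p1,p2,p3) (q0,q1,q2,q3) \<Longrightarrow> B (q0,q1,q2,q3) \<Longrightarrow> B (p0,p1,p2,p3)"
  shows "B p \<or> B (vec_conj p)"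
proof -
  obtain p0 p1 p2 p3 where pp: "p = (p0,p1,p2,p3)" by (cases p)
  obtain q0 q1 q2 q3 r0 r1 r2 r3 where q: "good_odd (q0,q1,q2,q3)" "sqrt2_Phi (q0,q1,q2,q3) = (r0,r1,r2,r3)"
    "int_proportional (p0,p1,p2,p3) (r0,r1,r2,r3)" by (rule good_odd_step[OF p[unfolded pp]])
  have q': "odd q0" "even q2" "odd (q1+q3)" using q(1) unfolding good_odd_def good_def by auto
  have "B (vec_conj (r0,r1,r2,r3)) \<or> B (r0,r1,r2,r3)"
    using A[OF q(1)]
  proof
    assume "A (q0,q1,q2,q3)"
    thus ?thesis using AB[OF _ q'(1) q(2)] by blast
  next
    assume "A (vec_conj (q0,q1,q2,q3))"
    thus ?thesis using AB[OF _ q'(1), of "-q3" "-q2" "-q1"] sqrt2_Phi_conj[OF q'] q(2) by simp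
  qed
  moreover have "int_proportional (p0,-p3,-p2,-p1) (r0,-r3,-r2,-r1)" using q(3) by auto
  ultimately show ?thesis unfolding pp vec_conj.simps using B q(3) by blast
qed

lemma good_odd_near:
  assumes "good_odd p"
  shows "near_odd (2^Suc k) p \<or> near_odd (2^Suc k) (vec_conj p)"
  using assms
proof (induction k arbitrary: p)
  case 0
  obtain p0 p1 p2 p3 where p: "p = (p0,p1,p2,p3)" by (cases p)
  have "primitive_vec p" "odd p0" "\<not> mixed_parity p" using 0 unfolding good_odd_def good_def p by auto
  thus ?case unfolding p by auto
next
  case (Suc k)
  note IH = Suc.IH and prems = Suc.prems
  show ?case
  proof (cases k)
    case 0
    have IH2: "near_odd 2 q \<or> near_odd 2 (vec_conj q)" if "good_odd q" for q using IH[OF that] unfolding 0 by simp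
    have nt: "nearer_two q \<or> nearer_two (vec_conj q)" if "good_odd q" for q
      by (rule good_odd_transfer[where A = "near_odd 2" and B = nearer_two,
            OF IH2 that sqrt2_Phi_near_two near_odd_proportional(3)])
    have "near_odd (2^2) p \<or> near_odd (2^2) (vec_conj p)"
      by (rule good_odd_transfer[where A = nearer_two and B = "near_odd (2^2)",
            OF nt prems sqrt2_Phi_nearer_two near_odd_proportional(1)])
    thus ?thesis unfolding 0 by (simp add: numeral_eq_Suc)
  next
    case (Suc j)
    have e: "2^Suc k = 4*(2::int)^j" unfolding Suc by simp
    have nt: "nearer_odd (2^Suc k) q \<or> nearer_odd (2^Suc k) (vec_conj q)" if "good_odd q" for q
      by (rule good_odd_transfer[where A = "near_odd (2^Suc k)" and B = "nearer_odd (2^Suc k)",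
            OF IH that sqrt2_Phi_near_odd[of "2^j", folded e] near_odd_proportional(2)])
    show ?thesis
      by (rule good_odd_transfer[where A = "nearer_odd (2^Suc k)" and B = "near_odd (2^Suc (Suc k))",
            OF nt prems sqrt2_Phi_nearer_odd[of "2^j", folded e, folded power_Suc] near_odd_proportional(1)])
  qed
qed

lemma good_odd_wsim:
  assumes "good_odd p"
  shows "wsim (vec_of_int p) (1,1,0,0) \<or> wsim (vec_of_int p) (0,1,1,0)"
proof -
  obtain p0 p1 p2 p3 where p: "p = (p0,p1,p2,p3)" by (cases p)
  define n where "n = \<bar>p0\<bar> + \<bar>p1\<bar> + \<bar>p2\<bar> + \<bar>p3\<bar>"
  have "near_odd (2^Suc (nat n)) p \<or> near_odd (2^Suc (nat n)) (vec_conj p)" by (rule good_odd_near[OF assms])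
  hence near: "near_odd (2^nat n) p \<or> near_odd (2^nat n) (vec_conj p)" unfolding p by (auto dest: dvd_mult_right)
  hence *: "(p1 = p0 \<and> p2 = 0 \<and> p3 = 0) \<or> (p1 = 0 \<and> p2 = 0 \<and> p3 = -p0)"
  proof -
    have s: "2^nat n dvd m \<Longrightarrow> \<bar>m\<bar> \<le> n \<Longrightarrow> m = 0" for m by (rule pow2_dvd_small)
    have "\<bar>p1-p0\<bar> \<le> n" "\<bar>-p1\<bar> \<le> n" "\<bar>p2\<bar> \<le> n" "\<bar>-p2\<bar> \<le> n" "\<bar>p3\<bar> \<le> n" "\<bar>-p3-p0\<bar> \<le> n" unfolding n_def by linarith+
    hence "(p1-p0 = 0 \<and> p2 = 0 \<and> p3 = 0) \<or> (-p3-p0 = 0 \<and> -p2 = 0 \<and> -p1 = 0)"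
      using near s unfolding p vec_conj.simps near_odd.simps by blast
    thus ?thesis by auto
  qed
  have "p0 \<noteq> 0" using assms unfolding good_odd_def p by auto
  hence "W_multiple (of_int p0) (vec_of_int p) (1,1,0,0) \<or> W_multiple (-of_int p0) (vec_of_int p) (0,1,1,0)"
    using * unfolding p by (auto simp: W_multiple_def)
  thus ?thesis using W_multiple_wsim by blast
qed

lemma xi_wsim:
  assumes D: "mumford a b v1 v0"
  shows "wsim (xi a b v1) (1,0,0,0) \<or> wsim (xi a b v1) (1,1,0,0) \<or> wsim (xi a b v1) (0,1,1,0)"
proof -
  have "xi a b v1 \<noteq> (0,0,0,0)" by (simp add: xi_def)
  then obtain p where p: "primitive_vec p" "wsim (xi a b v1) (vec_of_int p)" by (rule exists_primitive)
  have g: "good p" unfolding good_def using p(1) D wsim_sym[OF p(2)] by blast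
  obtain p0 p1 p2 p3 where pp: "p = (p0,p1,p2,p3)" by (cases p)
  have "wsim (vec_of_int p) (1,0,0,0) \<or> wsim (vec_of_int p) (1,1,0,0) \<or> wsim (vec_of_int p) (0,1,1,0)"
  proof (cases "mixed_parity p")
    case True
    thus ?thesis using good_mixed[OF g] by blast
  next
    case False
    show ?thesis
    proof (cases "odd p0")
      case True
      hence "good_odd p" unfolding good_odd_def using g False pp by simp
      thus ?thesis using good_odd_wsim by blast
    next
      case even: False
      have "odd (-p2)" "\<not> mixed_parity (-p2,-p3,p0,p1)" using p(1) False even unfolding pp by auto
      hence "good_odd (-p2,-p3,p0,p1)" unfolding good_odd_def using good_mul_i[OF g[unfolded pp]] by simp
      hence "wsim (vec_of_int (-p2,-p3,p0,p1)) (1,1,0,0) \<or> wsim (vec_of_int (-p2,-p3,p0,p1)) (0,1,1,0)"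
        by (rule good_odd_wsim)
      moreover have "wsim (vec_of_int p) (vec_of_int (-p2,-p3,p0,p1))"
        using wsim.mul_i[OF wsim.refl, of "vec_of_int p"] unfolding pp by simp
      ultimately show ?thesis using wsim_trans by blast
    qed
  qed
  thus ?thesis using wsim_trans[OF _ p(2)] by blast
qed

text \<open>The entry 2 of \<open>xi\<close> fixes the scalar in each of the twelve cases. All but
  two are impossible or give a quadratic vanishing at 0, 1 or -1.\<close>

theorem irreducible_mumford:
  assumes D: "mumford a b v1 v0" and irr: "\<And>x. x^2 + a*x + b \<noteq> 0"
  shows "(a = 0 \<and> b = 1) \<or> (a = 2 \<and> b = -1)"
proof -
  have 0: "b \<noteq> 0" "1 + a + b \<noteq> 0" "1 - a + b \<noteq> 0" using irr[of 0] irr[of 1] irr[of "-1"] by auto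
  consider c where "W_multiple c (xi a b v1) (1,0,0,0)" | c where "W_multiple c (xi a b v1) (1,1,0,0)"
    | c where "W_multiple c (xi a b v1) (0,1,1,0)"
    using xi_wsim[OF D] wsim_W_multiple by metis
  thus ?thesis
  proof cases
    case 1
    thus ?thesis using 0 unfolding W_multiple_def xi_def by auto
  next
    case 2
    thus ?thesis using 0 unfolding W_multiple_def xi_def by auto
  next
    case 3
    thus ?thesis using 0 unfolding W_multiple_def xi_def by auto
  qed
qed

section \<open>Points over a quadratic field\<close>

locale quadratic_subfield =
  fixes K :: "complex set" and d :: int and \<delta> :: complex
  assumes nonsquare: "\<nexists>m::int. d = m^2" and K: "K = {of_rat p + of_rat q * \<delta> | p q. True}" and \<delta>: "\<delta>^2 = of_int d"
begin

lemma not_rational: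
  assumes "q \<noteq> 0"
  shows "of_rat p + of_rat q * \<delta> \<notin> \<rat>"
proof
  assume "of_rat p + of_rat q * \<delta> \<in> \<rat>"
  then obtain r where "of_rat p + of_rat q * \<delta> = of_rat r" by (elim Rats_cases)
  hence "of_rat q * \<delta> = of_rat (r - p)" by (simp add: of_rat_diff algebra_simps)
  hence "\<delta> = of_rat ((r-p)/q)" using assms by (simp add: of_rat_divide field_simps)
  hence "of_rat (((r-p)/q)^2) = (of_rat (of_int d) :: complex)" using \<delta> by (simp add: of_rat_power)
  hence *: "((r-p)/q)^2 = of_int d" by (simp only: of_rat_eq_iff)
  then obtain m where "(r-p)/q = of_int m" by (rule rat_square_int)
  hence "of_int (m^2) = (of_int d :: rat)" using * by simp
  hence "d = m^2" by (simp only: of_int_eq_iff)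
  thus False using nonsquare by blast
qed

lemma Rats_subset: "x \<in> \<rat> \<Longrightarrow> x \<in> K"
proof -
  assume "x \<in> \<rat>"
  then obtain r where "x = of_rat r" by (elim Rats_cases)
  hence "x = of_rat r + of_rat 0 * \<delta>" by simp
  thus ?thesis unfolding K by blast
qed

lemma add: "x \<in> K \<Longrightarrow> y \<in> K \<Longrightarrow> x + y \<in> K"
proof -
  assume "x \<in> K" "y \<in> K"
  then obtain p q r s where "x = of_rat p + of_rat q * \<delta>" "y = of_rat r + of_rat s * \<delta>" unfolding K by blast
  hence "x + y = of_rat (p+r) + of_rat (q+s) * \<delta>" by (simp add: of_rat_add algebra_simps)
  thus ?thesis unfolding K by blast
qed

lemma mult: "x \<in> K \<Longrightarrow> y \<in> K \<Longrightarrow> x * y \<in> K"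
proof -
  assume "x \<in> K" "y \<in> K"
  then obtain p q r s where "x = of_rat p + of_rat q * \<delta>" "y = of_rat r + of_rat s * \<delta>" unfolding K by blast
  hence "x * y = of_rat p * of_rat r + of_rat q * of_rat s * \<delta>^2 + (of_rat p * of_rat s + of_rat q * of_rat r) * \<delta>"
    by (simp add: algebra_simps power2_eq_square)
  also have "\<dots> = of_rat (p*r + q*s*of_int d) + of_rat (p*s + q*r) * \<delta>" unfolding \<delta> by (simp add: of_rat_add of_rat_mult)
  finally show ?thesis unfolding K by blast
qed

lemma inverse: "x \<in> K \<Longrightarrow> inverse x \<in> K"
proof -
  assume "x \<in> K"
  then obtain p q where x: "x = of_rat p + of_rat q * \<delta>" unfolding K by blast
  show ?thesis
  proof (cases "q = 0")
    case True
    hence "x \<in> \<rat>" using x by simp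
    thus ?thesis by (intro Rats_subset) simp
  next
    case False
    define N where "N = p^2 - q^2 * of_int d"
    have "x * (of_rat p - of_rat q * \<delta>) = of_rat p^2 - of_rat q^2 * \<delta>^2"
      unfolding x by (simp add: algebra_simps power2_eq_square)
    also have "\<dots> = of_rat N" unfolding \<delta> N_def by (simp add: of_rat_diff of_rat_mult of_rat_power)
    finally have N: "x * (of_rat p - of_rat q * \<delta>) = of_rat N" .
    have "x \<notin> \<rat>" unfolding x by (rule not_rational[OF False])
    moreover have "of_rat p + of_rat (-q) * \<delta> \<notin> \<rat>" by (rule not_rational) (use False in simp)
    ultimately have "x \<noteq> 0" "of_rat p - of_rat q * \<delta> \<noteq> 0" by (auto simp: of_rat_minus)
    hence N0: "of_rat N \<noteq> (0::complex)" using N by (metis mult_eq_0_iff)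
    have "inverse x = (of_rat p - of_rat q * \<delta>) / of_rat N" unfolding N[symmetric] using \<open>x \<noteq> 0\<close> \<open>of_rat p - of_rat q * \<delta> \<noteq> 0\<close> by (simp add: field_simps)
    also have "\<dots> = of_rat (p/N) + of_rat (-q/N) * \<delta>" by (simp add: of_rat_divide of_rat_minus diff_divide_distrib)
    finally show ?thesis unfolding K by blast
  qed
qed

lemma minus: "x \<in> K \<Longrightarrow> - x \<in> K"
  using mult[OF Rats_subset[of "-1"], of x] by simp

lemma diff: "x \<in> K \<Longrightarrow> y \<in> K \<Longrightarrow> x - y \<in> K"
  using add[OF _ minus, of x y] by simp

lemma divide: "x \<in> K \<Longrightarrow> y \<in> K \<Longrightarrow> x / y \<in> K"
  unfolding divide_inverse by (intro mult inverse)

lemma power: "x \<in> K \<Longrightarrow> x ^ n \<in> K"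
  by (induction n) (auto intro: mult Rats_subset)

lemma numeral: "numeral n \<in> K"
  by (intro Rats_subset) simp

lemma one: "1 \<in> K"
  by (intro Rats_subset) simp

lemmas closed = add diff minus mult divide power numeral one

text \<open>Take the minimal polynomial of \<open>x\<close> and the line through the point and its
  conjugate. The remainder \<open>L1 x + L0\<close> is rational and vanishes at the irrational
  \<open>x\<close>, so it is zero.\<close>

lemma curve_points:
  assumes x: "x \<in> K" and y: "y \<in> K" and irr: "x \<notin> \<rat>" and eq: "y^2 = x^5 + 2*x^4 + 2*x^2 - x"
  shows "x^2 + 1 = 0 \<or> x^2 + 2*x - 1 = 0"
proof -
  obtain p q where x: "x = of_rat p + of_rat q * \<delta>" using x unfolding K by blast
  obtain r s where y: "y = of_rat r + of_rat s * \<delta>" using y unfolding K by blast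
  have q: "q \<noteq> 0"
  proof
    assume "q = 0"
    thus False using irr unfolding x by simp
  qed
  define a b v1 v0 w where "a = -2*p" and "b = p^2 - q^2 * of_int d" and "v1 = s/q" and "v0 = r - p*s/q"
    and w: "w = 2 - v1^2 - a*(a^2-2*a-b) - b*(2-a)"
  define L1 L0 where L1: "L1 = b*(a^2-2*a-b) + a*w + 1 + 2*v1*v0" and L0: "L0 = v0^2 + b*w"
  define a' b' v1' v0' w' :: complex where "a' = of_rat a" and "b' = of_rat b" and "v1' = of_rat v1" and "v0' = of_rat v0" and w'': "w' = of_rat w"
  have qd: "of_rat q * \<delta> = x - of_rat p" unfolding x by simp
  have "(x - of_rat p)^2 = of_rat q^2 * of_int d" unfolding qd[symmetric] power_mult_distrib \<delta> ..
  hence u: "x^2 + a'*x + b' = 0" unfolding a'_def b'_def a_def b_def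
    by (simp add: of_rat_diff of_rat_mult of_rat_power of_rat_minus power2_eq_square algebra_simps)
  have "v1'*x + v0' = of_rat r + of_rat (s/q) * (x - of_rat p)" unfolding v1'_def v0'_def v1_def v0_def
    by (simp add: of_rat_diff of_rat_mult of_rat_divide diff_divide_distrib algebra_simps)
  also have "\<dots> = y" unfolding y qd[symmetric] using q by (simp add: of_rat_divide)
  finally have yv: "y = v1'*x + v0'" ..
  have w': "w' = 2 - v1'^2 - a'*(a'^2-2*a'-b') - b'*(2-a')" unfolding w'' w a'_def b'_def v1'_def v0'_def
    by (simp add: of_rat_diff of_rat_mult of_rat_power of_rat_add)
  have eq': "x^5 + 2*x^4 + 2*x^2 - x - (v1'*x+v0')^2 = 0" using eq unfolding yv by simp
  have "(b'*(a'^2-2*a'-b') + a'*w' + 1 + 2*v1'*v0')*x + (v0'^2 + b'*w') =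
    (x^2+a'*x+b')*(x^3+(2-a')*x^2+(a'^2-2*a'-b')*x+w') - (x^5 + 2*x^4 + 2*x^2 - x - (v1'*x+v0')^2)"
    unfolding w' by Groebner_Basis.algebra
  hence "(b'*(a'^2-2*a'-b') + a'*w' + 1 + 2*v1'*v0')*x + (v0'^2 + b'*w') = 0" unfolding u eq' by simp
  hence lin: "of_rat L1 * x + of_rat L0 = 0" unfolding L1 L0 a'_def b'_def v1'_def v0'_def w''
    by (simp add: of_rat_diff of_rat_mult of_rat_power of_rat_add)
  have "L1 = 0"
  proof (rule ccontr)
    assume "L1 \<noteq> 0"
    hence "x = of_rat (-L0/L1)" using lin by (simp add: of_rat_divide of_rat_minus field_simps add_eq_0_iff2)
    thus False using irr by simp
  qed
  moreover from this have "L0 = 0" using lin by simp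
  ultimately have M: "mumford a b v1 v0" unfolding mumford_def L1 L0 w by simp
  have "z^2 + a*z + b \<noteq> 0" for z
  proof
    assume "z^2 + a*z + b = 0"
    hence "of_rat (z^2 + a*z + b) = (0::complex)" by simp
    hence "(of_rat z)^2 + a'*of_rat z + b' = 0" unfolding a'_def b'_def by (simp add: of_rat_mult of_rat_power of_rat_add)
    moreover have "(x - of_rat z)*(x + of_rat z + a') = (x^2 + a'*x + b') - ((of_rat z)^2 + a'*of_rat z + b')"
      by (simp add: algebra_simps power2_eq_square)
    ultimately have "(x - of_rat z)*(x + of_rat z + a') = 0" unfolding u by simp
    hence "x - of_rat z = 0 \<or> x + of_rat z + a' = 0" by (simp only: mult_eq_0_iff)
    moreover have "x = (x + of_rat z + a') + of_rat (- z - a)" unfolding a'_def by (simp add: of_rat_diff of_rat_minus)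
    ultimately have "x = of_rat z \<or> x = of_rat (- z - a)" by (metis add_0 right_minus_eq)
    thus False using irr by auto
  qed
  hence "(a = 0 \<and> b = 1) \<or> (a = 2 \<and> b = -1)" by (rule irreducible_mumford[OF M])
  thus ?thesis using u unfolding a'_def b'_def by auto
qed

end

lemma quadratic_field_subfield:
  assumes "quadratic_field K"
  obtains d \<delta> where "quadratic_subfield K d \<delta>"
proof -
  obtain d :: int where "\<nexists>m::int. d = m^2" "K = {of_rat p + of_rat q * csqrt (of_int d) | p q. True}"
    using assms unfolding quadratic_field_def by blast
  hence "quadratic_subfield K d (csqrt (of_int d))" by unfold_locales auto
  thus ?thesis by (rule that)
qed

section \<open>Points of order sixteen\<close>

lemma wadd_double_cases:
  assumes "wadd (Weier a1 a2 a3 a4 a6) (Some (x,y)) (Some (x,y)) = Q"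
  shows "2*y + a1*x + a3 = 0 \<and> Q = None \<or>
    2*y + a1*x + a3 \<noteq> 0 \<and> (\<exists>x' y'. Q = Some (x',y') \<and>
      (let l = (3*x^2 + 2*a2*x + a4 - a1*y) / (2*y + a1*x + a3) in x' = l^2 + a1*l - a2 - 2*x))"
proof -
  have e: "y + y + a1*x + a3 = 2*y + a1*x + a3" "z - x - x = z - 2*x" for z by simp_all
  show ?thesis using assms unfolding wadd.simps e by (auto simp: Let_def split: if_splits)
qed

text \<open>The equation becomes \<open>Y^2 = X (X^2 + A X + B)\<close> in the coordinates \<open>X = x - x0\<close> and
  \<open>Y = y + (a1 x + a3) / 2\<close>, where \<open>x0\<close> belongs to a point of order two.\<close>

locale two_torsion =
  fixes a1 a2 a3 a4 a6 x0 y0 :: complex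
  assumes on_curve0: "wpoly (Weier a1 a2 a3 a4 a6) x0 y0 = 0" and torsion: "2*y0 + a1*x0 + a3 = 0"
begin

definition A where "A = 3*x0 + a2 + a1^2/4"
definition B where "B = 3*x0^2 + (a1^2/2 + 2*a2)*x0 + a4 + a1*a3/2"
definition X where "X x = x - x0"
definition Y where "Y x y = y + (a1*x + a3)/2"

lemma a3: "a3 = - 2*y0 - a1*x0"
proof -
  have "a3 = (2*y0 + a1*x0 + a3) - 2*y0 - a1*x0" by simp
  thus ?thesis unfolding torsion by simp
qed

lemma a6: "a6 = y0^2 + a1*x0*y0 + a3*y0 - x0^3 - a2*x0^2 - a4*x0"
  using on_curve0 by (simp add: algebra_simps)

lemma wpoly_XY: "wpoly (Weier a1 a2 a3 a4 a6) x y = (Y x y)^2 - X x^3 - A*X x^2 - B*X x"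
  unfolding wpoly.simps a6 X_def Y_def A_def B_def unfolding a3 by (simp add: field_simps power2_eq_square power3_eq_cube)

lemma wdisc_AB: "wdisc (Weier a1 a2 a3 a4 a6) = 16*B^2*(A^2-4*B)"
proof -
  define h where "h = a1/2"
  have a1: "a1 = 2*h" by (simp add: h_def)
  have A: "A = 3*x0 + a2 + h^2" unfolding A_def unfolding a1 by (simp add: power2_eq_square)
  have B: "B = 3*x0^2 + (2*h^2 + 2*a2)*x0 + a4 - 2*h*(y0+h*x0)" unfolding B_def unfolding a3 unfolding a1 by (simp add: power2_eq_square field_simps)
  show ?thesis unfolding wdisc.simps Let_def a6 A B unfolding a3 unfolding a1 by Groebner_Basis.algebra
qed

text \<open>The duplication formula; that a double has square abscissa is the source of the
  \<open>K\<close>-rational roots \<open>e\<close> and \<open>h\<close> later.\<close>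

lemma double_X:
  assumes P: "wpoly (Weier a1 a2 a3 a4 a6) x y = 0" and Y0: "Y x y \<noteq> 0"
    and l: "l = (3*x^2 + 2*a2*x + a4 - a1*y) / (2*y + a1*x + a3)" and x': "x' = l^2 + a1*l - a2 - 2*x"
  shows "X x' = ((X x^2 - B)/(2*Y x y))^2"
proof -
  have e: "2*y + a1*x + a3 = 2*Y x y" by (simp add: Y_def)
  have "(l + a1/2)*(2*Y x y) = 3*x^2 + 2*a2*x + a4 - a1*y + a1*Y x y" using Y0 unfolding l e by (simp add: field_simps)
  also have "\<dots> = 3*X x^2 + 2*A*X x + B" unfolding X_def A_def B_def Y_def by (simp add: field_simps power2_eq_square)
  finally have l': "(l + a1/2)*(2*Y x y) = 3*X x^2 + 2*A*X x + B" .
  have X': "X x' = (l + a1/2)^2 - A - 2*X x" unfolding x' X_def A_def by (simp add: field_simps power2_eq_square)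
  have "X x' * (2*Y x y)^2 = ((l + a1/2)*(2*Y x y))^2 - 4*(A + 2*X x)*(Y x y)^2" unfolding X'
  proof -
    define m where "m = l + a1/2"
    have "(m^2 - A - 2*X x)*(2*Y x y)^2 = (m*(2*Y x y))^2 - 4*(A + 2*X x)*(Y x y)^2" by Groebner_Basis.algebra
    thus "((l + a1/2)^2 - A - 2*X x)*(2*Y x y)^2 = ((l + a1/2)*(2*Y x y))^2 - 4*(A + 2*X x)*(Y x y)^2"
      unfolding m_def .
  qed
  also have "(Y x y)^2 = X x^3 + A*X x^2 + B*X x" using P unfolding wpoly_XY by (simp add: algebra_simps)
  also have "((l + a1/2)*(2*Y x y))^2 - 4*(A + 2*X x)*(X x^3 + A*X x^2 + B*X x) = (X x^2 - B)^2"
    unfolding l' by Groebner_Basis.algebra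
  finally show ?thesis using Y0 by (simp add: power_divide field_simps)
qed

end

lemma exists_order_16:
  assumes H: "subgroup H G" and iso: "G\<lparr>carrier := H\<rparr> \<cong> integer_mod_group 16" and one: "\<one>\<^bsub>G\<^esub> \<otimes>\<^bsub>G\<^esub> \<one>\<^bsub>G\<^esub> = \<one>\<^bsub>G\<^esub>"
  obtains P1 P2 P3 P4 where "P1 \<in> carrier G" "P2 \<in> carrier G" "P3 \<in> carrier G" "P4 \<in> carrier G"
    "P1 \<otimes>\<^bsub>G\<^esub> P1 = P2" "P2 \<otimes>\<^bsub>G\<^esub> P2 = P3" "P3 \<otimes>\<^bsub>G\<^esub> P3 = P4" "P4 \<otimes>\<^bsub>G\<^esub> P4 = \<one>\<^bsub>G\<^esub>" "P4 \<noteq> \<one>\<^bsub>G\<^esub>"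
proof -
  obtain f where f: "f \<in> Group.iso (G\<lparr>carrier := H\<rparr>) (integer_mod_group 16)" using iso unfolding is_iso_def by blast
  have hom: "f (x \<otimes>\<^bsub>G\<^esub> y) = (f x + f y) mod 16" if "x \<in> H" "y \<in> H" for x y
    using f that unfolding Group.iso_def hom_def by (auto simp: mult_integer_mod_group)
  have inj: "inj_on f H" and im: "f ` H = {0..<16}"
    using f unfolding Group.iso_def bij_betw_def by (auto simp: carrier_integer_mod_group)
  have cl: "x \<otimes>\<^bsub>G\<^esub> y \<in> H" if "x \<in> H" "y \<in> H" for x y using subgroup.m_closed[OF H that] .
  have HG: "x \<in> carrier G" if "x \<in> H" for x using subgroup.mem_carrier[OF H that] .
  have 1: "\<one>\<^bsub>G\<^esub> \<in> H" by (rule subgroup.one_closed[OF H])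
  \<comment> \<open>The identity is idempotent, and 0 is the only idempotent modulo 16.\<close>
  have f1: "f \<one>\<^bsub>G\<^esub> = 0"
  proof -
    have "f \<one>\<^bsub>G\<^esub> = (f \<one>\<^bsub>G\<^esub> + f \<one>\<^bsub>G\<^esub>) mod 16" using hom[OF 1 1] unfolding one .
    moreover have "f \<one>\<^bsub>G\<^esub> \<in> {0..<16}" using im 1 by blast
    moreover have "u = 0" if "u = (u + u) mod 16" "u \<in> {0..<16}" for u :: int using that by simp presburger
    ultimately show ?thesis by blast
  qed
  have "1 \<in> f ` H" unfolding im by simp
  then obtain P1 where P1: "P1 \<in> H" "f P1 = 1" by (elim imageE) simp
  define P2 where "P2 = P1 \<otimes>\<^bsub>G\<^esub> P1"
  have P2: "P2 \<in> H" "f P2 = 2" unfolding P2_def using cl[OF P1(1) P1(1)] hom[OF P1(1) P1(1)] P1(2) by simp_all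
  define P3 where "P3 = P2 \<otimes>\<^bsub>G\<^esub> P2"
  have P3: "P3 \<in> H" "f P3 = 4" unfolding P3_def using cl[OF P2(1) P2(1)] hom[OF P2(1) P2(1)] P2(2) by simp_all
  define P4 where "P4 = P3 \<otimes>\<^bsub>G\<^esub> P3"
  have P4: "P4 \<in> H" "f P4 = 8" unfolding P4_def using cl[OF P3(1) P3(1)] hom[OF P3(1) P3(1)] P3(2) by simp_all
  have "f (P4 \<otimes>\<^bsub>G\<^esub> P4) = f \<one>\<^bsub>G\<^esub>" using hom[OF P4(1) P4(1)] P4(2) f1 by simp
  hence "P4 \<otimes>\<^bsub>G\<^esub> P4 = \<one>\<^bsub>G\<^esub>" by (rule inj_onD[OF inj _ cl[OF P4(1) P4(1)] 1])
  moreover have "P4 \<noteq> \<one>\<^bsub>G\<^esub>" using f1 P4(2) by auto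
  ultimately show ?thesis
    by (rule that[OF HG[OF P1(1)] HG[OF P2(1)] HG[OF P3(1)] HG[OF P4(1)] P2_def[symmetric] P3_def[symmetric] P4_def[symmetric]])
qed

text \<open>The parameters of the curve \<open>y^2 = x^3 + A x^2 + x\<close> on which a point with abscissa \<open>x\<close> has order 16: its double
  has abscissa \<open>h^2\<close>, and its multiple by four has abscissa \<open>1\<close>.\<close>

lemma (in quadratic_subfield) parameter_rational:
  assumes K: "h \<in> K" "x \<in> K" and h: "h \<noteq> 0" "h^4 \<noteq> 1" and x: "x \<noteq> 0" "x^2 \<noteq> 1"
    and A: "4*(h^6 + A*h^4 + h^2) = (h^4 - 1)^2" and xh: "4*h^2*(x^3 + A*x^2 + x) = (x^2-1)^2"
  shows "h \<in> \<rat>"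
proof -
  define w where "w = x + 1/x"
  have wx: "w*x = x^2 + 1" using x(1) unfolding w_def by (simp add: field_simps power2_eq_square)
  have "x^2*(4*h^2*(w + A)) = x^2*(w^2 - 4)"
  proof -
    have "x^2*(4*h^2*(w + A)) = 4*h^2*(x*(w*x) + A*x^2)" by (simp add: algebra_simps power2_eq_square)
    also have "\<dots> = (x^2-1)^2" unfolding wx xh[symmetric] by (simp add: algebra_simps power2_eq_square power3_eq_cube)
    also have "\<dots> = (w*x)^2 - 4*x^2" unfolding wx by (simp add: algebra_simps power2_eq_square)
    finally show ?thesis by (simp add: algebra_simps power2_eq_square)
  qed
  hence w: "4*h^2*(w + A) = w^2 - 4" using x(1) by simp
  \<comment> \<open>Completing the square in \<open>w\<close>: by \<open>A\<close> the discriminant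
    is a square up to the factor \<open>h^2\<close>, and the two roots correspond to
    \<open>h\<close> and \<open>-h\<close>.\<close>
  have "h^2*(h*(w - 2*h^2))^2 = h^2*(h^4-1)^2"
  proof -
    have "h^2*(h*(w - 2*h^2))^2 - h^2*(h^4-1)^2 = - (h^4*(4*h^2*(w+A) - (w^2-4))) + h^2*(4*(h^6+A*h^4+h^2) - (h^4-1)^2)"
      by Groebner_Basis.algebra
    thus ?thesis unfolding w A by simp
  qed
  hence "(h*(w - 2*h^2))^2 = (h^4-1)^2" using h(1) by simp
  hence "h*(w - 2*h^2) = h^4-1 \<or> h*(w - 2*h^2) = -(h^4-1)" by (simp add: power2_eq_iff)
  then obtain g where g: "g = h \<or> g = -h" and gw: "g*(w - 2*g^2) = g^4-1"
  proof
    assume "h*(w - 2*h^2) = h^4-1"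
    thus thesis by (intro that[of h]) auto
  next
    assume "h*(w - 2*h^2) = -(h^4-1)"
    thus thesis by (intro that[of "-h"]) (auto simp: algebra_simps)
  qed
  have gK: "g \<in> K" using g K(1) minus by blast
  have g0: "g \<noteq> 0" "g^4 \<noteq> 1" using g h by auto
  have "g \<noteq> -1" "g \<noteq> 1" "g^2 + 1 \<noteq> 0"
  proof -
    show "g \<noteq> -1" "g \<noteq> 1" using g0(2) by auto
    show "g^2 + 1 \<noteq> 0"
    proof
      assume "g^2 + 1 = 0"
      hence "g^2 = -1" by (simp add: add_eq_0_iff2)
      moreover have "g^4 = (g^2)^2" by (simp add: power_even_eq)
      ultimately show False using g0(2) by simp
    qed
  qed
  note g1 = this
  have g1': "1 + g \<noteq> 0" using g1(1) by (metis add.commute add_eq_0_iff)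
  have w2: "g*(w+2) = (g^2+1)*(g^2+2*g-1)" "g*(w-2) = (g^2-1)*(g+1)^2"
    using gw by (simp_all add: algebra_simps power2_eq_square power4_eq_xxxx)
  have "g \<in> \<rat>"
  proof (rule ccontr)
    assume irr: "g \<notin> \<rat>"
    \<comment> \<open>This substitution sends the branch points 1 and -1 of the sextic
      \<open>(g^2+1)*(g^2+2*g-1)*(g^2-1)\<close> to 0 and infinity and preserves the other two
      factors up to scalars, which gives the quintic.\<close>
    define z where "z = (1-g)/(1+g)"
    define t where "t = (x - 1/x)*g/(1+g)"
    have zg: "z*(1+g) = 1 - g" unfolding z_def using g1' by simp
    have "1 - z = g*(2/(1+g))" using g1' unfolding z_def by (simp add: field_simps)
    moreover have z1: "1 + z = 2/(1+g)" using g1' unfolding z_def by (simp add: field_simps)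
    ultimately have gz: "g = (1-z)/(1+z)" if "1 + z \<noteq> 0" using that by simp
    have "z \<notin> \<rat>"
    proof
      assume z: "z \<in> \<rat>"
      have "1 + z \<noteq> 0" unfolding z1 using g1' by simp
      hence "g \<in> \<rat>" using gz z by simp
      thus False using irr by blast
    qed
    moreover have "z \<in> K" unfolding z_def using gK by (intro closed)
    moreover have "2*t/(1+g)^3 \<in> K" unfolding t_def using gK K by (intro closed)
    moreover have "(2*t/(1+g)^3)^2 = z^5 + 2*z^4 + 2*z^2 - z"
    proof -
      have "((x-1/x)*g)^2 = (g*(w+2))*(g*(w-2))"
      proof -
        have "(x-1/x)^2 = w^2 - 4" unfolding w_def using x(1) by (simp add: field_simps power2_eq_square)
        hence "((x-1/x)*g)^2 = (w^2 - 4)*g^2" by (simp only: power_mult_distrib)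
        thus ?thesis by (simp add: algebra_simps power2_eq_square)
      qed
      also have "\<dots> = (1+g)^2*((g^2+1)*(g^2+2*g-1)*(g^2-1))" unfolding w2 by (simp add: algebra_simps power2_eq_square)
      finally have t: "t^2 = (g^2+1)*(g^2+2*g-1)*(g^2-1)" unfolding t_def power_divide using g1' by (simp add: field_simps)
      have "(1+g)^6*(z^5 + 2*z^4 + 2*z^2 - z) = (1+g)*((1-g)^5) + 2*(1+g)^2*(1-g)^4 + 2*(1+g)^4*(1-g)^2 - (1+g)^5*(1-g)"
      proof -
        have "(1+g)^6*(z^5 + 2*z^4 + 2*z^2 - z) = (1+g)*(z*(1+g))^5 + 2*(1+g)^2*(z*(1+g))^4 + 2*(1+g)^4*(z*(1+g))^2 - (1+g)^5*(z*(1+g))"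
          by Groebner_Basis.algebra
        thus ?thesis unfolding zg .
      qed
      also have "\<dots> = 4*t^2" unfolding t by Groebner_Basis.algebra
      finally have "4*t^2 = (1+g)^6*(z^5 + 2*z^4 + 2*z^2 - z)" ..
      moreover have "((1+g)^3)^2 = (1+g)^6" by (simp flip: power_mult)
      ultimately show ?thesis using g1' by (simp add: power_divide power_mult_distrib)
    qed
    ultimately have "z^2 + 1 = 0 \<or> z^2 + 2*z - 1 = 0" by (intro curve_points)
    thus False
    proof
      assume z: "z^2 + 1 = 0"
      have "(1+g)^2*(z^2+1) = (z*(1+g))^2 + (1+g)^2" by Groebner_Basis.algebra
      also have "\<dots> = 2*(g^2+1)" unfolding zg by (simp add: algebra_simps power2_eq_square)
      finally have "2*(g^2+1) = 0" unfolding z by simp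
      thus False using g1(3) by (simp only: mult_eq_0_iff) simp
    next
      assume z: "z^2 + 2*z - 1 = 0"
      have "(1+g)^2*(z^2+2*z-1) = -2*(g^2+2*g-1)"
      proof -
        have "(1+g)^2*(z^2+2*z-1) = (z*(1+g))^2 + 2*(z*(1+g))*(1+g) - (1+g)^2" by Groebner_Basis.algebra
        thus ?thesis unfolding zg by (simp add: algebra_simps power2_eq_square)
      qed
      hence "-2*(g^2+2*g-1) = 0" unfolding z by simp
      hence "g^2+2*g-1 = 0" by (simp only: mult_eq_0_iff) simp
      hence "w + 2 = 0" using w2(1) g0 by simp
      hence "w*x + 2*x = 0" by (metis distrib_right mult_zero_left)
      hence "(x+1)^2 = 0" unfolding wx by (simp add: algebra_simps power2_eq_square)
      hence "x = -1" by (simp add: add_eq_0_iff2)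
      thus False using x(2) by simp
    qed
  qed
  thus ?thesis using g by auto
qed

theorem theorem1:
  fixes K :: "complex set" and E :: weier
  assumes "quadratic_field K"
    and "elliptic_over K E"
    and "\<exists>H. subgroup H (rat_points K E) \<and>
           (rat_points K E)\<lparr>carrier := H\<rparr> \<cong> integer_mod_group 16"
  shows "\<exists>E0. elliptic_over \<rat> E0 \<and> iso_over K E0 E"
proof -
  obtain d \<delta> where "quadratic_subfield K d \<delta>" by (rule quadratic_field_subfield[OF assms(1)])
  then interpret quadratic_subfield K d \<delta> .
  obtain a1 a2 a3 a4 a6 where E: "E = Weier a1 a2 a3 a4 a6" by (cases E)
  have aK: "a1 \<in> K" "a2 \<in> K" "a3 \<in> K" "a4 \<in> K" and disc: "wdisc E \<noteq> 0" using assms(2) unfolding elliptic_over_def E by auto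
  obtain H where H: "subgroup H (rat_points K E)" "(rat_points K E)\<lparr>carrier := H\<rparr> \<cong> integer_mod_group 16" using assms(3) by blast
  have G: "\<one>\<^bsub>rat_points K E\<^esub> = None" "P \<otimes>\<^bsub>rat_points K E\<^esub> Q = wadd E P Q"
    "P \<in> carrier (rat_points K E) \<longleftrightarrow> on_curve E P \<and> (\<forall>x y. P = Some (x, y) \<longrightarrow> x \<in> K \<and> y \<in> K)" for P Q
    by (simp_all add: rat_points_def)
  obtain P1 P2 P3 P4 where P: "P1 \<in> carrier (rat_points K E)" "P2 \<in> carrier (rat_points K E)"
    "P3 \<in> carrier (rat_points K E)" "P4 \<in> carrier (rat_points K E)"
    and dbl: "wadd E P1 P1 = P2" "wadd E P2 P2 = P3" "wadd E P3 P3 = P4" "wadd E P4 P4 = None" and P4: "P4 \<noteq> None"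
    by (rule exists_order_16[OF H, unfolded G]) (simp_all add: G)
  have none: "wadd E None None = None" by simp
  obtain x4 y4 where 4: "P4 = Some (x4,y4)" using P4 by auto
  obtain x3 y3 where 3: "P3 = Some (x3,y3)" using 4 dbl(3) none by (cases P3) auto
  obtain x2 y2 where 2: "P2 = Some (x2,y2)" using 3 dbl(2) none by (cases P2) auto
  obtain x1 y1 where 1: "P1 = Some (x1,y1)" using 2 dbl(1) none by (cases P1) auto
  have pK: "x1 \<in> K" "y1 \<in> K" "x2 \<in> K" "y2 \<in> K" "x4 \<in> K" and on: "wpoly E x1 y1 = 0" "wpoly E x2 y2 = 0" "wpoly E x3 y3 = 0" "wpoly E x4 y4 = 0"
    using P unfolding G 1 2 3 4 by auto
  note D = dbl[unfolded 1 2 3 4 E, THEN wadd_double_cases, unfolded Let_def]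
  interpret two_torsion a1 a2 a3 a4 a6 x4 y4
    using on(4) D(4) unfolding E by unfold_locales auto
  have Y: "Y x1 y1 \<noteq> 0" "Y x2 y2 \<noteq> 0" "Y x3 y3 \<noteq> 0" using D(1-3) by (auto simp: Y_def field_simps)
  note X' = double_X[OF _ _ HOL.refl]
  have X2: "X x2 = ((X x1^2 - B)/(2*Y x1 y1))^2" by (rule X'[OF on(1)[unfolded E] Y(1)]) (use D(1) in auto)
  have X3: "X x3 = ((X x2^2 - B)/(2*Y x2 y2))^2" by (rule X'[OF on(2)[unfolded E] Y(2)]) (use D(2) in auto)
  have "X x4 = ((X x3^2 - B)/(2*Y x3 y3))^2" by (rule X'[OF on(3)[unfolded E] Y(3)]) (use D(3) in auto)
  hence XB: "X x3^2 = B" using Y(3) by (simp add: X_def)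
  have B: "B \<noteq> 0" "A^2 - 4*B \<noteq> 0" using disc unfolding E wdisc_AB by auto
  \<comment> \<open>\<open>e^2\<close> is the abscissa of the multiple by four, and
    \<open>B = e^4\<close>; division by \<open>e^2\<close> therefore normalizes this abscissa and
    \<open>B\<close> to 1 over \<open>K\<close>.\<close>
  define e where "e = (X x2^2 - B)/(2*Y x2 y2)"
  define h where "h = (X x1^2 - B)/(2*Y x1 y1)/e"
  define x where "x = X x1/e^2"
  define C where "C = A/e^2"
  have e: "X x3 = e^2" "B = e^4" using X3 XB unfolding e_def by simp_all
  have e0: "e \<noteq> 0" using e B by auto
  have Ce: "A = C*e^2" using e0 by (simp add: C_def)
  have xe: "X x1 = x*e^2" using e0 by (simp add: x_def)
  have he: "X x2 = h^2*e^2" using e0 unfolding h_def power_divide X2 by simp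
  have curve: "(Y x1 y1)^2 = e^6*(x^3 + C*x^2 + x)" "(Y x2 y2)^2 = e^6*(h^6 + C*h^4 + h^2)"
  proof -
    have "(Y x1 y1)^2 = (x*e^2)^3 + C*e^2*(x*e^2)^2 + e^4*(x*e^2)"
      using on(1) unfolding E wpoly_XY xe Ce e(2) by (simp add: algebra_simps)
    also have "\<dots> = e^6*(x^3 + C*x^2 + x)" by Groebner_Basis.algebra
    finally show "(Y x1 y1)^2 = e^6*(x^3 + C*x^2 + x)" .
    have "(Y x2 y2)^2 = (h^2*e^2)^3 + C*e^2*(h^2*e^2)^2 + e^4*(h^2*e^2)"
      using on(2) unfolding E wpoly_XY he Ce e(2) by (simp add: algebra_simps)
    also have "\<dots> = e^6*(h^6 + C*h^4 + h^2)" by Groebner_Basis.algebra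
    finally show "(Y x2 y2)^2 = e^6*(h^6 + C*h^4 + h^2)" .
  qed
  have y2: "2*Y x2 y2 = e^3*(h^4-1)"
  proof -
    have "e*(2*Y x2 y2) = X x2^2 - B" using Y(2) unfolding e_def by simp
    also have "\<dots> = e*(e^3*(h^4-1))" unfolding he e(2) by Groebner_Basis.algebra
    finally show ?thesis using e0 by simp
  qed
  have y1: "h*(2*Y x1 y1) = e^3*(x^2-1)"
  proof -
    have "e*(h*(2*Y x1 y1)) = X x1^2 - B" using Y(1) e0 unfolding h_def by simp
    also have "\<dots> = e*(e^3*(x^2-1))" unfolding xe e(2) by Groebner_Basis.algebra
    finally show ?thesis using e0 by simp
  qed
  have C: "4*(h^6 + C*h^4 + h^2) = (h^4 - 1)^2"
  proof -
    have "e^6*(4*(h^6 + C*h^4 + h^2)) = (2*Y x2 y2)^2" unfolding power_mult_distrib curve by simp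
    also have "\<dots> = e^6*(h^4-1)^2" unfolding y2 by Groebner_Basis.algebra
    finally show ?thesis using e0 by simp
  qed
  have xh: "4*h^2*(x^3 + C*x^2 + x) = (x^2-1)^2"
  proof -
    have "e^6*(4*h^2*(x^3 + C*x^2 + x)) = (h*(2*Y x1 y1))^2" unfolding power_mult_distrib curve by simp
    also have "\<dots> = e^6*(x^2-1)^2" unfolding y1 by Groebner_Basis.algebra
    finally show ?thesis using e0 by simp
  qed
  have h0: "h \<noteq> 0" using curve(2) Y(2) by auto
  have h4: "h^4 \<noteq> 1" using y2 Y(2) by auto
  have x0: "x \<noteq> 0" using curve(1) Y(1) by auto
  have x1: "x^2 \<noteq> 1" using y1 Y(1) h0 by auto
  have BK: "B \<in> K" unfolding B_def using aK pK by (intro closed)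
  have XK: "X x \<in> K" if "x \<in> K" for x unfolding X_def using that pK by (intro closed)
  have YK: "Y x y \<in> K" if "x \<in> K" "y \<in> K" for x y unfolding Y_def using that aK by (intro closed)
  note XK = XK[OF pK(1)] XK[OF pK(3)] YK[OF pK(1,2)] YK[OF pK(3,4)]
  have eK: "e \<in> K" unfolding e_def using XK BK by (intro closed)
  have "h \<in> K" unfolding h_def using XK BK eK by (intro closed)
  moreover have "x \<in> K" unfolding x_def using XK eK by (intro closed)
  ultimately have hQ: "h \<in> \<rat>" by (rule parameter_rational[OF _ _ h0 h4 x0 x1 C xh])
  have "C = ((h^4-1)^2 - 4*(h^6+h^2))/(4*h^4)" using C h0 by (simp add: field_simps)
  hence CQ: "C \<in> \<rat>" using hQ by simp
  define E0 where "E0 = Weier 0 C 0 1 0"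
  have "wdisc E0 = 16*(C^2-4)" unfolding E0_def by (simp add: Let_def algebra_simps power2_eq_square)
  moreover have "e^4*(C^2-4) = A^2-4*B" unfolding Ce e by (simp add: algebra_simps power2_eq_square power4_eq_xxxx)
  ultimately have "wdisc E0 \<noteq> 0" using B(2) by auto
  hence "elliptic_over \<rat> E0" using CQ unfolding elliptic_over_def E0_def by auto
  moreover have "iso_over K E0 E"
    unfolding iso_over_def
  proof (intro exI conjI allI)
    \<comment> \<open>\<open>e\<close> is the scaling and \<open>x4\<close> the translation; the
      other two parameters undo the completion of the square in \<open>Y\<close>.\<close>
    show "e \<in> K" "x4 \<in> K" "e \<noteq> 0" by (rule eK, rule pK, rule e0)
    show "-a1/2 \<in> K" using aK by (intro closed)
    show "-(a1*x4+a3)/2 \<in> K" using aK pK by (intro closed)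
    fix x y
    have XY: "X (e^2*x+x4) = e^2*x" "Y (e^2*x+x4) (e^3*y + -a1/2*e^2*x + -(a1*x4+a3)/2) = e^3*y"
      unfolding X_def Y_def by (simp_all add: field_simps)
    show "wpoly E (e^2*x+x4) (e^3*y + -a1/2*e^2*x + -(a1*x4+a3)/2) = e^6 * wpoly E0 x y"
      unfolding E wpoly_XY XY unfolding E0_def wpoly.simps Ce e(2)
      by Groebner_Basis.algebra
  qed
  ultimately show ?thesis by blast
qed

end
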